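(* Let $n\ge1$ and $A,B\subseteq[1;n]$ with $B\subseteq A$. Then $\Gamma^q_A$ and $\Gamma^q_B$ commute in $\mathfrak{osp}_q(1|2)^{\otimes n}$.
   Context: Let $\mathbb{K}$ be a field, $q\in\mathbb{K}$ not a root of unity, with a fixed square root $q^{1/2}\in\mathbb{K}$. $\mathfrak{osp}_q(1|2)$ is the associative $\mathbb{K}$-algebra generated by $A_+,A_-,K,K^{-1},P$ with relations $KA_+K^{-1}=q^{1/2}A_+$, $KA_-K^{-1}=q^{-1/2}A_-$, $A_+A_-+A_-A_+=\frac{K^2-K^{-2}}{q^{1/2}-q^{-1/2}}$, $PA_\pm+A_\pm P=0$, $PK=KP$, $PK^{-1}=K^{-1}P$, $KK^{-1}=K^{-1}K=1$, $P^2=1$. Its Casimir element is $\Gamma^q=\big(-A_+A_-+\frac{q^{-1/2}K^2-q^{1/2}K^{-2}}{q-q^{-1}}\big)P$. The coproduct is the algebra morphism $\Delta$ with $\Delta(A_\pm)=A_\pm\otimes KP+K^{-1}\otimes A_\pm$, $\Delta(K^{\pm1})=K^{\pm1}\otimes K^{\pm1}$, $\Delta(P)=P\otimes P$. Let $\mathcal{I}_R$ be the subalgebra generated by $A_+K,A_-K,K^2P,\Gamma^q$ and $\tau_R:\mathcal{I}_R\to\mathfrak{osp}_q(1|2)\otimes\mathcal{I}_R$ the algebra morphism with $\tau_R(A_-K)=K^2P\otimes A_-K$, $\tau_R(A_+K)=K^{-2}P\otimes A_+K+q^{-1/2}(q-q^{-1})A_+^2P\otimes A_-K+q^{-1/2}(q^{1/2}-q^{-1/2})A_+K^{-1}P\otimes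 K^2P+q^{-1/2}(q-q^{-1})A_+K^{-1}P\otimes\Gamma^q$, $\tau_R(K^2P)=1\otimes K^2P-(q-q^{-1})A_+K\otimes A_-K$, $\tau_R(\Gamma^q)=1\otimes\Gamma^q$. For integers $i\le j$, $[i;j]=\{i,\dots,j\}$; $1^{\otimes\ell}\otimes\varphi\otimes1^{\otimes m}$ applies $\varphi$ to tensor position $\ell+1$. $\Gamma^q_\varnothing$ is a scalar, and for $A=\{a_1<\dots<a_m\}\subseteq[1;n]$, $\Gamma^q_A=1^{\otimes(a_1-1)}\otimes(\mu_m\circ\cdots\circ\mu_2)(\Gamma^q)\otimes1^{\otimes(n-a_m)}\in\mathfrak{osp}_q(1|2)^{\otimes n}$ with $\mu_i=(1^{\otimes(a_i-a_1-1)}\otimes\tau_R)\circ\cdots\circ(1^{\otimes(a_{i-1}-a_1+1)}\otimes\tau_R)\circ(1^{\otimes(a_{i-1}-a_1)}\otimes\Delta)$ (no $\tau_R$ factors when $a_i=a_{i-1}+1$). *)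

theory Defs
  imports Main
begin

text \<open>
  Concrete model of the tensor powers of osp_q(1|2) by generators and relations.
  Letters are pairs (i, g): generator g in tensor position i (0-based, so paper
  position i+1).  Besides the five generators A_+, A_-, K, K^-1, P we use four
  auxiliary letters XAp, XAm, XKP, XG standing for A_+K, A_-K, K^2P and the
  Casimir; the relations identify them with their defining expressions.
  Noncommutative polynomials are finitely supported functions on words.
  The algebra osp_q(1|2)^(tensor k) is the free algebra on letters with
  positions < k modulo the two-sided ideal osp_ideal s k (s = q^(1/2)).
\<close>

datatype sym = Ap | Am | Kp | Km | Pp | XAp | XAm | XKP | XG

type_synonym 'k ncp = "(nat \<times> sym) list \<Rightarrow> 'k"

definition nzero :: "'k::field ncp" where "nzero = (\<lambda>w. 0)"
definition nconst :: "'k::field \<Rightarrow> 'k ncp" where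
  "nconst c = (\<lambda>w. if w = [] then c else 0)"
definition none :: "'k::field ncp" where "none = nconst 1"
definition nadd :: "'k::field ncp \<Rightarrow> 'k ncp \<Rightarrow> 'k ncp" where
  "nadd f g = (\<lambda>w. f w + g w)"
definition nsub :: "'k::field ncp \<Rightarrow> 'k ncp \<Rightarrow> 'k ncp" where
  "nsub f g = (\<lambda>w. f w - g w)"
definition nmul :: "'k::field ncp \<Rightarrow> 'k ncp \<Rightarrow> 'k ncp" where
  "nmul f g = (\<lambda>w. \<Sum>i\<le>length w. f (take i w) * g (drop i w))"
definition nlet :: "nat \<Rightarrow> sym \<Rightarrow> 'k::field ncp" where
  "nlet i g = (\<lambda>w. if w = [(i,g)] then 1 else 0)"
definition nmon :: "'k::field \<Rightarrow> (nat \<times> sym) list \<Rightarrow> 'k ncp" where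
  "nmon c ls = (\<lambda>w. if w = ls then c else 0)"
definition nprod :: "'k::field ncp list \<Rightarrow> 'k ncp" where
  "nprod fs = foldr nmul fs none"
definition nsum :: "'k::field ncp list \<Rightarrow> 'k ncp" where
  "nsum fs = foldr nadd fs nzero"

definition nsubst :: "((nat \<times> sym) \<Rightarrow> 'k::field ncp) \<Rightarrow> 'k ncp \<Rightarrow> 'k ncp" where
  "nsubst \<phi> f = (\<lambda>v. \<Sum>w | f w \<noteq> 0. f w * nprod (map \<phi> w) v)"

definition ncp_in :: "nat \<Rightarrow> 'k::field ncp \<Rightarrow> bool" where
  "ncp_in k f \<longleftrightarrow> finite {w. f w \<noteq> 0} \<and> (\<forall>w. f w \<noteq> 0 \<longrightarrow> (\<forall>(i,g)\<in>set w. i < k))"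

definition gamma_expr :: "'k::field \<Rightarrow> nat \<Rightarrow> 'k ncp" where
  "gamma_expr s i = nsum
     [nmon (-1) [(i,Ap),(i,Am),(i,Pp)],
      nmon ((1/s) / (s^2 - 1/s^2)) [(i,Kp),(i,Kp),(i,Pp)],
      nmon (- s / (s^2 - 1/s^2)) [(i,Km),(i,Km),(i,Pp)]]"

fun expand :: "'k::field \<Rightarrow> nat \<Rightarrow> sym \<Rightarrow> 'k ncp" where
  "expand s i XAp = nmon 1 [(i,Ap),(i,Kp)]"
| "expand s i XAm = nmon 1 [(i,Am),(i,Kp)]"
| "expand s i XKP = nmon 1 [(i,Kp),(i,Kp),(i,Pp)]"
| "expand s i XG = gamma_expr s i"
| "expand s i g = nlet i g"

definition osp_rels :: "'k::field \<Rightarrow> nat \<Rightarrow> 'k ncp set" where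
  "osp_rels s i =
    {nsub (nmon 1 [(i,Kp),(i,Ap),(i,Km)]) (nmon s [(i,Ap)]),
     nsub (nmon 1 [(i,Kp),(i,Am),(i,Km)]) (nmon (1/s) [(i,Am)]),
     nsub (nadd (nmon 1 [(i,Ap),(i,Am)]) (nmon 1 [(i,Am),(i,Ap)]))
          (nadd (nmon (1/(s - 1/s)) [(i,Kp),(i,Kp)]) (nmon (-1/(s - 1/s)) [(i,Km),(i,Km)])),
     nadd (nmon 1 [(i,Pp),(i,Ap)]) (nmon 1 [(i,Ap),(i,Pp)]),
     nadd (nmon 1 [(i,Pp),(i,Am)]) (nmon 1 [(i,Am),(i,Pp)]),
     nsub (nmon 1 [(i,Pp),(i,Kp)]) (nmon 1 [(i,Kp),(i,Pp)]),
     nsub (nmon 1 [(i,Pp),(i,Km)]) (nmon 1 [(i,Km),(i,Pp)]),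
     nsub (nmon 1 [(i,Kp),(i,Km)]) (nmon 1 []),
     nsub (nmon 1 [(i,Km),(i,Kp)]) (nmon 1 []),
     nsub (nmon 1 [(i,Pp),(i,Pp)]) (nmon 1 [])}
    \<union> {nsub (nlet i g) (expand s i g) | g. g \<in> {XAp, XAm, XKP, XG}}"

inductive_set osp_ideal :: "'k::field \<Rightarrow> nat \<Rightarrow> 'k ncp set" for s :: "'k" and k :: nat where
  gen: "i < k \<Longrightarrow> r \<in> osp_rels s i \<Longrightarrow> r \<in> osp_ideal s k"
| comm: "i < k \<Longrightarrow> j < k \<Longrightarrow> i \<noteq> j \<Longrightarrow>
          nsub (nmon 1 [(i,g),(j,h)]) (nmon 1 [(j,h),(i,g)]) \<in> osp_ideal s k"
| zero: "nzero \<in> osp_ideal s k"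
| add: "x \<in> osp_ideal s k \<Longrightarrow> y \<in> osp_ideal s k \<Longrightarrow> nadd x y \<in> osp_ideal s k"
| mul: "x \<in> osp_ideal s k \<Longrightarrow> ncp_in k a \<Longrightarrow> ncp_in k b \<Longrightarrow> nmul (nmul a x) b \<in> osp_ideal s k"

text \<open>Coproduct on the osp generators, at positions p, p+1.\<close>
fun dgen0 :: "nat \<Rightarrow> sym \<Rightarrow> 'k::field ncp" where
  "dgen0 p Ap = nadd (nmon 1 [(p,Ap),(Suc p,Kp),(Suc p,Pp)]) (nmon 1 [(p,Km),(Suc p,Ap)])"
| "dgen0 p Am = nadd (nmon 1 [(p,Am),(Suc p,Kp),(Suc p,Pp)]) (nmon 1 [(p,Km),(Suc p,Am)])"
| "dgen0 p Kp = nmon 1 [(p,Kp),(Suc p,Kp)]"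
| "dgen0 p Km = nmon 1 [(p,Km),(Suc p,Km)]"
| "dgen0 p Pp = nmon 1 [(p,Pp),(Suc p,Pp)]"
| "dgen0 p _ = nzero"

text \<open>1^(tensor p) tensor Delta tensor 1^(tensor m), on letters.\<close>
definition delta_letter :: "'k::field \<Rightarrow> nat \<Rightarrow> nat \<times> sym \<Rightarrow> 'k ncp" where
  "delta_letter s p l = (case l of (i,g) \<Rightarrow>
     if i < p then nlet i g else if p < i then nlet (Suc i) g
     else nsubst (\<lambda>(j,h). dgen0 p h) (expand s p g))"

definition delta_op :: "'k::field \<Rightarrow> nat \<Rightarrow> 'k ncp \<Rightarrow> 'k ncp" where
  "delta_op s p x = nsubst (delta_letter s p) x"

text \<open>tau_R on the generators A_+K, A_-K, K^2P, Gamma^q of I_R (position p to p, p+1).\<close>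
fun tau_gen :: "'k::field \<Rightarrow> nat \<Rightarrow> sym \<Rightarrow> 'k ncp" where
  "tau_gen s p XAm = nmon 1 [(p,Kp),(p,Kp),(p,Pp),(Suc p,XAm)]"
| "tau_gen s p XAp = nsum
     [nmon 1 [(p,Km),(p,Km),(p,Pp),(Suc p,XAp)],
      nmon ((1/s) * (s^2 - 1/s^2)) [(p,Ap),(p,Ap),(p,Pp),(Suc p,XAm)],
      nmon ((1/s) * (s - 1/s)) [(p,Ap),(p,Km),(p,Pp),(Suc p,XKP)],
      nmon ((1/s) * (s^2 - 1/s^2)) [(p,Ap),(p,Km),(p,Pp),(Suc p,XG)]]"
| "tau_gen s p XKP = nsub (nlet (Suc p) XKP) (nmon (s^2 - 1/s^2) [(p,XAp),(Suc p,XAm)])"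
| "tau_gen s p XG = nlet (Suc p) XG"
| "tau_gen s p _ = nzero"

definition tau_letter :: "'k::field \<Rightarrow> nat \<Rightarrow> nat \<times> sym \<Rightarrow> 'k ncp" where
  "tau_letter s p l = (case l of (i,g) \<Rightarrow>
     if i < p then nlet i g else if p < i then nlet (Suc i) g else tau_gen s p g)"

definition only_X_at :: "nat \<Rightarrow> 'k::field ncp \<Rightarrow> bool" where
  "only_X_at p e \<longleftrightarrow> (\<forall>w. e w \<noteq> 0 \<longrightarrow> (\<forall>g. (p,g) \<in> set w \<longrightarrow> g \<in> {XAp, XAm, XKP, XG}))"

text \<open>1^(tensor p) tensor tau_R : osp^(tensor p) tensor I_R -> osp^(tensor (p+2)),
  applied to (a representative of) x: choose a representative e of the class of x
  written with only I_R-generators in position p, and apply tau_R letterwise.\<close>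
definition tau_op :: "'k::field \<Rightarrow> nat \<Rightarrow> 'k ncp \<Rightarrow> 'k ncp" where
  "tau_op s p x = (SOME y. \<exists>e. ncp_in (Suc p) e \<and> only_X_at p e \<and>
      nsub e x \<in> osp_ideal s (Suc p) \<and> y = nsubst (tau_letter s p) e)"

fun taus :: "'k::field \<Rightarrow> nat \<Rightarrow> nat \<Rightarrow> 'k ncp \<Rightarrow> 'k ncp" where
  "taus s p 0 x = x"
| "taus s p (Suc j) x = taus s (Suc p) j (tau_op s p x)"

text \<open>mu_i, with bp = a_(i-1) - a_1 and b = a_i - a_1.\<close>
definition mu :: "'k::field \<Rightarrow> nat \<Rightarrow> nat \<Rightarrow> 'k ncp \<Rightarrow> 'k ncp" where
  "mu s bp b x = taus s (Suc bp) (b - bp - 1) (delta_op s bp x)"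

definition gam_core :: "'k::field \<Rightarrow> nat list \<Rightarrow> 'k ncp" where
  "gam_core s bs = foldl (\<lambda>x (bp, b). mu s bp b x) (gamma_expr s 0) (zip bs (tl bs))"

definition shift :: "nat \<Rightarrow> 'k::field ncp \<Rightarrow> 'k ncp" where
  "shift d x = nsubst (\<lambda>(i,g). nlet (i + d) g) x"

text \<open>Gamma^q_A for A a finite set of positive integers (paper positions);
  Gamma^q_empty is the scalar c.\<close>
definition GammaA :: "'k::field \<Rightarrow> 'k \<Rightarrow> nat set \<Rightarrow> 'k ncp" where
  "GammaA s c A = (if A = {} then nconst c else
     (let as = sorted_list_of_set A; a1 = hd as in
        shift (a1 - 1) (gam_core s (map (\<lambda>a. a - a1) as))))"

end

theory Submission
  imports Defs "HOL-Library.Function_Algebras"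
begin

text \<open>
  Write x, y, z, g for A_+K, (q - 1/q) A_-K, K^2P, (q - 1/q) Gamma.  The coproduct and tau_R act
  on these four elements by 4x4 matrices with entries in the new tensor factor, so
  Gamma_A can be expanded from the left, one tensor position at a time, by a Delta-matrix at each
  position in A and a tau-matrix at each position in a hole.  Let u and w be the quadruples that
  arise in this way for A and for B.  Starting from the relations saying that w_g commutes with all
  u_i, the span of all quadratic relations forced by compatibility with the pairs (Delta, Delta),
  (Delta, tau), (tau, tau) is 16-dimensional (a reflection equation).  These relations hold for u = w,
  and also at the last position of B when A continues to its right, hence by induction
  for all u and w with B contained in A.

  As tau_R is applied to a chosen representative, it has to be shown independent of that
  choice.  Words in x, y, z, g reduce to combinations of x^n z^b g^c and y^n z^b g^c using only
  relations that tau_R preserves, and these monomials are independent because they send a vector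
  of a suitable osp_q(1|2)-module to distinct basis vectors.
\<close>

section \<open>Noncommutative polynomials\<close>

text \<open>Each coaction changes only the last tensor factor: it replaces the quadruple v there by
  M v, with the entries of M in that factor and v one place further right. Iteration multiplies
  matrices, and regrouping the product lets the same element grow by prepending positions, so that
  Gamma_A and Gamma_B can be compared position by position. Commutation of u_g and w_g alone is no
  usable induction hypothesis, since a further position mixes all products u_i w_j. The relations in
  \<open>exch\<close> rewrite each u_i w_j as a combination of products w_k u_l with scalar
  coefficients. The pair (tau_R, Delta) does not occur: it would be an element of B in a hole of A.

  The obstacle with the representatives is that a difference of two of them, though written in
  generators of I_R, may belong to the ideal only by way of relations involving letters on which
  tau_R has no value. A derivation of that membership therefore cannot be translated, and the module
  is used to detect zero instead.\<close>

definition nfin :: "'k::field ncp \<Rightarrow> bool" where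
  "nfin f \<longleftrightarrow> finite {w. f w \<noteq> 0}"

lemma nmul_Nil: "nmul f g [] = f [] * g []"
  by (simp add: nmul_def)

text \<open>Splits off the term in which the left factor takes the empty prefix. The rest is a
  product whose first factor is the left derivative of \<open>f\<close> by the letter
  \<open>l\<close>, which is why inductions on words generalise over \<open>f\<close>.\<close>

lemma nmul_Cons: "nmul f g (l # w) = f [] * g (l # w) + nmul (\<lambda>v. f (l # v)) g w"
  by (simp add: nmul_def sum.atMost_Suc_shift del: sum.atMost_Suc)

lemma nmul_nadd_left: "nmul (nadd f g) h = nadd (nmul f h) (nmul g h)"
  by (simp add: nmul_def nadd_def fun_eq_iff distrib_right sum.distrib)

lemma nmul_nadd_right: "nmul h (nadd f g) = nadd (nmul h f) (nmul h g)"
  by (simp add: nmul_def nadd_def fun_eq_iff distrib_left sum.distrib)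

lemma nmul_nsub_left: "nmul (nsub f g) h = nsub (nmul f h) (nmul g h)"
  by (simp add: nmul_def nsub_def fun_eq_iff left_diff_distrib sum_subtractf)

lemma nmul_nsub_right: "nmul h (nsub f g) = nsub (nmul h f) (nmul h g)"
  by (simp add: nmul_def nsub_def fun_eq_iff right_diff_distrib sum_subtractf)

lemma nmul_scale_left: "nmul (\<lambda>v. c * f v) g = (\<lambda>w. c * nmul f g w)"
  by (simp add: nmul_def sum_distrib_left mult.assoc)

lemma nmul_assoc: "nmul (nmul f g) h = nmul f (nmul g h)"
proof
  fix w show "nmul (nmul f g) h w = nmul f (nmul g h) w"
  proof (induction w arbitrary: f)
    case Nil
    show ?case by (simp add: nmul_Nil)
  next
    case (Cons l w)
    have "(\<lambda>v. nmul f g (l # v)) = nadd (\<lambda>v. f [] * g (l # v)) (nmul (\<lambda>v. f (l # v)) g)"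
      by (simp add: nmul_Cons nadd_def)
    note step = this
    have "nmul (nmul f g) h (l # w)
        = f [] * g [] * h (l # w) + (f [] * nmul (\<lambda>v. g (l # v)) h w
          + nmul (nmul (\<lambda>v. f (l # v)) g) h w)"
      by (simp add: nmul_Cons[of "nmul f g"] step nmul_Nil nmul_nadd_left nmul_scale_left)
        (simp add: nadd_def)
    also have "\<dots> = nmul f (nmul g h) (l # w)"
      by (simp add: nmul_Cons Cons.IH algebra_simps)
    finally show ?case .
  qed
qed

lemma nmul_nconst_left: "nmul (nconst c) f = (\<lambda>w. c * f w)"
proof
  fix w show "nmul (nconst c) f w = c * f w"
  proof (cases w)
    case (Cons l v)
    have "(\<lambda>v. nconst c (l # v)) = (\<lambda>v. 0 * nzero v)" by (simp add: nconst_def)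
    then have "nmul (\<lambda>v. nconst c (l # v)) f v = 0"
      by (simp only: nmul_scale_left) simp
    then show ?thesis using Cons by (simp add: nmul_Cons nconst_def)
  qed (simp add: nmul_Nil nconst_def)
qed

lemma nmul_nconst_right: "nmul f (nconst c) = (\<lambda>w. c * f w)"
proof
  fix w show "nmul f (nconst c) w = c * f w"
    by (induction w arbitrary: f) (auto simp: nmul_Nil nmul_Cons nconst_def)
qed

lemma nmul_none [simp]: "nmul none f = f" "nmul f none = f"
  by (simp_all add: none_def nmul_nconst_left nmul_nconst_right)

lemma nmon_Nil: "nmon c [] = nconst c"
  by (simp add: nmon_def nconst_def)

lemma nlet_eq_nmon: "nlet i g = nmon 1 [(i, g)]"
  by (simp add: nlet_def nmon_def)

lemma nmul_nmon: "nmul (nmon c u) (nmon d v) = nmon (c * d) (u @ v)"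
proof
  fix w show "nmul (nmon c u) (nmon d v) w = nmon (c * d) (u @ v) w"
  proof (induction w arbitrary: u)
    case Nil
    show ?case by (auto simp: nmul_Nil nmon_def)
  next
    case (Cons l w)
    show ?case
    proof (cases u)
      case Nil
      then show ?thesis by (simp add: nmon_Nil nmul_nconst_left) (simp add: nmon_def)
    next
      case u: (Cons l' u')
      have "(\<lambda>v. nmon c u (l # v)) = (if l = l' then nmon c u' else (\<lambda>v. 0 * nzero v))"
        using u by (auto simp: nmon_def)
      then have "nmul (\<lambda>v. nmon c u (l # v)) (nmon d v) w = (if l = l' then nmon (c * d) (u' @ v) w else 0)"
        using Cons.IH[of u'] by (cases "l = l'") (simp_all add: nmul_def)
      then show ?thesis using u by (auto simp: nmul_Cons nmon_def)
    qed
  qed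
qed

lemma nmul_apply_neq0: "nmul f g w \<noteq> 0 \<Longrightarrow> \<exists>u v. w = u @ v \<and> f u \<noteq> 0 \<and> g v \<noteq> 0"
  unfolding nmul_def by (metis (no_types, lifting) append_take_drop_id mult_eq_0_iff sum.neutral)

lemma ncp_in_nfin: "ncp_in k f \<Longrightarrow> nfin f"
  by (simp add: ncp_in_def nfin_def)

lemma ncp_in_mono: "ncp_in k f \<Longrightarrow> k \<le> l \<Longrightarrow> ncp_in l f"
  unfolding ncp_in_def by fastforce

lemma nfin_ncp_in: "nfin f \<Longrightarrow> \<exists>k. ncp_in k f"
proof -
  assume f: "nfin f"
  let ?L = "\<Union>w\<in>{w. f w \<noteq> 0}. set w"
  have "finite (fst ` ?L)" using f by (simp add: nfin_def)
  then obtain k where k: "\<forall>i\<in>fst ` ?L. i < k" by (meson finite_nat_set_iff_bounded)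
  have "ncp_in k f" unfolding ncp_in_def using f k by (fastforce simp: nfin_def)
  then show ?thesis ..
qed

lemma nfin_nmon [simp]: "nfin (nmon c u)"
  by (rule ncp_in_nfin[of "Suc (Max (insert 0 (fst ` set u)))"])
     (auto simp: ncp_in_def nmon_def less_Suc_eq_le intro!: Max_ge split: if_splits intro: rev_image_eqI)

lemma ncp_in_nmon: "(\<And>i g. (i, g) \<in> set u \<Longrightarrow> i < k) \<Longrightarrow> ncp_in k (nmon c u)"
  using nfin_nmon[of c u] by (auto simp: ncp_in_def nfin_def nmon_def split: if_splits)

lemma ncp_in_nconst [simp]: "ncp_in k (nconst c)"
  unfolding nmon_Nil[symmetric] by (rule ncp_in_nmon) simp

lemma ncp_in_none [simp]: "ncp_in k none"
  by (simp add: none_def)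

lemma ncp_in_nlet: "i < k \<Longrightarrow> ncp_in k (nlet i g)"
  by (auto simp: nlet_eq_nmon intro!: ncp_in_nmon)

lemma ncp_in_nzero [simp]: "ncp_in k nzero"
  by (simp add: ncp_in_def nzero_def)

lemma ncp_in_nadd [intro]: "ncp_in k f \<Longrightarrow> ncp_in k g \<Longrightarrow> ncp_in k (nadd f g)"
  unfolding ncp_in_def nadd_def
  by (auto intro: finite_subset[of _ "{w. f w \<noteq> 0} \<union> {w. g w \<noteq> 0}"]) (metis add.right_neutral case_prodD add_0)+

lemma ncp_in_nsub [intro]: "ncp_in k f \<Longrightarrow> ncp_in k g \<Longrightarrow> ncp_in k (nsub f g)"
  unfolding ncp_in_def nsub_def
  by (auto intro: finite_subset[of _ "{w. f w \<noteq> 0} \<union> {w. g w \<noteq> 0}"]) (metis diff_self case_prodD)+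

lemma ncp_in_nmul [intro]: assumes "ncp_in k f" "ncp_in k g" shows "ncp_in k (nmul f g)"
proof -
  have "{w. nmul f g w \<noteq> 0} \<subseteq> (\<lambda>(u, v). u @ v) ` ({w. f w \<noteq> 0} \<times> {w. g w \<noteq> 0})"
    by (auto dest!: nmul_apply_neq0)
  moreover have "finite \<dots>" using assms by (auto simp: ncp_in_def)
  ultimately have "finite {w. nmul f g w \<noteq> 0}" by (rule finite_subset)
  then show ?thesis using assms unfolding ncp_in_def
    by (fastforce dest!: nmul_apply_neq0)
qed

lemma ncp_in_nprod: "(\<And>f. f \<in> set fs \<Longrightarrow> ncp_in k f) \<Longrightarrow> ncp_in k (nprod fs)"
  by (induction fs) (auto simp: nprod_def)

lemma nfin_closed [simp]: "nfin nzero" "nfin none" "nfin (nconst c)" "nfin (nlet i g)"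
  by (auto intro!: ncp_in_nfin[of 0] simp: nlet_eq_nmon)

lemma nfin_binop [intro]:
  assumes "nfin f" "nfin g"
  shows "nfin (nadd f g)" "nfin (nsub f g)" "nfin (nmul f g)"
proof -
  obtain k l where "ncp_in k f" "ncp_in l g" using assms nfin_ncp_in by blast
  then have "ncp_in (max k l) f" "ncp_in (max k l) g" by (auto intro: ncp_in_mono)
  then show "nfin (nadd f g)" "nfin (nsub f g)" "nfin (nmul f g)"
    using ncp_in_nfin by blast+
qed

lemma nsum_simps [simp]: "nsum [] = nzero" "nsum (f # fs) = nadd f (nsum fs)"
  by (simp_all add: nsum_def)

lemma nprod_simps [simp]: "nprod [] = none" "nprod (f # fs) = nmul f (nprod fs)"
  by (simp_all add: nprod_def)

lemma nfin_nprod: "(\<And>f. f \<in> set fs \<Longrightarrow> nfin f) \<Longrightarrow> nfin (nprod fs)"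
  by (induction fs) auto

lemma ncp_in_nsubst:
  fixes f :: "'k::field ncp"
  assumes "nfin f" and "\<And>w l. f w \<noteq> 0 \<Longrightarrow> l \<in> set w \<Longrightarrow> ncp_in k (\<phi> l)"
  shows "ncp_in k (nsubst \<phi> f)"
proof -
  have *: "finite W \<Longrightarrow> (\<And>w. w \<in> W \<Longrightarrow> ncp_in k (h w)) \<Longrightarrow> ncp_in k (\<lambda>v. \<Sum>w\<in>W. c w * h w v)"
    for W :: "'c set" and h :: "'c \<Rightarrow> 'k ncp" and c
  proof (induction W rule: finite_induct)
    case empty
    then show ?case using ncp_in_nzero by (simp add: nzero_def)
  next
    case (insert w W)
    have "ncp_in k (nadd (nmul (nconst (c w)) (h w)) (\<lambda>v. \<Sum>w\<in>W. c w * h w v))"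
      using insert by (intro ncp_in_nadd ncp_in_nmul ncp_in_nconst) simp_all
    then show ?case using insert.hyps by (simp add: nmul_nconst_left nadd_def)
  qed
  show ?thesis unfolding nsubst_def
    by (rule *) (use assms in \<open>auto simp: nfin_def intro!: ncp_in_nprod\<close>)
qed

section \<open>Representations of the free algebra\<close>

text \<open>Evaluation in the product ring, substitution of polynomials for letters and the module
  action are all instances, so additivity and multiplicativity are proved once.
  \<open>sm 1 m = m\<close> is not among the axioms because in two of these instances the scalar 1
  acts as the idempotent \<open>sd s 1\<close>.\<close>

locale free_rep =
  fixes sm :: "'k::field \<Rightarrow> 'm::ab_group_add \<Rightarrow> 'm" and \<rho> :: "nat \<times> sym \<Rightarrow> 'm \<Rightarrow> 'm"
  assumes sm_add_left: "sm (a + b) m = sm a m + sm b m"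
    and sm_add_right: "sm a (m + m') = sm a m + sm a m'"
    and sm_mult: "sm (a * b) m = sm a (sm b m)"
    and rho_add: "\<rho> l (m + m') = \<rho> l m + \<rho> l m'"
    and rho_sm: "\<rho> l (sm a m) = sm a (\<rho> l m)"
begin

definition act :: "'k ncp \<Rightarrow> 'm \<Rightarrow> 'm" where
  "act f m = (\<Sum>w | f w \<noteq> 0. sm (f w) (foldr \<rho> w m))"

lemma sm_0: "sm 0 m = 0"
  using sm_add_left[of 0 0 m] by simp

lemma sm_0_right: "sm a 0 = 0"
  using sm_add_right[of a 0 0] by simp

lemma sm_sum: "finite A \<Longrightarrow> sm a (\<Sum>x\<in>A. h x) = (\<Sum>x\<in>A. sm a (h x))"
  by (induction A rule: finite_induct) (auto simp: sm_0_right sm_add_right)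

lemma sm_sum_left: "finite A \<Longrightarrow> sm (\<Sum>x\<in>A. c x) m = (\<Sum>x\<in>A. sm (c x) m)"
  by (induction A rule: finite_induct) (auto simp: sm_0 sm_add_left)

lemma sm_diff_left: "sm (a - b) m = sm a m - sm b m"
  using sm_add_left[of "a - b" b m] by (simp add: algebra_simps)

lemma rho_0: "\<rho> l 0 = 0"
  using rho_add[of l 0 0] by simp

lemma rho_sum: "finite A \<Longrightarrow> \<rho> l (\<Sum>x\<in>A. h x) = (\<Sum>x\<in>A. \<rho> l (h x))"
  by (induction A rule: finite_induct) (auto simp: rho_0 rho_add)

lemma foldr_sum: "finite A \<Longrightarrow> foldr \<rho> w (\<Sum>x\<in>A. sm (c x) (h x)) = (\<Sum>x\<in>A. sm (c x) (foldr \<rho> w (h x)))"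
  by (induction w) (auto simp: rho_sum rho_sm)

lemma act_superset:
  assumes "finite W" "{w. f w \<noteq> 0} \<subseteq> W"
  shows "act f m = (\<Sum>w\<in>W. sm (f w) (foldr \<rho> w m))"
  unfolding act_def by (rule sum.mono_neutral_left) (use assms in \<open>auto simp: sm_0\<close>)

lemma act_nadd: "nfin f \<Longrightarrow> nfin g \<Longrightarrow> act (nadd f g) m = act f m + act g m"
proof -
  assume "nfin f" "nfin g"
  then have W: "finite ({w. f w \<noteq> 0} \<union> {w. g w \<noteq> 0})" (is "finite ?W") by (simp add: nfin_def)
  then show ?thesis
    by (subst (1 2 3) act_superset[of ?W]) (auto simp: nadd_def sm_add_left sum.distrib)
qed

lemma act_nsub: "nfin f \<Longrightarrow> nfin g \<Longrightarrow> act (nsub f g) m = act f m - act g m"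
proof -
  assume "nfin f" "nfin g"
  then have W: "finite ({w. f w \<noteq> 0} \<union> {w. g w \<noteq> 0})" (is "finite ?W") by (simp add: nfin_def)
  then show ?thesis
    by (subst (1 2 3) act_superset[of ?W]) (auto simp: nsub_def sm_diff_left sum_subtractf)
qed

lemma act_nzero: "act nzero m = 0"
  by (simp add: act_def nzero_def)

lemma act_nmon: "act (nmon c u) m = sm c (foldr \<rho> u m)"
  by (subst act_superset[of "{u}"]) (auto simp: nmon_def)

lemma act_0: "act f 0 = 0"
proof -
  have "foldr \<rho> w 0 = 0" for w by (induction w) (auto simp: rho_0)
  then show ?thesis by (simp add: act_def sm_0_right)
qed

lemma act_nmul:
  assumes "nfin f" "nfin g"
  shows "act (nmul f g) m = act f (act g m)"
proof -
  let ?F = "{w. f w \<noteq> 0}" and ?G = "{w. g w \<noteq> 0}"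
  let ?h = "\<lambda>(u, v). u @ v"
  have fin: "finite ?F" "finite ?G" using assms by (auto simp: nfin_def)
  define W where "W = ?h ` (?F \<times> ?G)"
  have W: "finite W" using fin by (simp add: W_def)
  \<comment> \<open>A cut position in \<open>w\<close> is the same as a factorisation of
    \<open>w\<close> into two words, so the coefficient is a sum over a fibre of concatenation;
    \<open>sum.image_gen\<close> afterwards joins the fibres.\<close>
  have coeff: "nmul f g w = (\<Sum>(u, v)\<in>{x \<in> ?F \<times> ?G. ?h x = w}. f u * g v)" for w
  proof -
    have "nmul f g w = (\<Sum>(u, v)\<in>(\<lambda>i. (take i w, drop i w)) ` {..length w}. f u * g v)"
      unfolding nmul_def
      by (subst sum.reindex) (auto intro!: inj_onI dest: arg_cong[of _ _ length])
    also have "\<dots> = (\<Sum>(u, v)\<in>{x \<in> ?F \<times> ?G. ?h x = w}. f u * g v)"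
    proof (rule sum.mono_neutral_right)
      have "(u, v) \<in> (\<lambda>i. (take i (u @ v), drop i (u @ v))) ` {..length (u @ v)}" for u v :: "(nat \<times> sym) list"
        by (rule image_eqI[of _ _ "length u"]) auto
      then show "{x \<in> ?F \<times> ?G. ?h x = w} \<subseteq> (\<lambda>i. (take i w, drop i w)) ` {..length w}"
        by auto
    qed auto
    finally show ?thesis .
  qed
  have "act (nmul f g) m = (\<Sum>w\<in>W. sm (nmul f g w) (foldr \<rho> w m))"
    by (rule act_superset[OF W]) (force simp: W_def dest!: nmul_apply_neq0)
  also have "\<dots> = (\<Sum>w\<in>W. \<Sum>x\<in>{x \<in> ?F \<times> ?G. ?h x = w}. sm (f (fst x) * g (snd x)) (foldr \<rho> (?h x) m))"
    by (intro sum.cong refl, subst coeff, subst sm_sum_left) (auto simp: fin case_prod_beta intro!: sum.cong)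
  also have "\<dots> = (\<Sum>x\<in>?F \<times> ?G. sm (f (fst x) * g (snd x)) (foldr \<rho> (?h x) m))"
    unfolding W_def by (rule sum.image_gen[symmetric]) (simp add: fin)
  also have "\<dots> = (\<Sum>u\<in>?F. \<Sum>v\<in>?G. sm (f u * g v) (foldr \<rho> (u @ v) m))"
    by (simp add: sum.cartesian_product case_prod_beta)
  also have "\<dots> = act f (act g m)"
    unfolding act_def by (simp add: foldr_sum fin sm_sum sm_mult)
  finally show ?thesis .
qed

end

section \<open>The ideal\<close>

lemma osp_rels_ncp_in: "r \<in> osp_rels s i \<Longrightarrow> i < k \<Longrightarrow> ncp_in k r"
  by (auto simp: osp_rels_def gamma_expr_def intro!: ncp_in_nsub ncp_in_nadd ncp_in_nmon ncp_in_nlet)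

lemma osp_ideal_ncp_in: "x \<in> osp_ideal s k \<Longrightarrow> ncp_in k x"
proof (induction rule: osp_ideal.induct)
  case (gen i r)
  then show ?case using osp_rels_ncp_in by blast
next
  case (comm i j g h)
  then show ?case by (auto intro!: ncp_in_nsub ncp_in_nmon)
qed auto

lemma osp_ideal_mono: "x \<in> osp_ideal s k \<Longrightarrow> k \<le> l \<Longrightarrow> x \<in> osp_ideal s l"
proof (induction rule: osp_ideal.induct)
  case (gen i r)
  then show ?case by (intro osp_ideal.gen) auto
next
  case (comm i j g h)
  then show ?case by (intro osp_ideal.comm) auto
next
  case (mul x a b)
  then show ?case by (meson ncp_in_mono osp_ideal.mul)
qed (auto intro: osp_ideal.intros)

text \<open>With the union over all numbers of positions, one quotient contains all tensor powers,
  and a coaction, which adds a position, does not leave it. \<open>nideal_cut\<close> leads back to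
  a fixed number of positions.\<close>

definition nideal :: "'k::field \<Rightarrow> 'k ncp set" where
  "nideal s = (\<Union>k. osp_ideal s k)"

lemma nideal_nfin: "x \<in> nideal s \<Longrightarrow> nfin x"
  unfolding nideal_def using osp_ideal_ncp_in ncp_in_nfin by blast

lemma nideal_nzero: "nzero \<in> nideal s"
  unfolding nideal_def using osp_ideal.zero by blast

lemma nideal_nadd: assumes "x \<in> nideal s" "y \<in> nideal s" shows "nadd x y \<in> nideal s"
proof -
  obtain k l where "x \<in> osp_ideal s k" "y \<in> osp_ideal s l"
    using assms unfolding nideal_def by blast
  then have "x \<in> osp_ideal s (max k l)" "y \<in> osp_ideal s (max k l)"
    by (auto intro: osp_ideal_mono)
  then show ?thesis unfolding nideal_def by (intro UN_I[OF UNIV_I] osp_ideal.add)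
qed

lemma nideal_nmul2: assumes "x \<in> nideal s" "nfin a" "nfin b" shows "nmul (nmul a x) b \<in> nideal s"
proof -
  obtain k where k: "x \<in> osp_ideal s k" using assms(1) unfolding nideal_def by blast
  obtain l where l: "ncp_in l a" using nfin_ncp_in[OF assms(2)] ..
  obtain m where m: "ncp_in m b" using nfin_ncp_in[OF assms(3)] ..
  have "x \<in> osp_ideal s (max k (max l m))" "ncp_in (max k (max l m)) a" "ncp_in (max k (max l m)) b"
    by (rule osp_ideal_mono[OF k] ncp_in_mono[OF l] ncp_in_mono[OF m]; simp)+
  then show ?thesis unfolding nideal_def by (intro UN_I[OF UNIV_I] osp_ideal.mul)
qed

lemma nideal_nmul_left: "x \<in> nideal s \<Longrightarrow> nfin a \<Longrightarrow> nmul a x \<in> nideal s"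
  using nideal_nmul2[of x s a none] by simp

lemma nideal_nmul_right: "x \<in> nideal s \<Longrightarrow> nfin a \<Longrightarrow> nmul x a \<in> nideal s"
  using nideal_nmul2[of x s none a] by simp

lemma nsub_eq: "nsub x y = nadd x (nmul (nconst (-1)) y)"
  by (simp add: nmul_nconst_left nsub_def nadd_def)

lemma nideal_nsub: "x \<in> nideal s \<Longrightarrow> y \<in> nideal s \<Longrightarrow> nsub x y \<in> nideal s"
  unfolding nsub_eq by (intro nideal_nadd nideal_nmul_left) simp_all

lemma nsub_self: "nsub x x = nzero"
  by (simp add: nsub_def nzero_def)

lemma nideal_sym: assumes "nsub x y \<in> nideal s" shows "nsub y x \<in> nideal s"
proof -
  have "nsub y x = nsub nzero (nsub x y)"
    by (simp add: nsub_def nzero_def)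
  then show ?thesis using nideal_nsub[OF nideal_nzero assms] by simp
qed

lemma nideal_trans: assumes "nsub x y \<in> nideal s" "nsub y z \<in> nideal s" shows "nsub x z \<in> nideal s"
proof -
  have "nsub x z = nadd (nsub x y) (nsub y z)"
    by (simp add: nsub_def nadd_def)
  then show ?thesis using nideal_nadd[OF assms] by simp
qed

lemma nideal_cong:
  assumes "nsub x x' \<in> nideal s" "nsub y y' \<in> nideal s" "nfin x" "nfin x'" "nfin y" "nfin y'"
  shows "nsub (nadd x y) (nadd x' y') \<in> nideal s"
    and "nsub (nsub x y) (nsub x' y') \<in> nideal s"
    and "nsub (nmul x y) (nmul x' y') \<in> nideal s"
proof -
  have 1: "nsub (nadd x y) (nadd x' y') = nadd (nsub x x') (nsub y y')"
    and 2: "nsub (nsub x y) (nsub x' y') = nsub (nsub x x') (nsub y y')"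
    by (simp_all add: nsub_def nadd_def fun_eq_iff)
  have 3: "nsub (nmul x y) (nmul x' y') = nadd (nmul (nsub x x') y) (nmul x' (nsub y y'))"
    unfolding nmul_nsub_left nmul_nsub_right by (simp add: nsub_def nadd_def fun_eq_iff)
  show "nsub (nadd x y) (nadd x' y') \<in> nideal s" "nsub (nsub x y) (nsub x' y') \<in> nideal s"
    "nsub (nmul x y) (nmul x' y') \<in> nideal s"
    unfolding 1 2 3
    by (intro nideal_nadd[OF assms(1,2)] nideal_nsub[OF assms(1,2)]
        nideal_nadd[OF nideal_nmul_right[OF assms(1,5)] nideal_nmul_left[OF assms(2,4)]])+
qed

section \<open>The product of all quotient algebras\<close>

text \<open>
  A type cannot depend on the parameter s.  The quotient rings for all admissible s are therefore
  combined into their product, which is a type; if no s is admissible, it is the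
  zero ring, so only the classes ring and monoid_mult are available.
\<close>
definition generic :: "'k::field \<Rightarrow> bool" where
  "generic s \<longleftrightarrow> s \<noteq> 0 \<and> s^4 \<noteq> 1"

definition ffin :: "('k::field \<Rightarrow> 'k ncp) \<Rightarrow> bool" where
  "ffin f \<longleftrightarrow> (\<forall>s. nfin (f s))"

lemma ffin_simps [simp]: "ffin (\<lambda>s. nconst (c s))" "ffin (\<lambda>s. nmon (c s) u)" "ffin (\<lambda>s. nlet i g)"
   "ffin (\<lambda>s. nzero)" "ffin (\<lambda>s. none)"
  by (simp_all add: ffin_def)

lemma ffin_binop [intro]:
  "ffin f \<Longrightarrow> ffin g \<Longrightarrow> ffin (\<lambda>s. nadd (f s) (g s))"
  "ffin f \<Longrightarrow> ffin g \<Longrightarrow> ffin (\<lambda>s. nsub (f s) (g s))"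
  "ffin f \<Longrightarrow> ffin g \<Longrightarrow> ffin (\<lambda>s. nmul (f s) (g s))"
  by (auto simp: ffin_def)

text \<open>A partial relation, reflexive exactly on families of finitely supported polynomials, so
  that nothing else enters the quotient. Parameters that are not generic are disregarded, which
  makes s and q - 1/q invertible in the quotient.\<close>

definition fam_rel :: "('k::field \<Rightarrow> 'k ncp) \<Rightarrow> ('k \<Rightarrow> 'k ncp) \<Rightarrow> bool" where
  "fam_rel f g \<longleftrightarrow> ffin f \<and> ffin g \<and> (\<forall>s. generic s \<longrightarrow> nsub (f s) (g s) \<in> nideal s)"

lemma fam_rel_refl: "ffin f \<Longrightarrow> fam_rel f f"
  by (simp add: fam_rel_def nsub_self nideal_nzero)

lemma part_equivp_fam_rel: "part_equivp fam_rel"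
proof (rule part_equivpI)
  show "\<exists>f. fam_rel f f"
    by (rule exI[of _ "\<lambda>_. nzero"], rule fam_rel_refl) (simp add: ffin_def)
  show "symp fam_rel"
    by (rule sympI) (simp add: fam_rel_def nideal_sym)
  show "transp fam_rel"
    unfolding transp_def fam_rel_def using nideal_trans by blast
qed

quotient_type (overloaded) 'k fam = "'k::field \<Rightarrow> 'k ncp" / partial: fam_rel
  by (rule part_equivp_fam_rel)

abbreviation cl :: "('k::field \<Rightarrow> 'k ncp) \<Rightarrow> 'k fam" where "cl \<equiv> abs_fam"

lemma ffin_rep: "ffin (rep_fam x)"
  using Quotient_rep_reflp[OF Quotient_fam] by (auto simp: fam_rel_def)

lemma cl_rep: "cl (rep_fam x) = x"
  by (rule Quotient_abs_rep[OF Quotient_fam])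

lemma cl_exhaust: obtains f where "x = cl f" "ffin f"
  using cl_rep ffin_rep by metis

lemma cl_eq_iff: "ffin f \<Longrightarrow> ffin g \<Longrightarrow> cl f = cl g \<longleftrightarrow> (\<forall>s. generic s \<longrightarrow> nsub (f s) (g s) \<in> nideal s)"
  using Quotient_rel[OF Quotient_fam, of f g] fam_rel_refl[of f] fam_rel_refl[of g]
  by (auto simp: fam_rel_def)

lemma rep_cl: "ffin f \<Longrightarrow> generic s \<Longrightarrow> nsub (rep_fam (cl f) s) (f s) \<in> nideal s"
  using cl_eq_iff[of "rep_fam (cl f)" f] by (simp add: ffin_rep cl_rep)

instantiation fam :: (field) "{ring, monoid_mult}"
begin

definition zero_fam :: "'a fam" where "0 = cl (\<lambda>_. nzero)"
definition one_fam :: "'a fam" where "1 = cl (\<lambda>_. none)"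
definition plus_fam :: "'a fam \<Rightarrow> 'a fam \<Rightarrow> 'a fam" where
  "x + y = cl (\<lambda>s. nadd (rep_fam x s) (rep_fam y s))"
definition minus_fam :: "'a fam \<Rightarrow> 'a fam \<Rightarrow> 'a fam" where
  "x - y = cl (\<lambda>s. nsub (rep_fam x s) (rep_fam y s))"
definition uminus_fam :: "'a fam \<Rightarrow> 'a fam" where
  "- x = (0 - x :: 'a fam)"
definition times_fam :: "'a fam \<Rightarrow> 'a fam \<Rightarrow> 'a fam" where
  "x * y = cl (\<lambda>s. nmul (rep_fam x s) (rep_fam y s))"

text \<open>The operations are defined through chosen representatives; since the ideal is a
  congruence (\<open>nideal_cong\<close>), any finitely supported representatives do as
  well.\<close>

lemma cl_arith:
  fixes f g :: "'a \<Rightarrow> 'a ncp"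
  assumes "ffin f" "ffin g"
  shows "cl (\<lambda>s. nadd (f s) (g s)) = cl f + cl g"
    and "cl (\<lambda>s. nsub (f s) (g s)) = cl f - cl g"
    and "cl (\<lambda>s. nmul (f s) (g s)) = cl f * cl g"
proof -
  have fin: "\<And>s. nfin (f s)" "\<And>s. nfin (g s)" "\<And>x s. nfin (rep_fam x s)"
    using assms ffin_rep by (auto simp: ffin_def)
  note f = nideal_sym[OF rep_cl[OF assms(1)]] and g = nideal_sym[OF rep_cl[OF assms(2)]]
  show "cl (\<lambda>s. nadd (f s) (g s)) = cl f + cl g"
    unfolding plus_fam_def by (subst cl_eq_iff) (auto intro!: ffin_binop assms ffin_rep nideal_cong f g fin)
  show "cl (\<lambda>s. nsub (f s) (g s)) = cl f - cl g"
    unfolding minus_fam_def by (subst cl_eq_iff) (auto intro!: ffin_binop assms ffin_rep nideal_cong(2) f g fin)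
  show "cl (\<lambda>s. nmul (f s) (g s)) = cl f * cl g"
    unfolding times_fam_def by (subst cl_eq_iff) (auto intro!: ffin_binop assms ffin_rep nideal_cong f g fin)
qed

instance
proof
  fix a b c :: "'a fam"
  obtain f where f: "a = cl f" "ffin f" by (rule cl_exhaust)
  obtain g where g: "b = cl g" "ffin g" by (rule cl_exhaust)
  obtain h where h: "c = cl h" "ffin h" by (rule cl_exhaust)
  note abc = f(1) g(1) h(1) and fin = f(2) g(2) h(2)
  note fins = fin ffin_binop[OF fin(1,2)] ffin_binop[OF fin(2,3)] ffin_binop[OF fin(1,3)]
     ffin_binop[OF ffin_simps(4) fin(1)] ffin_binop[OF ffin_simps(4) fin(2)]
  note zero_one = zero_fam_def one_fam_def
  show "a - b = a + - b"
    unfolding uminus_fam_def unfolding abc zero_one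
    by (simp only: cl_arith[symmetric] fins ffin_simps ffin_binop) (simp add: nadd_def nsub_def nzero_def)
  show "a + b + c = a + (b + c)" "a + b = b + a" "0 + a = a" "- a + a = 0"
    unfolding uminus_fam_def unfolding abc zero_one
    by (simp_all only: cl_arith[symmetric] fins ffin_simps)
      (simp_all add: nadd_def nsub_def nzero_def add_ac)
  show "a * b * c = a * (b * c)" "(a + b) * c = a * c + b * c" "a * (b + c) = a * b + a * c"
    "1 * a = a" "a * 1 = a"
    unfolding abc zero_one
    by (simp_all only: cl_arith[symmetric] fins ffin_simps)
      (simp_all add: nmul_assoc nmul_nadd_left nmul_nadd_right)
qed

end

text \<open>Scalars are functions of the parameter because an element of the product has one
  component for each parameter; s itself becomes the central element
  \<open>sc (\<lambda>s. s)\<close>.\<close>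

definition sc :: "('k::field \<Rightarrow> 'k) \<Rightarrow> 'k fam" where
  "sc c = cl (\<lambda>s. nconst (c s))"

lemma sc_add: "sc (\<lambda>s. c s + d s) = sc c + sc d"
proof -
  have "nconst (a + b) = nadd (nconst a) (nconst b)" for a b :: 'a
    by (auto simp: nconst_def nadd_def)
  then show ?thesis by (simp add: sc_def cl_arith)
qed

lemma sc_diff: "sc (\<lambda>s. c s - d s) = sc c - sc d"
proof -
  have "nconst (a - b) = nsub (nconst a) (nconst b)" for a b :: 'a
    by (auto simp: nconst_def nsub_def)
  then show ?thesis by (simp add: sc_def cl_arith)
qed

lemma sc_mult: "sc (\<lambda>s. c s * d s) = sc c * sc d"
proof -
  have "nconst (a * b) = nmul (nconst a) (nconst b)" for a b :: 'a
    by (simp add: nmul_nconst_left) (auto simp: nconst_def)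
  then show ?thesis by (simp add: sc_def cl_arith)
qed

lemma sc_1 [simp]: "sc (\<lambda>_. 1) = 1"
  by (simp add: sc_def one_fam_def none_def)

lemma sc_0 [simp]: "sc (\<lambda>_. 0) = 0"
  using sc_diff[of "\<lambda>_. 0" "\<lambda>_. 0"] by simp

lemma sc_uminus: "sc (\<lambda>s. - c s) = - sc c"
  using sc_diff[of "\<lambda>_. 0" c] by simp

lemma sc_cong: "(\<And>s. generic s \<Longrightarrow> c s = d s) \<Longrightarrow> sc c = sc d"
  unfolding sc_def by (subst cl_eq_iff) (auto simp: nsub_self nideal_nzero)

lemma sc_central: "x * sc c = sc c * x"
proof -
  obtain f where f: "x = cl f" "ffin f" by (rule cl_exhaust)
  show ?thesis unfolding f(1) sc_def
    by (simp flip: cl_arith add: f(2) nmul_nconst_left nmul_nconst_right)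
qed

definition gl :: "nat \<times> sym \<Rightarrow> 'k::field fam" where
  "gl l = cl (\<lambda>_. nmon 1 [l])"

lemma cl_nmon: "cl (\<lambda>s. nmon (c s) u) = sc c * prod_list (map gl u)"
proof (induction u)
  case Nil
  then show ?case by (simp add: sc_def nmon_Nil)
next
  case (Cons l u)
  have "cl (\<lambda>s. nmon (c s) (l # u)) = cl (\<lambda>s. nmul (nmon 1 [l]) (nmon (c s) u))"
    by (simp add: nmul_nmon)
  also have "\<dots> = gl l * (sc c * prod_list (map gl u))"
    by (simp add: cl_arith Cons.IH gl_def[of l])
  finally show ?case by (simp add: mult.assoc[symmetric] sc_central)
qed

text \<open>
  Embeds the quotient algebra at the single parameter s into the product, as a ring without unit.
\<close>
definition at_param :: "'k::field \<Rightarrow> 'k ncp \<Rightarrow> 'k fam" where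
  "at_param s x = cl (\<lambda>t. if t = s then x else nzero)"

text \<open>\<open>sd s 1\<close> is the central idempotent that cuts out the component at s. It
  appears as a factor whenever an identity passes from that single parameter to the product.\<close>

definition sd :: "'k::field \<Rightarrow> 'k \<Rightarrow> 'k fam" where
  "sd s c = sc (\<lambda>t. if t = s then c else 0)"

lemma at_arith:
  assumes "nfin x" "nfin y"
  shows "at_param s (nadd x y) = at_param s x + at_param s y"
    and "at_param s (nsub x y) = at_param s x - at_param s y"
    and "at_param s (nmul x y) = at_param s x * at_param s y"
proof -
  have f: "ffin (\<lambda>t. if t = s then x else nzero)" "ffin (\<lambda>t. if t = s then y else nzero)"
    using assms by (auto simp: ffin_def)
  have *: "nadd nzero nzero = nzero" "nsub nzero nzero = nzero" "nmul nzero nzero = nzero"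
    by (auto simp: nadd_def nsub_def nmul_def nzero_def)
  show "at_param s (nadd x y) = at_param s x + at_param s y" "at_param s (nsub x y) = at_param s x - at_param s y"
    "at_param s (nmul x y) = at_param s x * at_param s y"
    unfolding at_param_def cl_arith[OF f, symmetric]
    by (rule arg_cong[where f = cl]; simp add: fun_eq_iff * cong: if_cong)+
qed

lemma at_cl: assumes "ffin f" shows "at_param s (f s) = sd s 1 * cl f"
  unfolding at_param_def sd_def sc_def cl_arith[OF ffin_simps(1) assms, symmetric]
  by (rule arg_cong[where f = cl]) (auto simp: fun_eq_iff nmul_nconst_left nzero_def)

lemma at_eq_0_iff: assumes "generic s" "nfin x" shows "at_param s x = 0 \<longleftrightarrow> x \<in> nideal s"
proof -
  have "ffin (\<lambda>t. if t = s then x else nzero)" using assms(2) by (auto simp: ffin_def)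
  moreover have "nsub y nzero = y" for y :: "'a ncp" by (simp add: nsub_def nzero_def)
  ultimately show ?thesis
    unfolding at_param_def zero_fam_def using assms(1)
    by (subst cl_eq_iff) (auto simp: nideal_nzero)
qed

lemma at_eq_iff: "generic s \<Longrightarrow> nfin x \<Longrightarrow> nfin y \<Longrightarrow> at_param s x = at_param s y \<longleftrightarrow> nsub x y \<in> nideal s"
  using at_eq_0_iff[of s "nsub x y"] nfin_binop[of x y] by (simp add: at_arith)

lemma sd_add: "sd s (c + d) = sd s c + sd s d"
  unfolding sd_def sc_add[symmetric] by (rule sc_cong) auto

lemma sd_diff: "sd s (c - d) = sd s c - sd s d"
  unfolding sd_def sc_diff[symmetric] by (rule sc_cong) auto

lemma sd_mult: "sd s (c * d) = sd s c * sd s d"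
  unfolding sd_def sc_mult[symmetric] by (rule sc_cong) auto

lemma sd_central: "x * sd s c = sd s c * x"
  by (simp add: sd_def sc_central)

lemma sd_sc: "sd s (c s) = sd s 1 * sc c"
  unfolding sd_def sc_mult[symmetric] by (rule sc_cong) auto

lemma at_nmon: "at_param s (nmon c u) = sd s c * prod_list (map gl u)"
proof -
  have "at_param s (nmon c u) = cl (\<lambda>t. nmon (if t = s then c else 0) u)"
    unfolding at_param_def by (rule arg_cong[where f = cl]) (auto simp: nmon_def nzero_def fun_eq_iff)
  then show ?thesis by (simp add: cl_nmon sd_def)
qed

section \<open>Exchange relations\<close>

locale central_unit =
  fixes S T :: "'a::{ring,monoid_mult}"
  assumes ST: "S * T = 1" and TS: "T * S = 1"
    and S_central: "\<And>v. v * S = S * v" and T_central: "\<And>v. v * T = T * v"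
begin

text \<open>
  The closure of the relations [u_i, w_g] = 0 under the coactions, solved for the products u_i w_j.
\<close>
definition exch :: "'a \<Rightarrow> 'a \<Rightarrow> 'a \<Rightarrow> 'a \<Rightarrow> 'a \<Rightarrow> 'a \<Rightarrow> 'a \<Rightarrow> 'a \<Rightarrow> bool" where
  "exch ux uy uz ug wx wy wz wg \<longleftrightarrow>
     ux * wx = wx * ux \<and>
     ux * wy = wy * ux - (S*S - T*T) * wz * uz - (S + T) * wg * uz \<and>
     ux * wz = wz * ux + (1 + S*S) * wx * uz \<and>
     ux * wg = wg * ux \<and>
     uy * wx = wx * uy + (S*S - T*T) * wz * uz + (S + T) * wg * uz \<and>
     uy * wy = wy * uy \<and>
     uy * wz = wz * uy + (1 + T*T) * wy * uz \<and>
     uy * wg = wg * uy \<and>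
     uz * wx = - (S*S * wx * uz) \<and>
     uz * wy = - (T*T * wy * uz) \<and>
     uz * wz = wz * uz \<and>
     uz * wg = wg * uz \<and>
     ug * wx = (S - T*T*T) * wz * ux + (1 + T*T) * wg * ux + (S*S*S - T) * wx * uz - T*T * wx * ug \<and>
     ug * wy = (S*S*S - T) * wz * uy + (1 + S*S) * wg * uy + (S - T*T*T) * wy * uz - S*S * wy * ug \<and>
     ug * wz = wz * ug + (S + T) * wx * uy - (S + T) * wy * ux
        + (S*S*S + S - T - T*T*T) * wz * uz + (S*S + 1 + 1 + T*T) * wg * uz \<and>
     ug * wg = wg * ug"

end

lemma mult_assoc_rule: "a * b = c \<Longrightarrow> a * (b * z) = c * (z::'a::{ring,monoid_mult})"
  by (simp add: mult.assoc[symmetric])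

text \<open>
  Here S = q^(1/2), C = A_+, a = (q - 1/q) A_- and g = (q - 1/q) Gamma; the rescaling makes all
  structure constants Laurent polynomials in S.
\<close>
locale osp_site = central_unit S T for S T :: "'a::{ring,monoid_mult}" +
  fixes C a K k P g :: 'a
  assumes KC: "K * C = S * (C * K)" and Ka: "K * a = T * (a * K)"
    and PC: "P * C = - (C * P)" and Pa: "P * a = - (a * P)"
    and PK: "P * K = K * P" and Pk: "P * k = k * P"
    and Kk: "K * k = 1" and kK: "k * K = 1" and PP: "P * P = 1"
    and Ca: "C * a = - (g * P) + T * K * K - S * k * k"
    and aC: "a * C = g * P + S * K * K - T * k * k"
begin

lemma kC: "k * C = T * (C * k)"
proof -
  have "k * C = k * C * (K * k)" by (simp add: Kk)
  also have "\<dots> = k * (C * K) * k" by (simp add: mult.assoc)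
  also have "C * K = T * (K * C)" by (simp add: KC mult.assoc[symmetric] TS)
  also have "k * (T * (K * C)) * k = T * (k * K) * C * k"
    using T_central[of k] by (simp add: mult.assoc[symmetric])
  finally show ?thesis by (simp add: kK mult.assoc)
qed

lemma ka: "k * a = S * (a * k)"
proof -
  have "k * a = k * a * (K * k)" by (simp add: Kk)
  also have "\<dots> = k * (a * K) * k" by (simp add: mult.assoc)
  also have "a * K = S * (K * a)" by (simp add: Ka mult.assoc[symmetric] ST)
  also have "k * (S * (K * a)) * k = S * (k * K) * a * k"
    using S_central[of k] by (simp add: mult.assoc[symmetric])
  finally show ?thesis by (simp add: kK mult.assoc)
qed

text \<open>This is \<open>Ca\<close> multiplied by \<open>P\<close> on the right and solved for
  \<open>g\<close> with P^2 = 1. Hence whatever commutes with the five generators also commutes with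
  \<open>g\<close>, a conclusion drawn several times below.\<close>

lemma gP: "g = - (C * a * P) + T * K * K * P - S * k * k * P"
proof -
  have "g = g * P * P" by (simp add: mult.assoc PP)
  also have "g * P = - (C * a) + T * K * K - S * k * k" by (simp add: Ca)
  finally show ?thesis by (simp add: algebra_simps)
qed

lemmas base_rules = KC Ka PC Pa PK Pk Kk kK PP kC ka ST TS
  S_central[of C] S_central[of a] S_central[of K] S_central[of k] S_central[of P]
  T_central[of C] T_central[of a] T_central[of K] T_central[of k] T_central[of P]

lemmas base_simps = base_rules base_rules[THEN mult_assoc_rule]

lemma g_comm:
  shows "C * g = g * C" "a * g = g * a" "K * g = g * K" "k * g = g * k" "P * g = g * P"
proof -
  have "g * P = - (C * a) + T * K * K - S * k * k" by (simp add: Ca)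
  \<comment> \<open>The sum of \<open>Ca\<close> and \<open>aC\<close> is free of g: it is the
    anticommutator relation, scaled, with (q - 1/q)/(q^(1/2) - q^(-1/2)) = S + T. Only a form
    without g is of use while it is open whether g commutes with the generators.\<close>
  then have aC': "a * C = - (C * a) + S * K * K + T * K * K - S * k * k - T * k * k"
    by (simp add: aC algebra_simps)
  note s = gP base_simps aC' aC'[THEN mult_assoc_rule]
  show "K * g = g * K" "k * g = g * k" "P * g = g * P" "C * g = g * C" "a * g = g * a"
    by (simp_all add: s algebra_simps)
qed

lemmas site_rules = base_rules Ca aC g_comm S_central[of g] T_central[of g]
lemmas site_simps = site_rules site_rules[THEN mult_assoc_rule]

text \<open>
  The matrices of Delta (D) and tau_R (T): the new tensor factor contributes C, a, K, k, P, g,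
  the remaining factors the quadruple ux, uy, uz, ug.
\<close>
abbreviation "Dx u v \<equiv> C * K * v + u"
abbreviation "Dy u v \<equiv> a * K * v + u"
abbreviation "Dz v \<equiv> K * K * P * v"
abbreviation "Dg ux uy uz ug \<equiv> (g + (S - T) * k * k * P) * uz + T * C * k * P * uy - k * a * P * ux + k * k * P * ug"
abbreviation "Tx ux uy uz ug \<equiv> k * k * P * ux + T * C * C * P * uy + (1 - T * T) * C * k * P * uz + T * C * k * P * ug"
abbreviation "Ty uy \<equiv> K * K * P * uy"
abbreviation "Tz uy uz \<equiv> uz - C * K * uy"

context
  fixes ux uy uz ug wx wy wz wg :: 'a
  assumes comm: "\<And>v l. v \<in> {ux,uy,uz,ug,wx,wy,wz,wg} \<Longrightarrow> l \<in> {C,a,K,k,P} \<Longrightarrow> v * l = l * v"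
    and ex: "exch ux uy uz ug wx wy wz wg"
begin

lemma cg: "v \<in> {ux,uy,uz,ug,wx,wy,wz,wg} \<Longrightarrow> v * g = g * v"
proof -
  assume v: "v \<in> {ux,uy,uz,ug,wx,wy,wz,wg}"
  have c: "v * C = C * v" "v * a = a * v" "v * K = K * v" "v * k = k * v" "v * P = P * v"
    using comm[OF v] by auto
  show ?thesis
    unfolding gP
    using c c[THEN mult_assoc_rule] S_central[of v] T_central[of v] S_central[of v, THEN mult_assoc_rule] T_central[of v, THEN mult_assoc_rule]
    by (simp add: algebra_simps base_simps)
qed

lemma c0: "v \<in> {ux,uy,uz,ug,wx,wy,wz,wg} \<Longrightarrow> v * C = C * v"
  "v \<in> {ux,uy,uz,ug,wx,wy,wz,wg} \<Longrightarrow> v * a = a * v"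
  "v \<in> {ux,uy,uz,ug,wx,wy,wz,wg} \<Longrightarrow> v * K = K * v"
  "v \<in> {ux,uy,uz,ug,wx,wy,wz,wg} \<Longrightarrow> v * k = k * v"
  "v \<in> {ux,uy,uz,ug,wx,wy,wz,wg} \<Longrightarrow> v * P = P * v"
  "v \<in> {ux,uy,uz,ug,wx,wy,wz,wg} \<Longrightarrow> v * S = S * v"
  "v \<in> {ux,uy,uz,ug,wx,wy,wz,wg} \<Longrightarrow> v * T = T * v"
  using comm S_central T_central by auto

lemmas c1 = c0 cg
lemmas uw_rules0 = c1[of ux] c1[of uy] c1[of uz] c1[of ug] c1[of wx] c1[of wy] c1[of wz] c1[of wg]
lemmas uw_rules1 = uw_rules0[simplified]
lemma ex_rules:
  "ux * wx = wx * ux"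
     "ux * wy = wy * ux - (S*S - T*T) * wz * uz - (S + T) * wg * uz "
     "ux * wz = wz * ux + (1 + S*S) * wx * uz "
     "ux * wg = wg * ux "
     "uy * wx = wx * uy + (S*S - T*T) * wz * uz + (S + T) * wg * uz "
     "uy * wy = wy * uy "
     "uy * wz = wz * uy + (1 + T*T) * wy * uz "
     "uy * wg = wg * uy "
     "uz * wx = - (S*S * wx * uz) "
     "uz * wy = - (T*T * wy * uz) "
     "uz * wz = wz * uz "
     "uz * wg = wg * uz "
     "ug * wx = (S - T*T*T) * wz * ux + (1 + T*T) * wg * ux + (S*S*S - T) * wx * uz - T*T * wx * ug "
     "ug * wy = (S*S*S - T) * wz * uy + (1 + S*S) * wg * uy + (S - T*T*T) * wy * uz - S*S * wy * ug "
     "ug * wz = wz * ug + (S + T) * wx * uy - (S + T) * wy * ux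
        + (S*S*S + S - T - T*T*T) * wz * uz + (S*S + 1 + 1 + T*T) * wg * uz "
     "ug * wg = wg * ug"
  using ex unfolding exch_def by blast+

lemmas uw_rules = uw_rules1 ex_rules
lemmas uw_simps = uw_rules uw_rules[THEN mult_assoc_rule]

text \<open>Once the site elements are moved to the left and ordered there, each of the sixteen
  relations compares sums of products u_i w_j and w_k u_l; the old relations turn the former into
  the latter, and the coefficients agree. The next two lemmas rest on the same computation. The
  first quadruple always belongs to the larger set.\<close>

lemma exch_tau_tau: "exch (Tx ux uy uz ug) (Ty uy) (Tz uy uz) ug (Tx wx wy wz wg) (Ty wy) (Tz wy wz) wg"
  unfolding exch_def by (intro conjI; simp add: algebra_simps site_simps uw_simps)
lemma exch_delta_tau: "exch (Dx ux uz) (Dy uy uz) (Dz uz) (Dg ux uy uz ug) (Tx wx wy wz wg) (Ty wy) (Tz wy wz) wg"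
  unfolding exch_def by (intro conjI; simp add: algebra_simps site_simps uw_simps)
lemma exch_delta_delta: "exch (Dx ux uz) (Dy uy uz) (Dz uz) (Dg ux uy uz ug) (Dx wx wz) (Dy wy wz) (Dz wz) (Dg wx wy wz wg)"
  unfolding exch_def by (intro conjI; simp add: algebra_simps site_simps uw_simps)
end

end

section \<open>Coproduct and coaction on the generators\<close>

locale osp_site2 = osp_site S T C a K k P g + right: osp_site S T C' a' K' k' P' g'
  for S T C a K k P g C' a' K' k' P' g' :: "'a::{ring,monoid_mult}" +
  assumes comm: "\<And>v l. v \<in> {C',a',K',k',P'} \<Longrightarrow> l \<in> {C,a,K,k,P} \<Longrightarrow> v * l = l * v"
begin

lemma comm_rules:
  "C' * C = C * C'" "C' * a = a * C'" "C' * K = K * C'" "C' * k = k * C'" "C' * P = P * C'"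
  "a' * C = C * a'" "a' * a = a * a'" "a' * K = K * a'" "a' * k = k * a'" "a' * P = P * a'"
  "K' * C = C * K'" "K' * a = a * K'" "K' * K = K * K'" "K' * k = k * K'" "K' * P = P * K'"
  "k' * C = C * k'" "k' * a = a * k'" "k' * K = K * k'" "k' * k = k * k'" "k' * P = P * k'"
  "P' * C = C * P'" "P' * a = a * P'" "P' * K = K * P'" "P' * k = k * P'" "P' * P = P * P'"
  by (rule comm; simp)+

lemma comm_g:
  "v \<in> {C',a',K',k',P'} \<Longrightarrow> v * g = g * v"
proof -
  assume v: "v \<in> {C',a',K',k',P'}"
  have c: "v * C = C * v" "v * a = a * v" "v * K = K * v" "v * k = k * v" "v * P = P * v"
    using comm[OF v] by auto
  show ?thesis
    unfolding gP
    using c c[THEN mult_assoc_rule] S_central[of v] T_central[of v] S_central[of v, THEN mult_assoc_rule] T_central[of v, THEN mult_assoc_rule]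
    by (simp add: algebra_simps base_simps)
qed

lemma comm_g':
  assumes "v * C' = C' * v" "v * a' = a' * v" "v * K' = K' * v" "v * k' = k' * v" "v * P' = P' * v"
  shows "g' * v = v * g'"
    unfolding right.gP
    using assms assms[THEN mult_assoc_rule] S_central[of v] T_central[of v] S_central[of v, THEN mult_assoc_rule] T_central[of v, THEN mult_assoc_rule]
    by (simp add: algebra_simps right.base_simps)

lemma comm_rules_g:
  "C' * g = g * C'" "a' * g = g * a'" "K' * g = g * K'" "k' * g = g * k'" "P' * g = g * P'"
  "g' * C = C * g'" "g' * a = a * g'" "g' * K = K * g'" "g' * k = k * g'" "g' * P = P * g'" "g' * g = g * g'"
  by (rule comm_g, simp)+ (rule comm_g'; simp add: comm_rules comm_g)+

lemmas rules2 = comm_rules comm_rules_g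
lemmas simps2 = rules2 rules2[THEN mult_assoc_rule]

text \<open>Two facts in one: the images of the generators satisfy the defining relations, and the
  image of the scaled Casimir element is the last argument, because by \<open>gP\<close> only one
  element can fulfil \<open>Ca\<close>. This is where the matrix row \<open>Dg\<close> comes
  from.\<close>

lemma coproduct_site:
  "osp_site S T (C * K' * P' + k * C') (a * K' * P' + k * a') (K * K') (k * k') (P * P')
     (Dg (C' * K') (a' * K') (K' * K' * P') g')"
  by unfold_locales
    (simp_all add: algebra_simps site_simps right.site_simps simps2)

lemma coproduct_x:
  "(C * K' * P' + k * C') * (K * K') = C * K * (K' * K' * P') + C' * K'"
  "(a * K' * P' + k * a') * (K * K') = a * K * (K' * K' * P') + a' * K'"
  "K * K' * (K * K') * (P * P') = K * K * P * (K' * K' * P')"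
  by (simp_all add: algebra_simps site_simps right.site_simps simps2)

end

definition commutes :: "'a::{ring,monoid_mult} \<Rightarrow> 'a \<Rightarrow> bool" where
  "commutes x y \<longleftrightarrow> x * y = y * x"

lemma commutes_sym: "commutes x y \<Longrightarrow> commutes y x"
  by (simp add: commutes_def)

lemma commutes_intros:
  "commutes x z \<Longrightarrow> commutes y z \<Longrightarrow> commutes (x + y) z"
  "commutes x z \<Longrightarrow> commutes y z \<Longrightarrow> commutes (x - y) z"
  "commutes x z \<Longrightarrow> commutes (- x) z"
  "commutes x z \<Longrightarrow> commutes y z \<Longrightarrow> commutes (x * y) z"
  "commutes 1 z" "commutes 0 z"
  by (simp_all add: commutes_def algebra_simps) (metis mult.assoc)

text \<open>A generalized Weyl algebra over the commuting elements z and g: z passes x and y with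
  the factors -q and -1/q, and xy and yx are polynomials in z and g. These relations suffice to
  reduce words to normal form.\<close>

locale gwa = central_unit S T for S T :: "'a::{ring,monoid_mult}" +
  fixes x y z g :: 'a
  assumes zx: "z * x = - (S * S * x * z)" and zy: "z * y = - (T * T * y * z)"
    and xy: "x * y = - (T * g * z) + T * T * z * z - 1"
    and yx: "y * x = S * g * z + S * S * z * z - 1"
    and xg: "x * g = g * x" and yg: "y * g = g * y" and zg: "z * g = g * z"
begin
lemmas rules = zx zy xy yx xg yg zg ST TS
  S_central[of x] S_central[of y] S_central[of z] S_central[of g]
  T_central[of x] T_central[of y] T_central[of z] T_central[of g]
lemmas simps = rules rules[THEN mult_assoc_rule]
end

context osp_site begin

lemma site_gwa: "gwa S T (C * K) (a * K) (K * K * P) g"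
  by unfold_locales (simp_all add: algebra_simps site_simps)

lemma site_exch: "exch (C * K) (a * K) (K * K * P) g (C * K) (a * K) (K * K * P) g"
  unfolding exch_def by (intro conjI; simp add: algebra_simps site_simps)

text \<open>The homomorphism property of tau_R in the form in which it is used: it concerns the
  images of the four generators of I_R, the only elements on which tau_R is given.\<close>

lemma tau_gwa:
  assumes "gwa S T x y z h"
    and comm: "\<And>v l. v \<in> {x,y,z,h} \<Longrightarrow> l \<in> {C,a,K,k,P} \<Longrightarrow> v * l = l * v"
  shows "gwa S T (Tx x y z h) (Ty y) (Tz y z) h"
proof -
  interpret gwa S T x y z h by fact
  have c: "x * C = C * x" "x * a = a * x" "x * K = K * x" "x * k = k * x" "x * P = P * x"
    "y * C = C * y" "y * a = a * y" "y * K = K * y" "y * k = k * y" "y * P = P * y"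
    "z * C = C * z" "z * a = a * z" "z * K = K * z" "z * k = k * z" "z * P = P * z"
    "h * C = C * h" "h * a = a * h" "h * K = K * h" "h * k = k * h" "h * P = P * h"
    using comm by auto
  show ?thesis
    by unfold_locales (simp_all add: algebra_simps site_simps c c[THEN mult_assoc_rule] simps)
qed

text \<open>The second quadruple lives in this site alone, so both sides of every relation are
  linear in the old quadruple and no product of two of its members arises. The part of A to the
  right of B can therefore be anything.\<close>

lemma delta_exch_base:
  assumes comm: "\<And>v l. v \<in> {ux,uy,uz,ug} \<Longrightarrow> l \<in> {C,a,K,k,P} \<Longrightarrow> v * l = l * v"
  shows "exch (Dx ux uz) (Dy uy uz) (Dz uz) (Dg ux uy uz ug) (C * K) (a * K) (K * K * P) g"
proof -
  have c: "ux * C = C * ux" "ux * a = a * ux" "ux * K = K * ux" "ux * k = k * ux" "ux * P = P * ux"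
    "uy * C = C * uy" "uy * a = a * uy" "uy * K = K * uy" "uy * k = k * uy" "uy * P = P * uy"
    "uz * C = C * uz" "uz * a = a * uz" "uz * K = K * uz" "uz * k = k * uz" "uz * P = P * uz"
    "ug * C = C * ug" "ug * a = a * ug" "ug * K = K * ug" "ug * k = k * ug" "ug * P = P * ug"
    using comm by auto
  have cg: "v * C = C * v \<Longrightarrow> v * a = a * v \<Longrightarrow> v * K = K * v \<Longrightarrow> v * k = k * v \<Longrightarrow> v * P = P * v
     \<Longrightarrow> v * g = g * v" for v
    unfolding gP
    using S_central[of v] T_central[of v] S_central[of v, THEN mult_assoc_rule] T_central[of v, THEN mult_assoc_rule]
     mult_assoc_rule[of v C "C * v"] mult_assoc_rule[of v a "a * v"] mult_assoc_rule[of v K "K * v"] mult_assoc_rule[of v k "k * v"]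
    by (simp add: algebra_simps base_simps)
  note c' = c cg[OF c(1-5)] cg[OF c(6-10)] cg[OF c(11-15)] cg[OF c(16-20)]
    S_central[of ux] S_central[of uy] S_central[of uz] S_central[of ug]
    T_central[of ux] T_central[of uy] T_central[of uz] T_central[of ug]
  show ?thesis
    unfolding exch_def
    by (intro conjI; simp add: algebra_simps site_simps c' c'[THEN mult_assoc_rule])
qed

end

section \<open>Letters\<close>

definition SS :: "'k::field fam" where "SS = sc (\<lambda>s. s)"
definition TT :: "'k::field fam" where "TT = sc (\<lambda>s. 1 / s)"
definition Om :: "'k::field fam" where "Om = sc (\<lambda>s. s^2 - 1/s^2)"
definition Oi :: "'k::field fam" where "Oi = sc (\<lambda>s. 1 / (s^2 - 1/s^2))"

lemma generic_neq: assumes "generic s" shows "s \<noteq> 0" "s^2 - 1/s^2 \<noteq> 0" "s - 1/s \<noteq> 0"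
proof -
  show s: "s \<noteq> 0" using assms by (simp add: generic_def)
  have 4: "s^4 \<noteq> 1" using assms by (simp add: generic_def)
  show "s^2 - 1/s^2 \<noteq> 0"
  proof
    assume "s^2 - 1/s^2 = 0"
    then have "s^2 * s^2 = 1" using s by (simp add: field_simps)
    then show False using 4 by (simp add: power_add[symmetric])
  qed
  show "s - 1/s \<noteq> 0"
  proof
    assume "s - 1/s = 0"
    then have "s * s = 1" using s by (simp add: field_simps)
    then have "s^4 = 1" by (simp add: power4_eq_xxxx mult.assoc)
    then show False using 4 by simp
  qed
qed

lemma SS_TT: "SS * TT = (1 :: 'k::field fam)" "TT * SS = (1 :: 'k::field fam)"
  unfolding SS_def TT_def sc_mult[symmetric] sc_1[symmetric]
  by (rule sc_cong; simp add: generic_def)+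

lemma Om_Oi: "Om * Oi = (1 :: 'k::field fam)" "Oi * Om = (1 :: 'k::field fam)"
  unfolding Om_def Oi_def sc_mult[symmetric] sc_1[symmetric]
  by (rule sc_cong; drule generic_neq(2); simp)+

lemma fam_central: "x * SS = SS * x" "x * TT = TT * x" "x * Om = Om * x" "x * Oi = Oi * x"
  for x :: "'k::field fam"
  by (simp_all add: SS_def TT_def Om_def Oi_def sc_central)

interpretation fam: central_unit "SS :: 'k::field fam" TT
  by unfold_locales (rule SS_TT fam_central)+

lemma Om_mult: "Om * sc (\<lambda>s. 1 / (s - 1/s)) = (SS + TT :: 'k::field fam)"
  unfolding Om_def SS_def TT_def sc_mult[symmetric] sc_add[symmetric]
proof (rule sc_cong)
  fix s :: 'k assume "generic s"
  then have "s - 1/s \<noteq> 0" "s \<noteq> 0" by (rule generic_neq)+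
  moreover have "s^2 - 1/s^2 = (s + 1/s) * (s - 1/s)"
    using \<open>s \<noteq> 0\<close> by (simp add: field_simps power2_eq_square)
  ultimately show "(s^2 - 1/s^2) * (1 / (s - 1/s)) = s + 1/s" by simp
qed

lemma Oi_mult: "Oi * (SS + TT) = (sc (\<lambda>s. 1 / (s - 1/s)) :: 'k::field fam)"
  unfolding Om_mult[symmetric] by (simp add: mult.assoc[symmetric] Om_Oi)

text \<open>Assignments of ring elements to letters that respect all relations; evaluation along
  them kills the ideal (\<open>ev_osp_ideal\<close>). The letters themselves, the coproduct and the
  shift of positions are of this kind. tau_R is not, being defined only on I_R, and gets its own
  argument in \<open>ev_tau_ideal\<close>.\<close>

definition osp_letters :: "(nat \<times> sym \<Rightarrow> 'k::field fam) \<Rightarrow> bool" where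
  "osp_letters \<phi> \<longleftrightarrow>
    (\<forall>i. osp_site SS TT (\<phi> (i, Ap)) (Om * \<phi> (i, Am)) (\<phi> (i, Kp)) (\<phi> (i, Km)) (\<phi> (i, Pp)) (Om * \<phi> (i, XG))
       \<and> \<phi> (i, XAp) = \<phi> (i, Ap) * \<phi> (i, Kp) \<and> \<phi> (i, XAm) = \<phi> (i, Am) * \<phi> (i, Kp)
       \<and> \<phi> (i, XKP) = \<phi> (i, Kp) * \<phi> (i, Kp) * \<phi> (i, Pp)) \<and>
    (\<forall>i j g h. i \<noteq> j \<longrightarrow> \<phi> (i, g) * \<phi> (j, h) = \<phi> (j, h) * \<phi> (i, g))"

lemma cl_rel: "(\<And>s. r s \<in> osp_rels s i) \<Longrightarrow> cl r = 0"
proof -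
  assume r: "\<And>s. r s \<in> osp_rels s i"
  have I: "r s \<in> nideal s" for s
    unfolding nideal_def using osp_ideal.gen[OF lessI r] by blast
  then have "ffin r" unfolding ffin_def using nideal_nfin by blast
  moreover have "nsub x nzero = x" for x :: "'a ncp" by (simp add: nsub_def nzero_def)
  ultimately show ?thesis unfolding zero_fam_def by (subst cl_eq_iff) (auto simp: I)
qed

lemma osp_letters_gl: "osp_letters (gl :: nat \<times> sym \<Rightarrow> 'k::field fam)"
  unfolding osp_letters_def
proof (intro conjI allI impI osp_site.intro central_unit.intro osp_site_axioms.intro)
  fix i
  let ?C = "gl (i, Ap) :: 'k fam" and ?b = "gl (i, Am) :: 'k fam" and ?K = "gl (i, Kp) :: 'k fam"
    and ?k = "gl (i, Km) :: 'k fam" and ?P = "gl (i, Pp) :: 'k fam" and ?G = "gl (i, XG) :: 'k fam"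
  note cl = cl_arith cl_nmon nlet_eq_nmon
  note R = cl_rel[where i = i and 'a = 'k]
  have KCk: "?K * ?C * ?k = SS * ?C"
    using R[of "\<lambda>s. nsub (nmon 1 [(i,Kp),(i,Ap),(i,Km)]) (nmon s [(i,Ap)])"]
    by (simp add: osp_rels_def cl SS_def mult.assoc)
  have Kbk: "?K * ?b * ?k = TT * ?b"
    using R[of "\<lambda>s. nsub (nmon 1 [(i,Kp),(i,Am),(i,Km)]) (nmon (1/s) [(i,Am)])"]
    by (simp add: osp_rels_def cl TT_def mult.assoc)
  have "?C * ?b + ?b * ?C - (sc (\<lambda>s. 1/(s - 1/s)) * (?K * ?K) + sc (\<lambda>s. -1/(s - 1/s)) * (?k * ?k)) = 0"
    using R[of "\<lambda>s. nsub (nadd (nmon 1 [(i,Ap),(i,Am)]) (nmon 1 [(i,Am),(i,Ap)]))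
          (nadd (nmon (1/(s - 1/s)) [(i,Kp),(i,Kp)]) (nmon (-1/(s - 1/s)) [(i,Km),(i,Km)]))"]
    by (simp add: osp_rels_def cl ffin_binop mult.assoc)
  also have "sc (\<lambda>s. -1/(s - 1/s)) = (- sc (\<lambda>s. 1/(s - 1/s)) :: 'k fam)"
    by (simp flip: sc_uminus)
  finally have CbbC: "?C * ?b + ?b * ?C = sc (\<lambda>s. 1/(s - 1/s)) * (?K * ?K - ?k * ?k)"
    by (simp add: algebra_simps)
  show PC: "?P * ?C = - (?C * ?P)"
    using R[of "\<lambda>s. nadd (nmon 1 [(i,Pp),(i,Ap)]) (nmon 1 [(i,Ap),(i,Pp)])"]
    by (simp add: osp_rels_def cl eq_neg_iff_add_eq_0)
  have Pb: "?P * ?b = - (?b * ?P)"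
    using R[of "\<lambda>s. nadd (nmon 1 [(i,Pp),(i,Am)]) (nmon 1 [(i,Am),(i,Pp)])"]
    by (simp add: osp_rels_def cl eq_neg_iff_add_eq_0)
  show PK: "?P * ?K = ?K * ?P"
    using R[of "\<lambda>s. nsub (nmon 1 [(i,Pp),(i,Kp)]) (nmon 1 [(i,Kp),(i,Pp)])"]
    by (simp add: osp_rels_def cl)
  show Pk: "?P * ?k = ?k * ?P"
    using R[of "\<lambda>s. nsub (nmon 1 [(i,Pp),(i,Km)]) (nmon 1 [(i,Km),(i,Pp)])"]
    by (simp add: osp_rels_def cl)
  show Kk: "?K * ?k = 1"
    using R[of "\<lambda>s. nsub (nmon 1 [(i,Kp),(i,Km)]) (nmon 1 [])"]
    by (simp add: osp_rels_def cl)
  show kK: "?k * ?K = 1"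
    using R[of "\<lambda>s. nsub (nmon 1 [(i,Km),(i,Kp)]) (nmon 1 [])"]
    by (simp add: osp_rels_def cl)
  show PP: "?P * ?P = 1"
    using R[of "\<lambda>s. nsub (nmon 1 [(i,Pp),(i,Pp)]) (nmon 1 [])"]
    by (simp add: osp_rels_def cl)
  have X: "cl (\<lambda>s::'k. nsub (nlet i g) (expand s i g)) = 0" if "g \<in> {XAp, XAm, XKP, XG}" for g
    by (rule R) (use that in \<open>auto simp: osp_rels_def\<close>)
  show "gl (i, XAp) = ?C * ?K"
    using X[of XAp] by (simp add: cl)
  show "gl (i, XAm) = ?b * ?K"
    using X[of XAm] by (simp add: cl)
  show "gl (i, XKP) = ?K * ?K * ?P"
    using X[of XKP] by (simp add: cl mult.assoc)
  have "?G = sc (\<lambda>s. -1) * (?C * (?b * ?P)) + (sc (\<lambda>s. (1/s) / (s^2 - 1/s^2)) * (?K * (?K * ?P))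
      + (sc (\<lambda>s. - s / (s^2 - 1/s^2)) * (?k * (?k * ?P)) + 0))"
    using X[of XG] by (simp add: gamma_expr_def cl ffin_binop zero_fam_def[symmetric])
  also have "sc (\<lambda>s. (1/s) / (s^2 - 1/s^2)) = TT * (Oi :: 'k fam)"
    unfolding TT_def Oi_def sc_mult[symmetric] by (rule sc_cong) simp
  also have "sc (\<lambda>s. - s / (s^2 - 1/s^2)) = - (SS * (Oi :: 'k fam))"
    unfolding SS_def Oi_def sc_mult[symmetric] sc_uminus[symmetric] by (rule sc_cong) simp
  also have "sc (\<lambda>s. -1) = (- 1 :: 'k fam)"
    unfolding sc_uminus by simp
  finally have "Om * ?G = - (Om * (?C * (?b * ?P))) + Om * TT * Oi * (?K * (?K * ?P)) - Om * SS * Oi * (?k * (?k * ?P))"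
    by (simp add: distrib_left right_diff_distrib mult.assoc)
  also have "Om * TT * Oi = (TT :: 'k fam)" by (simp add: fam_central(3)[of TT, symmetric] mult.assoc Om_Oi)
  also have "Om * SS * Oi = (SS :: 'k fam)" by (simp add: fam_central(3)[of SS, symmetric] mult.assoc Om_Oi)
  finally have G: "Om * ?G = - (?C * ((Om * ?b) * ?P)) + TT * (?K * (?K * ?P)) - SS * (?k * (?k * ?P))"
    using fam_central(3)[of ?C] by (simp add: mult.assoc[symmetric])
  show "?K * ?C = SS * (?C * ?K)"
    using arg_cong[OF KCk, of "\<lambda>x. x * ?K"] by (simp add: mult.assoc kK)
  have "?K * ?b = TT * (?b * ?K)"
    using arg_cong[OF Kbk, of "\<lambda>x. x * ?K"] by (simp add: mult.assoc kK)
  then show "?K * (Om * ?b) = TT * (Om * ?b * ?K)"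
    by (simp add: mult.assoc mult_assoc_rule[OF fam_central(3)[of ?K]] mult_assoc_rule[OF fam_central(3)[of TT]])
  show "?P * (Om * ?b) = - (Om * ?b * ?P)"
    by (simp add: mult.assoc mult_assoc_rule[OF fam_central(3)[of ?P]] Pb)
  have "Om * ?G * ?P = - (?C * ((Om * ?b) * (?P * ?P))) + TT * (?K * (?K * (?P * ?P))) - SS * (?k * (?k * (?P * ?P)))"
    unfolding G by (simp add: algebra_simps)
  then show Ca: "?C * (Om * ?b) = - (Om * ?G * ?P) + TT * ?K * ?K - SS * ?k * ?k"
    by (simp add: PP mult.assoc)
  have "?C * (Om * ?b) + Om * ?b * ?C = Om * (?C * ?b + ?b * ?C)"
    using fam_central(3)[of ?C] by (simp add: distrib_left mult.assoc[symmetric])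
  also have "\<dots> = (SS + TT) * (?K * ?K - ?k * ?k)"
    unfolding CbbC mult.assoc[symmetric] Om_mult by (simp add: mult.assoc)
  finally show "Om * ?b * ?C = Om * ?G * ?P + SS * ?K * ?K - TT * ?k * ?k"
    unfolding Ca by (simp add: algebra_simps)
next
  fix i j :: nat and g h assume ij: "i \<noteq> j"
  have I: "nsub (nmon 1 [(i,g),(j,h)]) (nmon 1 [(j,h),(i,g)]) \<in> nideal s" for s :: 'k
    unfolding nideal_def by (rule UN_I[of "Suc (max i j)"], simp, rule osp_ideal.comm) (auto simp: ij)
  have "cl (\<lambda>s. nmon 1 [(i,g),(j,h)]) = cl (\<lambda>s::'k. nmon 1 [(j,h),(i,g)])"
    by (subst cl_eq_iff) (auto simp: I)
  then show "gl (i, g) * gl (j, h) = (gl (j, h) * gl (i, g) :: 'k fam)"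
    by (simp add: cl_nmon)
qed (rule fam_central SS_TT)+

section \<open>Evaluation\<close>

lemma fam_free_rep: "free_rep (\<lambda>c m. sd s c * m) (\<lambda>l m. \<phi> l * m :: 'k::field fam)"
proof
  show "\<phi> l * (sd s a * m) = sd s a * (\<phi> l * m)" for l a m
    by (simp add: mult.assoc[symmetric] sd_central)
qed (simp_all add: sd_add sd_mult algebra_simps)

definition ev :: "'k::field \<Rightarrow> (nat \<times> sym \<Rightarrow> 'k fam) \<Rightarrow> 'k ncp \<Rightarrow> 'k fam" where
  "ev s \<phi> f = free_rep.act (\<lambda>c m. sd s c * m) (\<lambda>l m. \<phi> l * m) f 1"

lemma foldr_mult: "foldr (\<lambda>l m. \<phi> l * m) w m = prod_list (map \<phi> w) * (m :: 'a::monoid_mult)"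
  by (induction w) (simp_all add: mult.assoc)

lemma fam_act: "free_rep.act (\<lambda>c m. sd s c * m) (\<lambda>l m. \<phi> l * m) f m = ev s \<phi> f * (m :: 'k::field fam)"
  unfolding ev_def free_rep.act_def[OF fam_free_rep]
  by (simp add: foldr_mult sum_distrib_right mult.assoc)

lemma ev_eq_sum: "ev s \<phi> f = (\<Sum>w | f w \<noteq> 0. sd s (f w) * prod_list (map \<phi> w))"
  unfolding ev_def free_rep.act_def[OF fam_free_rep] by (simp add: foldr_mult)

lemma ev_nadd: "nfin f \<Longrightarrow> nfin g \<Longrightarrow> ev s \<phi> (nadd f g) = ev s \<phi> f + ev s \<phi> g"
  unfolding ev_def by (rule free_rep.act_nadd[OF fam_free_rep])

lemma ev_nsub: "nfin f \<Longrightarrow> nfin g \<Longrightarrow> ev s \<phi> (nsub f g) = ev s \<phi> f - ev s \<phi> g"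
  unfolding ev_def by (rule free_rep.act_nsub[OF fam_free_rep])

lemma ev_nmul: "nfin f \<Longrightarrow> nfin g \<Longrightarrow> ev s \<phi> (nmul f g) = ev s \<phi> f * ev s \<phi> g"
  using free_rep.act_nmul[OF fam_free_rep, of f g s \<phi> 1] by (simp add: fam_act)

lemma ev_nzero: "ev s \<phi> nzero = 0"
  unfolding ev_def by (rule free_rep.act_nzero[OF fam_free_rep])

lemma ev_nmon: "ev s \<phi> (nmon c w) = sd s c * prod_list (map \<phi> w)"
  unfolding ev_def free_rep.act_nmon[OF fam_free_rep] by (simp add: foldr_mult)

lemma sd_consts:
  "sd s s = (sd s 1 * SS :: 'k::field fam)" "sd s (1/s) = (sd s 1 * TT :: 'k fam)"
  "sd s (1/(s - 1/s)) = (sd s 1 * (Oi * (SS + TT)) :: 'k fam)"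
  "sd s ((1/s) / (s^2 - 1/s^2)) = (sd s 1 * (Oi * TT) :: 'k fam)"
  "sd s (s / (s^2 - 1/s^2)) = (sd s 1 * (Oi * SS) :: 'k fam)"
  "sd s (- c) = (- sd s c :: 'k fam)"
proof -
  have "Oi * TT = (sc (\<lambda>s. (1/s) / (s^2 - 1/s^2)) :: 'k fam)"
    unfolding TT_def Oi_def sc_mult[symmetric] by (rule sc_cong) simp
  then show "sd s ((1/s) / (s^2 - 1/s^2)) = sd s 1 * (Oi * TT)"
    using sd_sc[of s "\<lambda>s. (1/s) / (s^2 - 1/s^2)"] by simp
  have "Oi * SS = (sc (\<lambda>s. s / (s^2 - 1/s^2)) :: 'k fam)"
    unfolding SS_def Oi_def sc_mult[symmetric] by (rule sc_cong) simp
  then show "sd s (s / (s^2 - 1/s^2)) = sd s 1 * (Oi * SS)"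
    using sd_sc[of s "\<lambda>s. s / (s^2 - 1/s^2)"] by simp
  show "sd s (1/(s - 1/s)) = sd s 1 * (Oi * (SS + TT))" unfolding Oi_mult by (rule sd_sc)
  show "sd s (1/s) = sd s 1 * TT" "sd s s = sd s 1 * SS"
    unfolding TT_def SS_def by (rule sd_sc)+
  show "sd s (- c) = - sd s c" using sd_diff[of s 0 c] sd_diff[of s 0 0] by simp
qed

lemma osp_relsE:
  assumes "r \<in> osp_rels s i"
  obtains "r = nsub (nmon 1 [(i,Kp),(i,Ap),(i,Km)]) (nmon s [(i,Ap)])"
  | "r = nsub (nmon 1 [(i,Kp),(i,Am),(i,Km)]) (nmon (1/s) [(i,Am)])"
  | "r = nsub (nadd (nmon 1 [(i,Ap),(i,Am)]) (nmon 1 [(i,Am),(i,Ap)]))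
          (nadd (nmon (1/(s - 1/s)) [(i,Kp),(i,Kp)]) (nmon (-1/(s - 1/s)) [(i,Km),(i,Km)]))"
  | "r = nadd (nmon 1 [(i,Pp),(i,Ap)]) (nmon 1 [(i,Ap),(i,Pp)])"
  | "r = nadd (nmon 1 [(i,Pp),(i,Am)]) (nmon 1 [(i,Am),(i,Pp)])"
  | "r = nsub (nmon 1 [(i,Pp),(i,Kp)]) (nmon 1 [(i,Kp),(i,Pp)])"
  | "r = nsub (nmon 1 [(i,Pp),(i,Km)]) (nmon 1 [(i,Km),(i,Pp)])"
  | "r = nsub (nmon 1 [(i,Kp),(i,Km)]) (nmon 1 [])"
  | "r = nsub (nmon 1 [(i,Km),(i,Kp)]) (nmon 1 [])"
  | "r = nsub (nmon 1 [(i,Pp),(i,Pp)]) (nmon 1 [])"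
  | "r = nsub (nlet i XAp) (expand s i XAp)"
  | "r = nsub (nlet i XAm) (expand s i XAm)"
  | "r = nsub (nlet i XKP) (expand s i XKP)"
  | "r = nsub (nlet i XG) (expand s i XG)"
  using assms unfolding osp_rels_def by fast

text \<open>The relations of \<open>osp_site\<close> are those of the generators with A_- and Gamma
  scaled by q - 1/q; multiplication by \<open>Oi\<close> removes the scaling and recovers the
  defining relations.\<close>

lemma ev_osp_rels:
  assumes "osp_letters \<phi>" "r \<in> osp_rels s i"
  shows "ev s \<phi> r = (0 :: 'k::field fam)"
proof -
  let ?C = "\<phi> (i, Ap)" and ?b = "\<phi> (i, Am)" and ?K = "\<phi> (i, Kp)"
    and ?k = "\<phi> (i, Km)" and ?P = "\<phi> (i, Pp)" and ?G = "\<phi> (i, XG)"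
  interpret osp_site SS TT ?C "Om * ?b" ?K ?k ?P "Om * ?G"
    using assms(1) by (simp add: osp_letters_def)
  have X: "\<phi> (i, XAp) = ?C * ?K" "\<phi> (i, XAm) = ?b * ?K" "\<phi> (i, XKP) = ?K * ?K * ?P"
    using assms(1) by (auto simp: osp_letters_def)
  have Ob: "Oi * (Om * ?b) = ?b" "Oi * (Om * ?G) = ?G"
    by (simp_all add: mult.assoc[symmetric] Om_Oi)
  have OC: "Oi * (?C * (Om * x)) = ?C * x" for x
  proof -
    have "Oi * (?C * (Om * x)) = Oi * Om * ?C * x"
      using fam_central(3)[of ?C] by (simp add: mult.assoc[symmetric])
    then show ?thesis by (simp add: Om_Oi)
  qed
  have Kb: "?K * ?b = TT * (?b * ?K)"
    using arg_cong[OF Ka, of "\<lambda>x. Oi * x"]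
    by (simp add: mult.assoc mult_assoc_rule[OF fam_central(3)[of ?K]] mult_assoc_rule[OF fam_central(4)[of TT, symmetric]]
       mult_assoc_rule[OF Om_Oi(2)])
  have Pb: "?P * ?b = - (?b * ?P)"
    using arg_cong[OF Pa, of "\<lambda>x. Oi * x"]
    by (simp add: mult.assoc mult_assoc_rule[OF fam_central(3)[of ?P]] mult_assoc_rule[OF Om_Oi(2)])
  have "?C * ?b + ?b * ?C = Oi * (?C * (Om * ?b) + Om * ?b * ?C)"
    by (simp add: distrib_left OC) (simp add: mult.assoc[symmetric] Om_Oi)
  also have "\<dots> = Oi * ((SS + TT) * (?K * ?K - ?k * ?k))"
    unfolding Ca aC by (rule arg_cong[where f = "\<lambda>x. Oi * x"]) (simp add: algebra_simps)
  also have "\<dots> = sc (\<lambda>s. 1 / (s - 1/s)) * (?K * ?K - ?k * ?k)"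
    by (simp add: mult.assoc[symmetric] Oi_mult)
  finally have CbbC: "?C * ?b + ?b * ?C = sc (\<lambda>s. 1 / (s - 1/s)) * (?K * ?K) - sc (\<lambda>s. 1 / (s - 1/s)) * (?k * ?k)"
    by (simp add: right_diff_distrib)
  have "?G = Oi * (- (?C * (Om * ?b) * ?P) + TT * ?K * ?K * ?P - SS * ?k * ?k * ?P)"
    by (subst Ob(2)[symmetric], subst gP) simp
  also have "\<dots> = - (?C * ?b * ?P) + Oi * TT * (?K * ?K * ?P) - Oi * SS * (?k * ?k * ?P)"
    by (simp add: distrib_left right_diff_distrib mult.assoc OC)
  finally have G: "?G = - (?C * ?b * ?P) + Oi * TT * (?K * ?K * ?P) - Oi * SS * (?k * ?k * ?P)" .
  note sdS = sd_consts(1) and sdT = sd_consts(2) and sdh = sd_consts(3)[unfolded Oi_mult]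
    and sdOT = sd_consts(4) and sdOS = sd_consts(5) and sdm = sd_consts(6)
  note ev = ev_nsub ev_nadd ev_nmon nfin_binop nlet_eq_nmon
  show ?thesis using assms(2)
  proof (cases rule: osp_relsE)
    case 1
    have "?K * (?C * ?k) = SS * ?C" by (simp add: mult_assoc_rule[OF KC] mult.assoc Kk)
    then show ?thesis by (simp add: 1 ev sdS mult.assoc)
  next
    case 2
    have "?K * (?b * ?k) = TT * ?b" by (simp add: mult_assoc_rule[OF Kb] mult.assoc Kk)
    then show ?thesis by (simp add: 2 ev sdT mult.assoc)
  next
    case 3
    have "ev s \<phi> r = sd s 1 * (?C * ?b + ?b * ?C) - (sd s (1/(s - 1/s)) * (?K * ?K) + sd s (- (1/(s - 1/s))) * (?k * ?k))"
      by (simp add: 3 ev distrib_left)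
    also have "\<dots> = 0"
      unfolding CbbC sdm sdh by (simp add: right_diff_distrib mult.assoc)
    finally show ?thesis .
  next
    case 14
    have "ev s \<phi> r = sd s 1 * ?G - (sd s (-1) * (?C * (?b * ?P)) + (sd s ((1/s) / (s^2 - 1/s^2)) * (?K * (?K * ?P))
        + sd s (- (s / (s^2 - 1/s^2))) * (?k * (?k * ?P))))"
      by (simp add: 14 ev gamma_expr_def ev_nzero)
    also have "\<dots> = 0"
      unfolding sdm sdOT sdOS by (subst G) (simp add: distrib_left right_diff_distrib mult.assoc)
    finally show ?thesis .
  qed (simp_all add: ev X PC Pb PK Pk Kk kK PP mult.assoc)
qed

lemma ev_osp_ideal:
  assumes "osp_letters \<phi>" "x \<in> osp_ideal s k"
  shows "ev s \<phi> x = (0 :: 'k::field fam)"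
  using assms(2)
proof (induction rule: osp_ideal.induct)
  case (gen i r)
  then show ?case using ev_osp_rels[OF assms(1)] by simp
next
  case (comm i j g h)
  then have "\<phi> (i, g) * \<phi> (j, h) = \<phi> (j, h) * \<phi> (i, g)"
    using assms(1) unfolding osp_letters_def by blast
  then show ?case by (simp add: ev_nsub ev_nmon)
next
  case (add x y)
  then show ?case by (simp add: ev_nadd ncp_in_nfin[OF osp_ideal_ncp_in])
next
  case (mul x a b)
  then have "nfin x" "nfin a" "nfin b"
    using osp_ideal_ncp_in ncp_in_nfin by blast+
  then show ?case using mul.IH by (simp add: ev_nmul nfin_binop)
qed (simp add: ev_nzero)

section \<open>Substitution and its passage to classes\<close>

lemma nsubst_free_rep: "free_rep (\<lambda>c (m :: 'k::field ncp) v. c * m v) (\<lambda>l m. nmul (\<phi> l) m)"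
proof
  show "nmul (\<phi> l) (m + m') = nmul (\<phi> l) m + nmul (\<phi> l) m'" for l and m m' :: "'k ncp"
    using nmul_nadd_right[of "\<phi> l" m m'] by (simp add: nadd_def plus_fun_def)
  show "nmul (\<phi> l) (\<lambda>v. a * m v) = (\<lambda>v. a * nmul (\<phi> l) m v)" for l a and m :: "'k ncp"
    by (simp add: nmul_def sum_distrib_left mult_ac)
qed (auto simp: fun_eq_iff algebra_simps)

lemma sum_fun_apply: "(\<Sum>x\<in>A. f x) v = (\<Sum>x\<in>A. f x v)" for f :: "'a \<Rightarrow> 'b \<Rightarrow> 'c::ab_group_add"
  by (induction A rule: infinite_finite_induct) auto

text \<open>Substitution is the action of the free algebra on polynomials in which a letter l
  multiplies by \<phi> l from the left, applied to 1.\<close>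

lemma nsubst_act:
  "nsubst \<phi> f = free_rep.act (\<lambda>c (m :: 'k::field ncp) v. c * m v) (\<lambda>l m. nmul (\<phi> l) m) f none"
proof -
  have "nprod (map \<phi> w) = foldr (\<lambda>l m. nmul (\<phi> l) m) w none" for w
    by (induction w) auto
  then show ?thesis
    unfolding nsubst_def free_rep.act_def[OF nsubst_free_rep] by (simp add: fun_eq_iff sum_fun_apply)
qed

lemma nsubst_nadd: "nfin f \<Longrightarrow> nfin g \<Longrightarrow> nsubst \<phi> (nadd f g) = nadd (nsubst \<phi> f) (nsubst \<phi> g)"
  unfolding nsubst_act by (subst free_rep.act_nadd[OF nsubst_free_rep]) (simp_all add: nadd_def plus_fun_def)

lemma nsubst_nsub: "nfin f \<Longrightarrow> nfin g \<Longrightarrow> nsubst \<phi> (nsub f g) = nsub (nsubst \<phi> f) (nsubst \<phi> g)"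
  unfolding nsubst_act by (subst free_rep.act_nsub[OF nsubst_free_rep]) (simp_all add: nsub_def fun_diff_def)

lemma nsubst_nmon: "nsubst \<phi> (nmon c w) = nmul (nconst c) (nprod (map \<phi> w))"
proof -
  have "nprod (map \<phi> w) = foldr (\<lambda>l m. nmul (\<phi> l) m) w none" for w
    by (induction w) auto
  then show ?thesis
    unfolding nsubst_act free_rep.act_nmon[OF nsubst_free_rep] by (simp add: nmul_nconst_left)
qed

lemma nsubst_nzero: "nsubst \<phi> nzero = nzero"
  by (simp add: nsubst_def nzero_def)

lemma nsubst_nmul: "nfin f \<Longrightarrow> nfin g \<Longrightarrow> nsubst \<phi> (nmul f g) = nmul (nsubst \<phi> f) (nsubst \<phi> g)"
proof -
  assume fin: "nfin f" "nfin g"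
  have "free_rep.act (\<lambda>c m v. c * m v) (\<lambda>l m. nmul (\<phi> l) m) f m
      = nmul (nsubst \<phi> f) m" for m :: "'a ncp"
  proof -
    have "foldr (\<lambda>l m. nmul (\<phi> l) m) w m = nmul (nprod (map \<phi> w)) m" for w
      by (induction w) (auto simp: nmul_assoc)
    then have "free_rep.act (\<lambda>c m v. c * m v) (\<lambda>l m. nmul (\<phi> l) m) f m
        = (\<lambda>v. \<Sum>w | f w \<noteq> 0. f w * nmul (nprod (map \<phi> w)) m v)"
      unfolding free_rep.act_def[OF nsubst_free_rep] by (simp add: fun_eq_iff sum_fun_apply)
    also have "\<dots> = nmul (nsubst \<phi> f) m"
      by (simp add: nsubst_def nmul_def sum_distrib_left sum_distrib_right mult.assoc)
        (subst sum.swap, rule refl)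
    finally show ?thesis .
  qed
  note act_f = this
  have "nsubst \<phi> (nmul f g) = free_rep.act (\<lambda>c m v. c * m v) (\<lambda>l m. nmul (\<phi> l) m) f (nsubst \<phi> g)"
    unfolding nsubst_act by (rule free_rep.act_nmul[OF nsubst_free_rep fin])
  then show ?thesis by (simp only: act_f)
qed

lemma nfin_nsubst: "nfin f \<Longrightarrow> (\<And>l. nfin (\<phi> l)) \<Longrightarrow> nfin (nsubst \<phi> f)"
proof -
  assume f: "nfin f" and phi: "\<And>l. nfin (\<phi> l)"
  obtain K where K: "\<And>l. ncp_in (K l) (\<phi> l)" using nfin_ncp_in[OF phi] by metis
  let ?L = "\<Union>w\<in>{w. f w \<noteq> 0}. set w"
  have fin: "finite ?L" using f by (simp add: nfin_def)
  have "ncp_in (\<Sum>l\<in>?L. K l) (nsubst \<phi> f)"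
  proof (rule ncp_in_nsubst[OF f])
    fix w l assume "f w \<noteq> 0" "l \<in> set w"
    then have "K l \<le> (\<Sum>l\<in>?L. K l)" using fin by (intro member_le_sum) auto
    then show "ncp_in (\<Sum>l\<in>?L. K l) (\<phi> l)" by (rule ncp_in_mono[OF K])
  qed
  then show ?thesis by (rule ncp_in_nfin)
qed

lemma at_sum: "finite W \<Longrightarrow> (\<And>w. w \<in> W \<Longrightarrow> nfin (h w)) \<Longrightarrow>
    nfin (\<lambda>v. \<Sum>w\<in>W. c w * h w v) \<and> at_param s (\<lambda>v. \<Sum>w\<in>W. c w * h w v) = (\<Sum>w\<in>W. sd s (c w) * at_param s (h w))"
proof (induction W rule: finite_induct)
  case empty
  have "at_param s nzero = 0" by (simp add: at_param_def zero_fam_def)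
  then show ?case using nfin_closed(1) by (simp add: nzero_def)
next
  case (insert w W)
  let ?r = "\<lambda>v. \<Sum>w\<in>W. c w * h w v"
  have r: "nfin ?r" "at_param s ?r = (\<Sum>w\<in>W. sd s (c w) * at_param s (h w))" using insert by auto
  have eq: "(\<lambda>v. \<Sum>w\<in>insert w W. c w * h w v) = nadd (nmul (nconst (c w)) (h w)) ?r"
    using insert.hyps by (simp add: nmul_nconst_left nadd_def)
  have hw: "nfin (h w)" using insert.prems by simp
  have "at_param s (nconst (c w)) = sd s (c w)" by (simp add: at_nmon flip: nmon_Nil)
  then show ?case unfolding eq using hw r insert.hyps
    by (simp add: at_arith nfin_binop)
qed

text \<open>The bridge from the concrete operators to the product ring: \<open>delta_op\<close>,
  \<open>tau_op\<close> and \<open>shift\<close> are all substitutions, and the class of the result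
  depends on the substituted polynomials only through their classes.\<close>

lemma at_nsubst:
  assumes "nfin x" and "\<And>l. nfin (\<phi>' l)"
    and "\<And>w l. x w \<noteq> 0 \<Longrightarrow> l \<in> set w \<Longrightarrow> at_param s (\<phi>' l) = sd s 1 * \<phi> l"
  shows "at_param s (nsubst \<phi>' x) = ev s \<phi> x"
proof -
  have fin: "nfin (nprod (map \<phi>' w))" for w
    using assms(2) by (intro nfin_nprod) auto
  have prod: "(\<And>l. l \<in> set w \<Longrightarrow> at_param s (\<phi>' l) = sd s 1 * \<phi> l)
      \<Longrightarrow> at_param s (nprod (map \<phi>' w)) = sd s 1 * prod_list (map \<phi> w)" for w
  proof (induction w)
    case Nil
    show ?case by (simp add: none_def nmon_Nil[symmetric] at_nmon)
  next
    case (Cons l w)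
    have "at_param s (nprod (map \<phi>' (l # w))) = sd s 1 * \<phi> l * (sd s 1 * prod_list (map \<phi> w))"
      using Cons by (simp add: at_arith assms(2) fin)
    also have "\<dots> = sd s 1 * sd s 1 * \<phi> l * prod_list (map \<phi> w)"
      by (simp add: sd_central[of "\<phi> l"] mult.assoc mult_assoc_rule[OF sd_central[of "\<phi> l"]])
    finally show ?case by (simp add: sd_mult[symmetric] mult.assoc)
  qed
  have sd1: "sd s c * (sd s 1 * y) = sd s c * y" for c y
    by (simp add: mult.assoc[symmetric] sd_mult[symmetric])
  have "at_param s (nsubst \<phi>' x) = (\<Sum>w | x w \<noteq> 0. sd s (x w) * at_param s (nprod (map \<phi>' w)))"
    unfolding nsubst_def using assms(1) at_sum[of "{w. x w \<noteq> 0}" "\<lambda>w. nprod (map \<phi>' w)" x s] fin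
    by (simp add: nfin_def)
  also have "\<dots> = ev s \<phi> x"
    unfolding ev_eq_sum using assms(3) by (intro sum.cong refl) (simp add: prod sd1)
  finally show ?thesis .
qed

lemma at_eq_ev: "nfin x \<Longrightarrow> at_param s x = ev s gl x"
proof -
  assume x: "nfin x"
  have "(\<lambda>v. \<Sum>w | x w \<noteq> 0. x w * nmon 1 w v) = x"
  proof
    fix v
    have "(\<Sum>w | x w \<noteq> 0. x w * nmon 1 w v) = (\<Sum>w | x w \<noteq> 0. if w = v then x v else 0)"
      by (intro sum.cong) (auto simp: nmon_def)
    also have "\<dots> = x v" using x by (simp add: nfin_def)
    finally show "(\<Sum>w | x w \<noteq> 0. x w * nmon 1 w v) = x v" .
  qed
  then have "at_param s x = (\<Sum>w | x w \<noteq> 0. sd s (x w) * at_param s (nmon 1 w))"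
    using conjunct2[OF at_sum[OF x[unfolded nfin_def], of "\<lambda>w. nmon 1 w" x s]] by simp
  also have "\<dots> = ev s gl x"
    unfolding ev_eq_sum at_nmon by (simp add: mult.assoc[symmetric] sd_mult[symmetric])
  finally show ?thesis .
qed

section \<open>The coproduct on letters\<close>

definition delta_img :: "nat \<Rightarrow> nat \<times> sym \<Rightarrow> 'k::field fam" where
  "delta_img p l = cl (\<lambda>s. delta_letter s p l)"

lemma nfin_dgen0: "nfin (dgen0 p g)"
  by (cases g) (auto intro!: nfin_binop)

lemma nfin_expand: "nfin (expand s p g)"
  by (cases g) (auto simp: gamma_expr_def intro!: nfin_binop)

lemma nfin_delta_letter: "nfin (delta_letter s p l)"
  by (cases l) (auto simp: delta_letter_def intro!: nfin_nsubst nfin_expand nfin_dgen0)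

lemma at_delta_letter: "at_param s (delta_letter s p l) = sd s 1 * delta_img p l"
  unfolding delta_img_def by (rule at_cl) (simp add: ffin_def nfin_delta_letter)

lemma delta_img_other:
  "i < p \<Longrightarrow> delta_img p (i, g) = gl (i, g)"
  "p < i \<Longrightarrow> delta_img p (i, g) = gl (Suc i, g)"
  by (simp_all add: delta_img_def delta_letter_def gl_def nlet_eq_nmon)

abbreviation site_at :: "(nat \<times> sym \<Rightarrow> 'k::field fam) \<Rightarrow> nat \<Rightarrow> bool" where
  "site_at \<phi> i \<equiv> osp_site SS TT (\<phi> (i, Ap)) (Om * \<phi> (i, Am)) (\<phi> (i, Kp)) (\<phi> (i, Km)) (\<phi> (i, Pp)) (Om * \<phi> (i, XG))"

lemma site_gl: "site_at gl i"
  using osp_letters_gl unfolding osp_letters_def by blast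

lemma gl_X: "gl (i, XAp) = (gl (i, Ap) * gl (i, Kp) :: 'k::field fam)" "gl (i, XAm) = (gl (i, Am) * gl (i, Kp) :: 'k::field fam)"
    "gl (i, XKP) = (gl (i, Kp) * gl (i, Kp) * gl (i, Pp) :: 'k::field fam)"
  using osp_letters_gl unfolding osp_letters_def by blast+

lemma gl_comm: "i \<noteq> j \<Longrightarrow> gl (i, g) * gl (j, h) = (gl (j, h) * gl (i, g) :: 'k::field fam)"
  using osp_letters_gl unfolding osp_letters_def by blast

lemma Om_left: "x * (Om * y) = Om * (x * y)" for x y :: "'k::field fam"
  by (rule trans[OF mult_assoc_rule[OF fam_central(3)]]) (simp add: mult.assoc)

lemma Om_gl: "gl l * (Om * y) = Om * (gl l * y)"
  and Om_delta: "delta_img p l * (Om * y) = Om * (delta_img p l * y)" for y :: "'k::field fam"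
  by (rule Om_left)+

lemma commutes_fam: "commutes SS z" "commutes TT z" "commutes Om z" "commutes Oi z" for z :: "'k::field fam"
  by (simp_all only: commutes_def fam_central[of z])

lemma commutes_gl: "i \<noteq> j \<Longrightarrow> commutes (gl (i, g)) (gl (j, h) :: 'k::field fam)"
  using gl_comm by (auto simp: commutes_def)

lemma site2_gl:
  assumes "p \<noteq> q"
  shows "osp_site2 SS TT (gl (p, Ap)) (Om * gl (p, Am)) (gl (p, Kp)) (gl (p, Km)) (gl (p, Pp)) (Om * gl (p, XG) :: 'k::field fam)
     (gl (q, Ap)) (Om * gl (q, Am)) (gl (q, Kp)) (gl (q, Km)) (gl (q, Pp)) (Om * gl (q, XG))"
proof (intro osp_site2.intro osp_site2_axioms.intro site_gl)
  note c = gl_comm[OF assms[symmetric]]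
  fix v l :: "'k fam"
  assume "v \<in> {gl (q, Ap), Om * gl (q, Am), gl (q, Kp), gl (q, Km), gl (q, Pp)}"
    and "l \<in> {gl (p, Ap), Om * gl (p, Am), gl (p, Kp), gl (p, Km), gl (p, Pp)}"
  then show "v * l = l * v"
    by (auto simp: c Om_gl mult.assoc mult_assoc_rule[OF c])
qed

lemma delta_img_base:
  "delta_img p (p, Ap) = (gl (p, Ap) * gl (Suc p, Kp) * gl (Suc p, Pp) + gl (p, Km) * gl (Suc p, Ap) :: 'k::field fam)"
  "delta_img p (p, Am) = (gl (p, Am) * gl (Suc p, Kp) * gl (Suc p, Pp) + gl (p, Km) * gl (Suc p, Am) :: 'k::field fam)"
  "delta_img p (p, Kp) = (gl (p, Kp) * gl (Suc p, Kp) :: 'k::field fam)"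
  "delta_img p (p, Km) = (gl (p, Km) * gl (Suc p, Km) :: 'k::field fam)"
  "delta_img p (p, Pp) = (gl (p, Pp) * gl (Suc p, Pp) :: 'k::field fam)"
  by (simp_all add: delta_img_def delta_letter_def nlet_eq_nmon nsubst_nmon cl_arith cl_nmon mult.assoc
      flip: none_def)

lemma cl_dgen0:
  "g \<in> {Ap, Am, Kp, Km, Pp} \<Longrightarrow> cl (\<lambda>s. dgen0 p g) = (delta_img p (p, g) :: 'k::field fam)"
  by (elim insertE; simp add: delta_img_def delta_letter_def nlet_eq_nmon nsubst_nmon flip: none_def)

lemma delta_img_X:
  "delta_img p (p, XAp) = (delta_img p (p, Ap) * delta_img p (p, Kp) :: 'k::field fam)"
  "delta_img p (p, XAm) = (delta_img p (p, Am) * delta_img p (p, Kp) :: 'k::field fam)"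
  "delta_img p (p, XKP) = (delta_img p (p, Kp) * delta_img p (p, Kp) * delta_img p (p, Pp) :: 'k::field fam)"
  by (simp_all add: delta_img_def[of p "(p, XAp)"] delta_img_def[of p "(p, XAm)"] delta_img_def[of p "(p, XKP)"]
      delta_letter_def nsubst_nmon cl_arith ffin_def nfin_dgen0 nfin_binop cl_dgen0 mult.assoc del: dgen0.simps flip: none_def)

lemma delta_img_G:
  "Om * delta_img p (p, XG) = (- (delta_img p (p, Ap) * (Om * delta_img p (p, Am)) * delta_img p (p, Pp))
     + TT * delta_img p (p, Kp) * delta_img p (p, Kp) * delta_img p (p, Pp)
     - SS * delta_img p (p, Km) * delta_img p (p, Km) * delta_img p (p, Pp) :: 'k::field fam)"
proof -
  let ?d = "\<lambda>g. delta_img p (p, g) :: 'k fam"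
  have "?d XG = sc (\<lambda>s. -1) * (?d Ap * (?d Am * ?d Pp))
      + (sc (\<lambda>s. (1/s) / (s^2 - 1/s^2)) * (?d Kp * (?d Kp * ?d Pp))
      + (sc (\<lambda>s. - s / (s^2 - 1/s^2)) * (?d Km * (?d Km * ?d Pp))))"
  proof -
    have add0: "nadd x nzero = x" for x :: "'k ncp" by (simp add: nadd_def nzero_def)
    show ?thesis
      unfolding delta_img_def[of p "(p, XG)"]
      by (simp add: delta_letter_def gamma_expr_def nsubst_nadd nsubst_nmon nsubst_nzero nfin_binop add0
          cl_arith ffin_def nfin_dgen0 cl_dgen0 sc_def del: dgen0.simps)
  qed
  also have "sc (\<lambda>s. (1/s) / (s^2 - 1/s^2)) = Oi * (TT :: 'k fam)"
    unfolding TT_def Oi_def sc_mult[symmetric] by (rule sc_cong) simp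
  also have "sc (\<lambda>s. - s / (s^2 - 1/s^2)) = - (Oi * (SS :: 'k fam))"
    unfolding SS_def Oi_def sc_mult[symmetric] sc_uminus[symmetric] by (rule sc_cong) simp
  also have "sc (\<lambda>s. -1) = (- 1 :: 'k fam)"
    unfolding sc_uminus by simp
  finally show ?thesis
    by (simp add: distrib_left right_diff_distrib mult.assoc mult_assoc_rule[OF Om_Oi(1)] Om_delta)
qed

lemma osp_letters_delta: "osp_letters (delta_img p :: nat \<times> sym \<Rightarrow> 'k::field fam)"
  and delta_img_coaction:
  "delta_img p (p, XAp) = (gl (p, XAp) * gl (Suc p, XKP) + gl (Suc p, XAp) :: 'k::field fam)"
  "Om * delta_img p (p, XAm) = (Om * gl (p, XAm) * gl (Suc p, XKP) + Om * gl (Suc p, XAm) :: 'k::field fam)"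
  "delta_img p (p, XKP) = (gl (p, XKP) * gl (Suc p, XKP) :: 'k::field fam)"
  "Om * delta_img p (p, XG) = ((Om * gl (p, XG) + (SS - TT) * gl (p, Km) * gl (p, Km) * gl (p, Pp)) * gl (Suc p, XKP)
      + TT * gl (p, Ap) * gl (p, Km) * gl (p, Pp) * (Om * gl (Suc p, XAm))
      - gl (p, Km) * (Om * gl (p, Am)) * gl (p, Pp) * gl (Suc p, XAp)
      + gl (p, Km) * gl (p, Km) * gl (p, Pp) * (Om * gl (Suc p, XG)) :: 'k::field fam)"
proof -
  let ?d = "\<lambda>g. delta_img p (p, g) :: 'k fam"
  let ?C = "gl (p, Ap) :: 'k fam" and ?b = "gl (p, Am) :: 'k fam" and ?K = "gl (p, Kp) :: 'k fam"
    and ?k = "gl (p, Km) :: 'k fam" and ?P = "gl (p, Pp) :: 'k fam" and ?G = "gl (p, XG) :: 'k fam"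
  let ?C' = "gl (Suc p, Ap) :: 'k fam" and ?b' = "gl (Suc p, Am) :: 'k fam" and ?K' = "gl (Suc p, Kp) :: 'k fam"
    and ?k' = "gl (Suc p, Km) :: 'k fam" and ?P' = "gl (Suc p, Pp) :: 'k fam" and ?G' = "gl (Suc p, XG) :: 'k fam"
  interpret s2: osp_site2 SS TT ?C "Om * ?b" ?K ?k ?P "Om * ?G" ?C' "Om * ?b'" ?K' ?k' ?P' "Om * ?G'"
    by (rule site2_gl) simp
  have b: "Om * ?d Am = Om * ?b * ?K' * ?P' + ?k * (Om * ?b')"
    by (simp add: delta_img_base distrib_left mult.assoc Om_gl)
  let ?D = "(Om * ?G + (SS - TT) * ?k * ?k * ?P) * (?K' * ?K' * ?P') + TT * ?C * ?k * ?P * (Om * ?b' * ?K')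
      - ?k * (Om * ?b) * ?P * (?C' * ?K') + ?k * ?k * ?P * (Om * ?G')"
  note cs = s2.coproduct_site
  interpret d: osp_site SS TT "?d Ap" "Om * ?d Am" "?d Kp" "?d Km" "?d Pp" ?D
    unfolding b unfolding delta_img_base(1,3,4,5) by (rule cs)
  \<comment> \<open>The letter \<open>XG\<close> is sent to the expression of the Casimir element in
    the images of the generators; in the site \<open>d\<close> the same expression equals
    \<open>?D\<close> by \<open>gP\<close>.\<close>
  have G: "Om * ?d XG = ?D"
    unfolding delta_img_G by (rule d.gP[symmetric])
  have site: "site_at (delta_img p :: _ \<Rightarrow> 'k fam) p"
    unfolding G by (rule d.osp_site_axioms)
  have comm: "delta_img p (i, g) * delta_img p (j, h) = (delta_img p (j, h) * delta_img p (i, g) :: 'k fam)"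
    if "i \<noteq> j" for i j g h
  proof -
    have base: "commutes (?d g) (gl (q, h))" if q: "q \<noteq> p" "q \<noteq> Suc p" for q g h
    proof -
      note c = commutes_gl[OF q(1)[symmetric]] commutes_gl[OF q(2)[symmetric]]
      have 1: "commutes (?d g) (gl (q, h))" if "g \<in> {Ap, Am, Kp, Km, Pp}" for g
        using that by (elim insertE) (simp_all add: delta_img_base commutes_intros c)
      have "commutes (Oi * (Om * ?d XG)) (gl (q, h))"
        unfolding delta_img_G by (intro commutes_intros commutes_fam 1) simp_all
      then have "commutes (?d XG) (gl (q, h))"
        by (simp add: mult.assoc[symmetric] Om_Oi)
      then show ?thesis
        by (cases g) (simp_all add: 1 delta_img_X commutes_intros)
    qed
    have "commutes (delta_img p (i, g)) (delta_img p (j, h) :: 'k fam)"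
    proof -
      consider "i = p" | "j = p" | "i \<noteq> p" "j \<noteq> p" by blast
      then show ?thesis
      proof cases
        case 1
        then show ?thesis using that base[of j g h] base[of "Suc j" g h]
          by (cases "j < p") (auto simp: delta_img_other)
      next
        case 2
        then show ?thesis using that base[of i h g] base[of "Suc i" h g]
          by (cases "i < p") (auto simp: delta_img_other intro: commutes_sym)
      next
        case 3
        then show ?thesis using that
          by (cases "i < p"; cases "j < p") (auto simp: delta_img_other intro!: commutes_gl)
      qed
    qed
    then show ?thesis by (simp add: commutes_def)
  qed
  show "osp_letters (delta_img p :: nat \<times> sym \<Rightarrow> 'k fam)"
    unfolding osp_letters_def
  proof (intro conjI allI impI)
    fix i
    consider "i < p" | "i = p" | "p < i" by linarith
    then show "site_at (delta_img p :: _ \<Rightarrow> 'k fam) i" "delta_img p (i, XAp) = (delta_img p (i, Ap) * delta_img p (i, Kp) :: 'k fam)"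
      "delta_img p (i, XAm) = (delta_img p (i, Am) * delta_img p (i, Kp) :: 'k fam)"
      "delta_img p (i, XKP) = (delta_img p (i, Kp) * delta_img p (i, Kp) * delta_img p (i, Pp) :: 'k fam)"
      by (cases; simp add: delta_img_other site_gl gl_X; simp add: site delta_img_X)+
  qed (rule comm)
  show "delta_img p (p, XAp) = (gl (p, XAp) * gl (Suc p, XKP) + gl (Suc p, XAp) :: 'k::field fam)"
    by (simp only: delta_img_X delta_img_base gl_X s2.coproduct_x)
  show "Om * delta_img p (p, XAm) = (Om * gl (p, XAm) * gl (Suc p, XKP) + Om * gl (Suc p, XAm) :: 'k fam)"
    using s2.coproduct_x(2)[folded b]
    by (simp add: delta_img_X delta_img_base(3) gl_X mult.assoc[symmetric])
  show "delta_img p (p, XKP) = (gl (p, XKP) * gl (Suc p, XKP) :: 'k fam)"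
    by (simp only: delta_img_X delta_img_base gl_X s2.coproduct_x)
  show "Om * delta_img p (p, XG) = ((Om * gl (p, XG) + (SS - TT) * gl (p, Km) * gl (p, Km) * gl (p, Pp)) * gl (Suc p, XKP)
      + TT * gl (p, Ap) * gl (p, Km) * gl (p, Pp) * (Om * gl (Suc p, XAm))
      - gl (p, Km) * (Om * gl (p, Am)) * gl (p, Pp) * gl (Suc p, XAp)
      + gl (p, Km) * gl (p, Km) * gl (p, Pp) * (Om * gl (Suc p, XG)) :: 'k fam)"
    unfolding G by (simp add: gl_X mult.assoc)
qed

section \<open>A module for osp_q(1|2)\<close>

context central_unit
begin

definition zp :: "int \<Rightarrow> 'a" where "zp n = (if n \<ge> 0 then S ^ nat n else T ^ nat (- n))"
definition eps :: "int \<Rightarrow> 'a" where "eps n = (if even n then 1 else - 1)"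

lemma S_zp: "S = zp 1" and T_zp: "T = zp (- 1)" and zp_0: "zp 0 = 1"
  by (simp_all add: zp_def)

lemma zp_central: "v * zp n = zp n * v"
proof -
  have "v * S ^ k = S ^ k * v" for k by (induction k) (simp_all add: S_central mult.assoc mult_assoc_rule[OF S_central])
  moreover have "v * T ^ k = T ^ k * v" for k by (induction k) (simp_all add: T_central mult.assoc mult_assoc_rule[OF T_central])
  ultimately show ?thesis by (simp add: zp_def)
qed

lemma zp_Suc: "S * zp n = zp (n + 1)"
proof (cases "n \<ge> 0")
  case True
  then show ?thesis by (simp add: zp_def nat_add_distrib)
next
  case False
  then obtain k where k: "n = - int (Suc k)" by (metis int_cases not_le of_nat_0_le_iff)
  then show ?thesis by (auto simp: zp_def mult_assoc_rule[OF ST] nat_add_distrib split: if_splits)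
qed

lemma zp_pred: "T * zp n = zp (n - 1)"
  using mult_assoc_rule[OF TS, of "zp (n - 1)"] zp_Suc[of "n - 1"] by simp

lemma zp_mult: "zp m * zp n = zp (m + n)"
proof (induction m rule: int_induct[where k = 0])
  case base
  then show ?case by (simp add: zp_0)
next
  case (step1 i)
  have "zp (i + 1) * zp n = S * (zp i * zp n)" by (simp add: zp_Suc[symmetric] mult.assoc)
  also have "\<dots> = zp (i + 1 + n)" by (simp add: step1 zp_Suc algebra_simps)
  finally show ?case .
next
  case (step2 i)
  have "zp (i - 1) * zp n = T * (zp i * zp n)" by (simp add: zp_pred[symmetric] mult.assoc)
  also have "\<dots> = zp (i - 1 + n)" by (simp add: step2 zp_pred algebra_simps)
  finally show ?case .
qed

lemmas zp_simps = zp_mult mult_assoc_rule[OF zp_mult] zp_Suc zp_pred mult_assoc_rule[OF zp_Suc] mult_assoc_rule[OF zp_pred]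
  S_zp[symmetric] T_zp[symmetric] zp_0

text \<open>
  The module with basis e(n, j, c), where e(n, j, c) is x^n K^j g^c e(0, 0, 0) for n >= 0 and
  y^(-n) K^j g^c e(0, 0, 0) for n <= 0, and P fixes e(0, 0, 0).  Vectors are coefficient functions, so the
  operators appear pulled back; the long branches are xy and yx written in terms of z and g.
\<close>
definition Kop :: "(int \<times> int \<times> int \<Rightarrow> 'a) \<Rightarrow> int \<times> int \<times> int \<Rightarrow> 'a" where
  "Kop m = (\<lambda>(n, j, c). zp n * m (n, j - 1, c))"
definition kop :: "(int \<times> int \<times> int \<Rightarrow> 'a) \<Rightarrow> int \<times> int \<times> int \<Rightarrow> 'a" where
  "kop m = (\<lambda>(n, j, c). zp (- n) * m (n, j + 1, c))"
definition Pop :: "(int \<times> int \<times> int \<Rightarrow> 'a) \<Rightarrow> int \<times> int \<times> int \<Rightarrow> 'a" where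
  "Pop m = (\<lambda>(n, j, c). eps n * m (n, j, c))"
definition Gop :: "(int \<times> int \<times> int \<Rightarrow> 'a) \<Rightarrow> int \<times> int \<times> int \<Rightarrow> 'a" where
  "Gop m = (\<lambda>(n, j, c). m (n, j, c - 1))"
definition Xop :: "(int \<times> int \<times> int \<Rightarrow> 'a) \<Rightarrow> int \<times> int \<times> int \<Rightarrow> 'a" where
  "Xop m = (\<lambda>(n, j, c). if n \<ge> 1 then m (n - 1, j, c) else
     - (eps n * zp (2 * n - 1) * m (n - 1, j - 2, c - 1)) + zp (4 * n - 2) * m (n - 1, j - 4, c) - m (n - 1, j, c))"
definition Yop :: "(int \<times> int \<times> int \<Rightarrow> 'a) \<Rightarrow> int \<times> int \<times> int \<Rightarrow> 'a" where
  "Yop m = (\<lambda>(n, j, c). if n \<le> - 1 then m (n + 1, j, c) else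
     eps n * zp (2 * n + 1) * m (n + 1, j - 2, c - 1) + zp (4 * n + 2) * m (n + 1, j - 4, c) - m (n + 1, j, c))"

lemmas op_defs = Kop_def kop_def Pop_def Gop_def Xop_def Yop_def

lemma eps_comm: "v * eps n = eps n * v" by (simp add: eps_def)
lemma eps_sq: "eps n * eps n = 1" "eps n * (eps n * v) = v" by (simp_all add: eps_def)
lemma eps_shift: "eps (n - 1) = - eps n" "eps (n + 1) = - eps n" "eps (1 + n) = - eps n" by (simp_all add: eps_def)

lemmas eps_rules = eps_comm[of "zp _"] mult_assoc_rule[OF eps_comm[of "zp _"]]
  eps_comm[of S] mult_assoc_rule[OF eps_comm[of S]] eps_comm[of T] mult_assoc_rule[OF eps_comm[of T]]

text \<open>The operators have central coefficients, hence are linear over the whole ring and not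
  only over the scalars. This lets the other tensor positions act on the coefficients of a vector,
  as in \<open>mact_commute\<close>.\<close>

lemma op_lmult:
  "Kop (\<lambda>v. y * m v) = (\<lambda>v. y * Kop m v)" "kop (\<lambda>v. y * m v) = (\<lambda>v. y * kop m v)"
  "Pop (\<lambda>v. y * m v) = (\<lambda>v. y * Pop m v)" "Gop (\<lambda>v. y * m v) = (\<lambda>v. y * Gop m v)"
  "Xop (\<lambda>v. y * m v) = (\<lambda>v. y * Xop m v)" "Yop (\<lambda>v. y * m v) = (\<lambda>v. y * Yop m v)"
  by (simp_all add: op_defs fun_eq_iff algebra_simps zp_central[of y] mult_assoc_rule[OF zp_central[of y]]
    eps_comm[of y] mult_assoc_rule[OF eps_comm[of y]])

lemma op_add:
  "Kop (\<lambda>v. m v + m' v) = (\<lambda>v. Kop m v + Kop m' v)" "kop (\<lambda>v. m v + m' v) = (\<lambda>v. kop m v + kop m' v)"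
  "Pop (\<lambda>v. m v + m' v) = (\<lambda>v. Pop m v + Pop m' v)" "Gop (\<lambda>v. m v + m' v) = (\<lambda>v. Gop m v + Gop m' v)"
  "Xop (\<lambda>v. m v + m' v) = (\<lambda>v. Xop m v + Xop m' v)" "Yop (\<lambda>v. m v + m' v) = (\<lambda>v. Yop m v + Yop m' v)"
  by (simp_all add: op_defs fun_eq_iff algebra_simps)

lemma op_Kk: "Kop (kop m) = m" "kop (Kop m) = m"
  by (simp_all add: op_defs fun_eq_iff zp_simps)

lemma op_PP: "Pop (Pop m) = m"
  by (simp add: op_defs fun_eq_iff eps_sq)

lemma op_PK: "Pop (Kop m) = Kop (Pop m)" "Pop (kop m) = kop (Pop m)"
  by (simp_all add: op_defs fun_eq_iff eps_def)

lemma op_KX: "Kop (Xop (kop m)) = (\<lambda>v. S * Xop m v)"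
  and op_KY: "Kop (Yop (kop m)) = (\<lambda>v. T * Yop m v)"
  by (simp_all add: op_defs fun_eq_iff algebra_simps zp_simps eps_rules)

lemma op_PX: "Pop (Xop m) = (\<lambda>v. - Xop (Pop m) v)"
  and op_PY: "Pop (Yop m) = (\<lambda>v. - Yop (Pop m) v)"
  by (simp_all add: op_defs fun_eq_iff eps_shift algebra_simps eps_sq mult_assoc_rule[OF eps_comm[of "zp _"]])

text \<open>Since x = A_+K, the generator A_+ is \<open>Xop\<close> after \<open>kop\<close>;
  likewise (q - 1/q) A_- is \<open>Yop\<close> after \<open>kop\<close>. The factor S + T is that of
  the anticommutator relation after this scaling.\<close>

lemma op_CaaC: "Xop (kop (Yop (kop m))) v + Yop (kop (Xop (kop m))) v
    = (S + T) * (Kop (Kop m) v - kop (kop m) v)"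
  by (cases v) (simp add: op_defs eps_shift algebra_simps zp_simps eps_rules)

lemma op_G: "Gop m v = - Xop (kop (Yop (kop (Pop m)))) v + T * Kop (Kop (Pop m)) v - S * kop (kop (Pop m)) v"
  by (cases v) (simp add: op_defs eps_shift algebra_simps zp_simps eps_rules eps_sq)

end

section \<open>Reduction coefficients and their realisation in the module\<close>

context central_unit
begin

text \<open>
  z x^n = sgm n x^n z and z y^n = sgm (-n) y^n z.
\<close>
definition sgm :: "int \<Rightarrow> 'a" where "sgm n = eps n * zp (2 * n)"

lemma sgm_Suc: "- (S * S * sgm n) = sgm (n + 1)" and sgm_pred: "- (T * T * sgm n) = sgm (n - 1)"
  by (simp_all add: sgm_def eps_shift algebra_simps eps_rules zp_simps)

lemma sgm_0: "sgm 0 = 1"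
  by (simp add: sgm_def eps_def zp_0)

lemma sgm_central: "v * sgm n = sgm n * v"
  by (simp add: sgm_def mult.assoc eps_comm[of v] mult_assoc_rule[OF eps_comm[of v]] zp_central[of v])

text \<open>The normal form of x times the monomial with exponents (n, b, c). For n < 0 the three
  terms are those of xy, and each z that is moved past the remaining power of y contributes a factor
  sgm (n + 1). Coefficients are kept as a list because the same list is read twice: by
  \<open>embed\<close> in the module and by \<open>total\<close> in any algebra with the
  \<open>gwa\<close> relations.\<close>

fun stepx :: "int \<times> nat \<times> nat \<Rightarrow> ('a \<times> (int \<times> nat \<times> nat)) list" where
  "stepx (n, b, c) = (if n \<ge> 0 then [(1, (n + 1, b, c))] else
     [(- (T * sgm (n + 1)), (n + 1, b + 1, c + 1)), (T * T * sgm (n + 1) * sgm (n + 1), (n + 1, b + 2, c)), (- 1, (n + 1, b, c))])"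

fun stepy :: "int \<times> nat \<times> nat \<Rightarrow> ('a \<times> (int \<times> nat \<times> nat)) list" where
  "stepy (n, b, c) = (if n \<le> 0 then [(1, (n - 1, b, c))] else
     [(S * sgm (n - 1), (n - 1, b + 1, c + 1)), (S * S * sgm (n - 1) * sgm (n - 1), (n - 1, b + 2, c)), (- 1, (n - 1, b, c))])"

fun stepz :: "int \<times> nat \<times> nat \<Rightarrow> ('a \<times> (int \<times> nat \<times> nat)) list" where
  "stepz (n, b, c) = [(sgm n, (n, b + 1, c))]"

fun stepg :: "int \<times> nat \<times> nat \<Rightarrow> ('a \<times> (int \<times> nat \<times> nat)) list" where
  "stepg (n, b, c) = [(1, (n, b, c + 1))]"

text \<open>
  z is K^2P, so z^b corresponds to the exponent j = 2b.
\<close>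
definition emb :: "int \<times> nat \<times> nat \<Rightarrow> int \<times> int \<times> int" where
  "emb = (\<lambda>(n, b, c). (n, 2 * int b, int c))"

lemma emb_inj: "emb v = emb v' \<longleftrightarrow> v = v'"
  by (cases v; cases v') (auto simp: emb_def)

definition single :: "int \<times> int \<times> int \<Rightarrow> 'a \<Rightarrow> int \<times> int \<times> int \<Rightarrow> 'a" where
  "single v d = (\<lambda>u. if u = v then d else 0)"

definition embed :: "('a \<times> (int \<times> nat \<times> nat)) list \<Rightarrow> int \<times> int \<times> int \<Rightarrow> 'a" where
  "embed L = (\<lambda>u. \<Sum>(d, v)\<leftarrow>L. single (emb v) d u)"

lemma Xop_single: "Xop (single (emb v) d) = embed (map (\<lambda>(e, v'). (e * d, v')) (stepx v))"
proof (cases v)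
  case (fields n b c)
  show ?thesis
    by (cases "n \<ge> 0")
      (auto simp: fields Xop_def embed_def single_def emb_def fun_eq_iff sgm_def algebra_simps eps_rules eps_sq zp_simps
        eps_comm[of "T"] mult_assoc_rule[OF eps_comm[of T]])
qed

lemma Yop_single: "Yop (single (emb v) d) = embed (map (\<lambda>(e, v'). (e * d, v')) (stepy v))"
proof (cases v)
  case (fields n b c)
  show ?thesis
    by (cases "n \<le> 0")
      (auto simp: fields Yop_def embed_def single_def emb_def fun_eq_iff sgm_def algebra_simps eps_rules eps_sq zp_simps
        eps_comm[of "S"] mult_assoc_rule[OF eps_comm[of S]])
qed

lemma Zop_single: "Kop (Kop (Pop (single (emb v) d))) = embed (map (\<lambda>(e, v'). (e * d, v')) (stepz v))"
  by (cases v) (auto simp: op_defs embed_def single_def emb_def fun_eq_iff sgm_def eps_rules zp_simps mult.assoc)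

lemma Gop_single: "Gop (single (emb v) d) = embed (map (\<lambda>(e, v'). (e * d, v')) (stepg v))"
  by (cases v) (auto simp: op_defs embed_def single_def emb_def fun_eq_iff)

end

section \<open>Normal forms in the generalized Weyl algebra\<close>

context gwa
begin

definition bas :: "int \<times> nat \<times> nat \<Rightarrow> 'a" where
  "bas = (\<lambda>(n, b, c). (if n \<ge> 0 then x ^ nat n else y ^ nat (- n)) * z ^ b * g ^ c)"

definition total :: "('a \<times> (int \<times> nat \<times> nat)) list \<Rightarrow> 'a" where
  "total L = (\<Sum>(d, v)\<leftarrow>L. d * bas v)"

lemma g_bas: "g * bas (n, b, c) = bas (n, b, c + 1)"
proof -
  have p: "g * v ^ k = v ^ k * g" if "g * v = v * g" for v and k :: nat
    using that by (induction k) (simp_all add: mult.assoc mult_assoc_rule[OF that])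
  show ?thesis
    by (simp add: bas_def mult.assoc mult_assoc_rule[OF p[OF xg[symmetric]]]
        mult_assoc_rule[OF p[OF yg[symmetric]]] mult_assoc_rule[OF p[OF zg[symmetric]]])
qed

lemma z_bas: "z * bas (n, b, c) = sgm n * bas (n, b + 1, c)"
proof -
  have x: "z * x ^ k = sgm (int k) * x ^ k * z" for k
  proof (induction k)
    case (Suc k)
    have "z * x ^ Suc k = - (S * S * x * (z * x ^ k))" by (simp add: mult_assoc_rule[OF zx] mult.assoc)
    also have "\<dots> = - (S * S * sgm (int k)) * x ^ Suc k * z"
      by (simp add: Suc mult.assoc mult_assoc_rule[OF sgm_central[of x]])
    finally show ?case by (simp add: sgm_Suc add.commute)
  qed (simp add: sgm_0)
  have y: "z * y ^ k = sgm (- int k) * y ^ k * z" for k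
  proof (induction k)
    case (Suc k)
    have "z * y ^ Suc k = - (T * T * y * (z * y ^ k))" by (simp add: mult_assoc_rule[OF zy] mult.assoc)
    also have "\<dots> = - (T * T * sgm (- int k)) * y ^ Suc k * z"
      by (simp add: Suc mult.assoc mult_assoc_rule[OF sgm_central[of y]])
    also have "- (T * T * sgm (- int k)) = sgm (- int (Suc k))"
      unfolding sgm_pred by (rule arg_cong[where f = sgm]) simp
    finally show ?case .
  qed (simp add: sgm_0)
  show ?thesis
    using x[of "nat n"] y[of "nat (- n)"] by (auto simp: bas_def mult.assoc[symmetric])
qed

lemma x_bas: "x * bas v = total (stepx v)"
proof (cases v)
  case (fields n b c)
  show ?thesis
  proof (cases "n \<ge> 0")
    case True
    then show ?thesis by (simp add: fields total_def bas_def nat_add_distrib mult.assoc)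
  next
    case False
    then have "x * bas v = x * y * bas (n + 1, b, c)"
    proof -
      have "y ^ nat (- n) = y * y ^ nat (- (n + 1))"
        using False by (simp flip: power_Suc add: Suc_nat_eq_nat_zadd1)
      moreover have "bas (n + 1, b, c) = y ^ nat (- (n + 1)) * z ^ b * g ^ c"
        using False by (auto simp: bas_def)
      ultimately show ?thesis using False by (simp add: fields bas_def mult.assoc)
    qed
    also have "\<dots> = total (stepx v)"
      using False
      by (simp add: fields xy total_def algebra_simps z_bas g_bas mult_assoc_rule[OF sgm_central[of g]]
          mult_assoc_rule[OF sgm_central[of z]] del: of_nat_Suc)
    finally show ?thesis .
  qed
qed

lemma y_bas: "y * bas v = total (stepy v)"
proof (cases v)
  case (fields n b c)
  show ?thesis
  proof (cases "n \<le> 0")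
    case True
    have "y ^ nat (1 - n) = y * y ^ nat (- n)"
      using True by (simp flip: power_Suc add: Suc_nat_eq_nat_zadd1 add.commute)
    with True show ?thesis by (cases "n = 0") (simp_all add: fields total_def bas_def mult.assoc)
  next
    case False
    then have "y * bas v = y * x * bas (n - 1, b, c)"
    proof -
      have "x ^ nat n = x * x ^ nat (n - 1)"
        using False by (simp flip: power_Suc add: Suc_nat_eq_nat_zadd1)
      then show ?thesis using False by (simp add: fields bas_def mult.assoc)
    qed
    also have "\<dots> = total (stepy v)"
      using False
      by (simp add: fields yx total_def algebra_simps z_bas g_bas mult_assoc_rule[OF sgm_central[of g]]
          mult_assoc_rule[OF sgm_central[of z]] del: of_nat_Suc)
    finally show ?thesis .
  qed
qed

lemma z_bas': "z * bas v = total (stepz v)" and g_bas': "g * bas v = total (stepg v)"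
  by (cases v; simp add: total_def z_bas g_bas)+

lemma bas_commutes:
  assumes "commutes x l" "commutes y l" "commutes z l" "commutes g l"
  shows "commutes (bas v) l"
proof -
  have "commutes (u ^ k) l" if "commutes u l" for u and k :: nat
    using that by (induction k) (auto intro: commutes_intros)
  then show ?thesis using assms by (cases v) (auto simp: bas_def intro!: commutes_intros)
qed

end

section \<open>Independence of the representative\<close>

definition tau_img :: "nat \<Rightarrow> nat \<times> sym \<Rightarrow> 'k::field fam" where
  "tau_img p l = cl (\<lambda>s. tau_letter s p l)"

lemma nfin_tau_letter: "nfin (tau_letter s p l)"
proof (cases l)
  case (Pair i g)
  have "nfin (tau_gen s p g)" by (cases g) (auto intro!: nfin_binop)
  then show ?thesis by (simp add: Pair tau_letter_def)
qed

lemma at_tau_letter: "at_param s (tau_letter s p l) = sd s 1 * tau_img p l"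
  unfolding tau_img_def by (rule at_cl) (simp add: ffin_def nfin_tau_letter)

lemma tau_img_other: "i < p \<Longrightarrow> tau_img p (i, g) = gl (i, g)"
  by (simp add: tau_img_def tau_letter_def gl_def nlet_eq_nmon)

lemma tau_img_coaction:
  "tau_img p (p, XAp) = (gl (p, Km) * gl (p, Km) * gl (p, Pp) * gl (Suc p, XAp)
      + TT * gl (p, Ap) * gl (p, Ap) * gl (p, Pp) * (Om * gl (Suc p, XAm))
      + (1 - TT * TT) * gl (p, Ap) * gl (p, Km) * gl (p, Pp) * gl (Suc p, XKP)
      + TT * gl (p, Ap) * gl (p, Km) * gl (p, Pp) * (Om * gl (Suc p, XG)) :: 'k::field fam)"
  "Om * tau_img p (p, XAm) = (gl (p, Kp) * gl (p, Kp) * gl (p, Pp) * (Om * gl (Suc p, XAm)) :: 'k::field fam)"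
  "tau_img p (p, XKP) = (gl (Suc p, XKP) - gl (p, Ap) * gl (p, Kp) * (Om * gl (Suc p, XAm)) :: 'k::field fam)"
  "tau_img p (p, XG) = (gl (Suc p, XG) :: 'k::field fam)"
proof -
  have TO: "sc (\<lambda>s. (1/s) * (s^2 - 1/s^2)) = (TT * Om :: 'k fam)"
    unfolding TT_def Om_def sc_mult[symmetric] by (rule refl)
  have TS: "sc (\<lambda>s. (1/s) * (s - 1/s)) = (1 - TT * TT :: 'k fam)"
    unfolding TT_def sc_mult[symmetric] sc_1[symmetric] sc_diff[symmetric]
    by (rule sc_cong) (simp add: generic_def field_simps)
  have O: "sc (\<lambda>s. s^2 - 1/s^2) = (Om :: 'k fam)" by (simp add: Om_def)
  have add0: "nadd x nzero = x" for x :: "'k ncp" by (simp add: nadd_def nzero_def)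
  have "tau_img p (p, XAp) = (gl (p, Km) * (gl (p, Km) * (gl (p, Pp) * gl (Suc p, XAp)))
      + (sc (\<lambda>s. (1/s) * (s^2 - 1/s^2)) * (gl (p, Ap) * (gl (p, Ap) * (gl (p, Pp) * gl (Suc p, XAm))))
      + (sc (\<lambda>s. (1/s) * (s - 1/s)) * (gl (p, Ap) * (gl (p, Km) * (gl (p, Pp) * gl (Suc p, XKP))))
      + sc (\<lambda>s. (1/s) * (s^2 - 1/s^2)) * (gl (p, Ap) * (gl (p, Km) * (gl (p, Pp) * gl (Suc p, XG)))))) :: 'k fam)"
    unfolding tau_img_def tau_letter_def
    by (simp add: cl_arith cl_nmon ffin_binop add0 del: times_divide_eq_left mult_1_left) (simp add: mult.assoc)
  then show "tau_img p (p, XAp) = (gl (p, Km) * gl (p, Km) * gl (p, Pp) * gl (Suc p, XAp)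
      + TT * gl (p, Ap) * gl (p, Ap) * gl (p, Pp) * (Om * gl (Suc p, XAm))
      + (1 - TT * TT) * gl (p, Ap) * gl (p, Km) * gl (p, Pp) * gl (Suc p, XKP)
      + TT * gl (p, Ap) * gl (p, Km) * gl (p, Pp) * (Om * gl (Suc p, XG)) :: 'k::field fam)"
    unfolding TO TS by (simp add: mult.assoc Om_gl add.assoc)
  show "Om * tau_img p (p, XAm) = (gl (p, Kp) * gl (p, Kp) * gl (p, Pp) * (Om * gl (Suc p, XAm)) :: 'k::field fam)"
    unfolding tau_img_def tau_letter_def by (simp add: cl_nmon Om_gl mult.assoc)
  have "tau_img p (p, XKP) = (gl (Suc p, XKP) - Om * (gl (p, XAp) * gl (Suc p, XAm)) :: 'k fam)"
    unfolding tau_img_def tau_letter_def by (simp add: cl_arith cl_nmon nlet_eq_nmon O mult.assoc)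
  then show "tau_img p (p, XKP) = (gl (Suc p, XKP) - gl (p, Ap) * gl (p, Kp) * (Om * gl (Suc p, XAm)) :: 'k::field fam)"
    by (simp add: gl_X mult.assoc Om_gl)
  show "tau_img p (p, XG) = (gl (Suc p, XG) :: 'k::field fam)"
    unfolding tau_img_def tau_letter_def by (simp add: nlet_eq_nmon gl_def)
qed

lemma gwa_gl: "gwa SS TT (gl (i, XAp)) (Om * gl (i, XAm)) (gl (i, XKP)) (Om * gl (i, XG) :: 'k::field fam)"
  unfolding gl_X mult.assoc[symmetric] by (rule osp_site.site_gwa[OF site_gl])

lemma gwa_tau: "gwa SS TT (tau_img p (p, XAp)) (Om * tau_img p (p, XAm)) (tau_img p (p, XKP)) (Om * tau_img p (p, XG) :: 'k::field fam)"
  unfolding tau_img_coaction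
proof (rule osp_site.tau_gwa[OF site_gl gwa_gl])
  fix v l :: "'k fam"
  assume "v \<in> {gl (Suc p, XAp), Om * gl (Suc p, XAm), gl (Suc p, XKP), Om * gl (Suc p, XG)}"
    and "l \<in> {gl (p, Ap), Om * gl (p, Am), gl (p, Kp), gl (p, Km), gl (p, Pp)}"
  then have "commutes v l"
    by (elim insertE emptyE; simp; intro commutes_intros commutes_fam commutes_gl commutes_sym[OF commutes_intros(4)]; simp)
  then show "v * l = l * v" by (simp add: commutes_def)
qed

section \<open>The module at one position, with coefficients acted on by the other positions\<close>

abbreviation letter_ops :: "(int \<times> int \<times> int \<Rightarrow> 'k::field fam) \<Rightarrow> sym \<Rightarrow> int \<times> int \<times> int \<Rightarrow> 'k fam" where
  "letter_ops m g \<equiv> (case g of Ap \<Rightarrow> fam.Xop (fam.kop m) | Am \<Rightarrow> (\<lambda>v. Oi * fam.Yop (fam.kop m) v)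
     | Kp \<Rightarrow> fam.Kop m | Km \<Rightarrow> fam.kop m | Pp \<Rightarrow> fam.Pop m | XAp \<Rightarrow> fam.Xop m | XAm \<Rightarrow> (\<lambda>v. Oi * fam.Yop m v)
     | XKP \<Rightarrow> fam.Kop (fam.Kop (fam.Pop m)) | XG \<Rightarrow> (\<lambda>v. Oi * fam.Gop m v))"

text \<open>Coefficients in \<open>fam\<close> are required because the words to be compared also
  contain letters at positions below p; independence of the monomials is thus obtained with
  coefficients from the other tensor factors. \<open>Yop\<close> and \<open>Gop\<close> realise
  scaled elements, whence the factors \<open>Oi\<close> in \<open>letter_ops\<close>.\<close>

definition mact :: "nat \<Rightarrow> nat \<times> sym \<Rightarrow> (int \<times> int \<times> int \<Rightarrow> 'k::field fam) \<Rightarrow> int \<times> int \<times> int \<Rightarrow> 'k fam" where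
  "mact p l m = (if fst l = p then letter_ops m (snd l) else (\<lambda>v. gl l * m v))"

lemma mact_lmult: "mact p (p, g) (\<lambda>v. y * m v) = (\<lambda>v. y * mact p (p, g) m v)" for y :: "'k::field fam"
  by (cases g) (simp_all add: mact_def fam.op_lmult mult.assoc[symmetric] fam_central(4)[of y])

lemma mact_rep: "free_rep (\<lambda>c m v. sd s c * m v) (mact p :: _ \<Rightarrow> _ \<Rightarrow> _ \<Rightarrow> 'k::field fam)"
proof
  fix l :: "nat \<times> sym" and m m' :: "int \<times> int \<times> int \<Rightarrow> 'k fam" and a :: 'k
  show "mact p l (m + m') = mact p l m + mact p l m'"
    by (cases "snd l") (simp_all add: mact_def plus_fun_def fam.op_add distrib_left)
  show "mact p l (\<lambda>v. sd s a * m v) = (\<lambda>v. sd s a * mact p l m v)"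
  proof (cases "fst l = p")
    case True
    then show ?thesis using mact_lmult[of p "snd l" "sd s a" m] by (cases l) simp
  next
    case False
    then show ?thesis
      by (simp add: mact_def mult.assoc[symmetric] sd_central)
  qed
qed (simp_all add: sd_add sd_mult algebra_simps fun_eq_iff)

lemma mact_commute:
  assumes "i \<noteq> j"
  shows "mact p (i, g) (mact p (j, h) m) = (mact p (j, h) (mact p (i, g) m) :: _ \<Rightarrow> 'k::field fam)"
proof -
  consider "i = p" | "j = p" | "i \<noteq> p" "j \<noteq> p" by blast
  then show ?thesis
  proof cases
    case 1
    then have "mact p (j, h) = (\<lambda>m v. gl (j, h) * m v :: 'k fam)" using assms by (simp add: mact_def fun_eq_iff)
    then show ?thesis using 1 by (simp add: mact_lmult)
  next
    case 2
    then have "mact p (i, g) = (\<lambda>m v. gl (i, g) * m v :: 'k fam)" using assms by (simp add: mact_def fun_eq_iff)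
    then show ?thesis using 2 by (simp add: mact_lmult)
  next
    case 3
    then show ?thesis by (simp add: mact_def mult.assoc[symmetric] gl_comm[OF assms])
  qed
qed

abbreviation act_on :: "'k::field \<Rightarrow> nat \<Rightarrow> 'k ncp \<Rightarrow> (int \<times> int \<times> int \<Rightarrow> 'k fam) \<Rightarrow> int \<times> int \<times> int \<Rightarrow> 'k fam" where
  "act_on s p \<equiv> free_rep.act (\<lambda>c m v. sd s c * m v) (mact p)"

lemma osp_rels_pos: "r \<in> osp_rels s i \<Longrightarrow> r w \<noteq> 0 \<Longrightarrow> l \<in> set w \<Longrightarrow> fst l = i"
  by (erule osp_relsE)
    (auto simp: nsub_def nadd_def nmon_def nlet_def gamma_expr_def nzero_def split: if_splits)

text \<open>Such a relation acts by left multiplication with its own class, which is zero.\<close>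

lemma act_on_rels_other:
  assumes "r \<in> osp_rels s i" "i \<noteq> p"
  shows "act_on s p r m = (0 :: _ \<Rightarrow> 'k::field fam)"
proof -
  have "(\<And>l. l \<in> set w \<Longrightarrow> fst l \<noteq> p) \<Longrightarrow> foldr (mact p) w m = (\<lambda>v. prod_list (map gl w) * m v)" for w
    by (induction w) (auto simp: mact_def mult.assoc)
  then have "act_on s p r m = (\<lambda>v. ev s gl r * m v)"
    unfolding free_rep.act_def[OF mact_rep] ev_eq_sum
    using assms osp_rels_pos[OF assms(1)]
    by (auto simp: fun_eq_iff sum_fun_apply sum_distrib_right mult.assoc intro!: sum.cong)
  then show ?thesis
    by (simp add: ev_osp_rels[OF osp_letters_gl assms(1)] fun_eq_iff)
qed

lemma act_on_rels_self:
  assumes "r \<in> osp_rels s p"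
  shows "act_on s p r m v = (0 :: 'k::field fam)"
proof -
  note act = free_rep.act_nsub[OF mact_rep] free_rep.act_nadd[OF mact_rep] free_rep.act_nmon[OF mact_rep]
    nfin_binop nlet_eq_nmon mact_def plus_fun_def fun_diff_def
  note oi = fam.op_lmult[where y = "Oi :: 'k fam"]
  show ?thesis using assms
  proof (cases rule: osp_relsE)
    case 1
    show ?thesis by (simp add: 1 act fam.op_KX fam.op_Kk sd_consts mult.assoc)
  next
    case 2
    show ?thesis by (simp add: 2 act oi fam.op_KY fam.op_Kk sd_consts mult.assoc mult_assoc_rule[OF fam_central(4)[of TT, symmetric]])
  next
    case 3
    have "act_on s p r m v = sd s 1 * (Oi * (fam.Xop (fam.kop (fam.Yop (fam.kop m))) v + fam.Yop (fam.kop (fam.Xop (fam.kop m))) v))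
        - (sd s (1/(s - 1/s)) * fam.Kop (fam.Kop m) v + sd s (- (1/(s - 1/s))) * fam.kop (fam.kop m) v)"
      by (simp add: 3 act oi distrib_left)
    also have "\<dots> = 0"
      unfolding fam.op_CaaC sd_consts by (simp add: mult.assoc right_diff_distrib)
    finally show ?thesis .
  next
    case 14
    have add0: "nadd x nzero = x" for x :: "'k ncp" by (simp add: nadd_def nzero_def)
    have "act_on s p r m v = sd s 1 * (Oi * fam.Gop m v)
        - (sd s (-1) * (Oi * fam.Xop (fam.kop (fam.Yop (fam.kop (fam.Pop m)))) v)
           + (sd s ((1/s) / (s^2 - 1/s^2)) * fam.Kop (fam.Kop (fam.Pop m)) v
           + sd s (- (s / (s^2 - 1/s^2))) * fam.kop (fam.kop (fam.Pop m)) v))"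
      by (simp add: 14 act oi gamma_expr_def add0)
    also have "\<dots> = 0"
      unfolding fam.op_G sd_consts by (simp add: mult.assoc distrib_left right_diff_distrib)
    finally show ?thesis .
  qed (simp_all add: act oi fam.op_PX fam.op_PY fam.op_PK fam.op_Kk fam.op_PP)
qed

lemma act_on_ideal: "x \<in> osp_ideal s k \<Longrightarrow> act_on s p x m = (0 :: _ \<Rightarrow> 'k::field fam)"
proof (induction arbitrary: m rule: osp_ideal.induct)
  case (gen i r)
  show ?case
  proof (cases "i = p")
    case True
    then show ?thesis using gen(2) by (intro ext) (simp add: act_on_rels_self)
  next
    case False
    show ?thesis by (rule act_on_rels_other[OF gen(2) False])
  qed
next
  case (comm i j g h)
  then show ?case
    by (simp add: free_rep.act_nsub[OF mact_rep] free_rep.act_nmon[OF mact_rep] mact_commute)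
next
  case zero
  show ?case by (rule free_rep.act_nzero[OF mact_rep])
next
  case (add x y)
  then show ?case
    by (simp add: free_rep.act_nadd[OF mact_rep] ncp_in_nfin[OF osp_ideal_ncp_in])
next
  case (mul x a b)
  then have "nfin x" "nfin a" "nfin b"
    using osp_ideal_ncp_in ncp_in_nfin by blast+
  then show ?case using mul.IH
    by (simp add: free_rep.act_nmul[OF mact_rep] nfin_binop free_rep.act_0[OF mact_rep, unfolded zero_fun_def])
qed

section \<open>Symbolic reduction of words, followed in the module and under tau_R\<close>

context central_unit
begin

text \<open>Centrality reconciles \<open>total\<close>, which writes the coefficients on the left,
  with \<open>tau_total\<close>, which writes them on the right.\<close>

lemma step_central:
  "(e, v') \<in> set (stepx v) \<Longrightarrow> u * e = e * u" "(e, v') \<in> set (stepy v) \<Longrightarrow> u * e = e * u"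
  "(e, v') \<in> set (stepz v) \<Longrightarrow> u * e = e * u" "(e, v') \<in> set (stepg v) \<Longrightarrow> u * e = e * u"
  by (cases v; auto split: if_splits simp: mult.assoc S_central[of u] T_central[of u] sgm_central[of u]
      mult_assoc_rule[OF S_central[of u]] mult_assoc_rule[OF T_central[of u]] mult_assoc_rule[OF sgm_central[of u]])+

end

type_synonym 'k fam_comb = "('k fam \<times> (int \<times> nat \<times> nat)) list"

definition nf_step :: "sym \<Rightarrow> int \<times> nat \<times> nat \<Rightarrow> 'k::field fam_comb" where
  "nf_step g v = (case g of XAp \<Rightarrow> fam.stepx v | XAm \<Rightarrow> map (\<lambda>(e, v'). (Oi * e, v')) (fam.stepy v)
     | XKP \<Rightarrow> fam.stepz v | XG \<Rightarrow> map (\<lambda>(e, v'). (Oi * e, v')) (fam.stepg v) | _ \<Rightarrow> [])"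

text \<open>One reduction step on lists of terms, with two readings: \<open>nf_letter_embed\<close>
  follows it in the module, \<open>nf_letter_total\<close> among the images under tau_R. Repeated
  exponents stay in the list and are collected only by \<open>lcoeff\<close>.\<close>

definition nf_letter :: "nat \<Rightarrow> nat \<times> sym \<Rightarrow> 'k::field fam_comb \<Rightarrow> 'k fam_comb" where
  "nf_letter p l L = (if fst l = p then concat (map (\<lambda>(d, v). map (\<lambda>(e, v'). (e * d, v')) (nf_step (snd l) v)) L)
     else map (\<lambda>(d, v). (gl l * d, v)) L)"

lemma embed_simps:
  "fam.embed [] = (\<lambda>u. 0 :: 'k::field fam)"
  "fam.embed ((d, v) # L) = (\<lambda>u. fam.single (fam.emb v) d u + fam.embed L u :: 'k fam)"
  "fam.embed (L @ L') = (\<lambda>u. fam.embed L u + fam.embed L' u :: 'k fam)"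
  by (simp_all add: fam.embed_def)

lemma embed_lmult: "fam.embed (map (\<lambda>(d, v). (y * d, v)) L) = (\<lambda>u. y * fam.embed L u :: 'k::field fam)"
  by (induction L) (auto simp: embed_simps fam.single_def distrib_left fun_eq_iff)

lemma nf_step_single:
  assumes "g \<in> {XAp, XAm, XKP, XG}"
  shows "mact p (p, g) (fam.single (fam.emb v) d) = (fam.embed (map (\<lambda>(e, v'). (e * d, v')) (nf_step g v)) :: _ \<Rightarrow> 'k::field fam)"
proof -
  have *: "map (\<lambda>(e, v'). (e * d, v')) (map (\<lambda>(e, v'). (Oi * e, v')) L)
      = map (\<lambda>(e, v'). (Oi * e, v')) (map (\<lambda>(e, v'). (e * d, v')) L)" for L :: "'k fam_comb"
    by (induction L) (auto simp: mult.assoc)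
  show ?thesis using assms
    by (elim insertE emptyE)
      (simp_all only: mact_def nf_step_def fst_conv snd_conv sym.case if_True refl *
        fam.Xop_single fam.Yop_single fam.Zop_single fam.Gop_single embed_lmult)
qed

lemma nf_letter_embed:
  assumes "fst l = p \<Longrightarrow> snd l \<in> {XAp, XAm, XKP, XG}"
  shows "mact p l (fam.embed L) = (fam.embed (nf_letter p l L) :: _ \<Rightarrow> 'k::field fam)"
proof (cases "fst l = p")
  case True
  then obtain g where l: "l = (p, g)" by (cases l) simp
  have g: "g \<in> {XAp, XAm, XKP, XG}" using assms l by simp
  show ?thesis unfolding l
  proof (induction L)
    case Nil
    show ?case using mact_lmult[of p g 0 "\<lambda>_. 0 :: 'k fam"]
      by (simp add: embed_simps nf_letter_def)
  next
    case (Cons a L)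
    obtain d v where a: "a = (d, v)" by (cases a)
    have "mact p (p, g) (fam.embed (a # L)) = mact p (p, g) (fam.single (fam.emb v) d + fam.embed L)"
      by (simp add: a embed_simps plus_fun_def)
    also have "\<dots> = mact p (p, g) (fam.single (fam.emb v) d) + mact p (p, g) (fam.embed L)"
      by (rule free_rep.rho_add[OF mact_rep])
    also have "\<dots> = (fam.embed (nf_letter p (p, g) (a # L)) :: _ \<Rightarrow> 'k fam)"
      by (simp add: Cons nf_step_single[OF g]) (simp add: nf_letter_def a embed_simps plus_fun_def)
    finally show ?case .
  qed
next
  case False
  then show ?thesis by (simp add: mact_def nf_letter_def embed_lmult)
qed

definition tau_bas :: "nat \<Rightarrow> int \<times> nat \<times> nat \<Rightarrow> 'k::field fam" where
  "tau_bas p = gwa.bas (tau_img p (p, XAp)) (Om * tau_img p (p, XAm)) (tau_img p (p, XKP)) (Om * tau_img p (p, XG))"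

text \<open>The coefficient stands on the right, so that the image of a letter at p meets the
  monomial directly. Letters below p commute with the monomial (\<open>commutes_tau_bas\<close>) and
  join the coefficient from its left, just as in the module.\<close>

definition tau_total :: "nat \<Rightarrow> 'k::field fam_comb \<Rightarrow> 'k fam" where
  "tau_total p L = (\<Sum>(d, v)\<leftarrow>L. tau_bas p v * d)"

lemma tau_total_simps:
  "tau_total p [] = 0" "tau_total p ((d, v) # L) = tau_bas p v * d + tau_total p L"
  "tau_total p (L @ L') = tau_total p L + tau_total p L'"
  by (simp_all add: tau_total_def)

lemma nf_step_tau:
  assumes "g \<in> {XAp, XAm, XKP, XG}"
  shows "tau_img p (p, g) * tau_bas p v = tau_total p (nf_step g v :: 'k::field fam_comb)"
proof -
  interpret t: gwa SS TT "tau_img p (p, XAp) :: 'k fam" "Om * tau_img p (p, XAm)" "tau_img p (p, XKP)" "Om * tau_img p (p, XG)"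
    by (rule gwa_tau)
  have *: "t.total L = tau_total p L" if "\<And>e v' u. (e, v') \<in> set L \<Longrightarrow> u * e = e * u" for L
    using that
  proof (induction L)
    case (Cons a L)
    obtain d v where a: "a = (d, v)" by (cases a)
    have "t.total L = tau_total p L" by (rule Cons.IH) (rule Cons.prems, erule list.set_intros(2))
    moreover have "t.bas v * d = d * t.bas v" by (rule Cons.prems[of d v]) (simp add: a)
    ultimately show ?case by (simp add: a t.total_def tau_total_simps tau_bas_def)
  qed (simp add: t.total_def tau_total_simps)
  have Oi: "tau_total p (map (\<lambda>(e, v'). (Oi * e, v')) L) = Oi * tau_total p L" for L :: "'k fam_comb"
    by (induction L) (auto simp: tau_total_simps distrib_left mult.assoc[symmetric] fam_central(4)[of "tau_bas p _"])
  have "tau_img p (p, XAp) * tau_bas p v = tau_total p (fam.stepx v :: 'k fam_comb)"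
    unfolding tau_bas_def t.x_bas by (rule *) (rule fam.step_central)
  moreover have "Om * tau_img p (p, XAm) * tau_bas p v = tau_total p (fam.stepy v :: 'k fam_comb)"
    unfolding tau_bas_def t.y_bas by (rule *) (rule fam.step_central)
  then have "Oi * (Om * (tau_img p (p, XAm) * tau_bas p v)) = Oi * tau_total p (fam.stepy v :: 'k fam_comb)"
    by (simp add: mult.assoc)
  moreover have "tau_img p (p, XKP) * tau_bas p v = tau_total p (fam.stepz v :: 'k fam_comb)"
    unfolding tau_bas_def t.z_bas' by (rule *) (rule fam.step_central)
  moreover have "Om * tau_img p (p, XG) * tau_bas p v = tau_total p (fam.stepg v :: 'k fam_comb)"
    unfolding tau_bas_def t.g_bas' by (rule *) (rule fam.step_central)
  then have "Oi * (Om * (tau_img p (p, XG) * tau_bas p v)) = Oi * tau_total p (fam.stepg v :: 'k fam_comb)"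
    by (simp add: mult.assoc)
  ultimately show ?thesis using assms
    by (auto simp: nf_step_def Oi mult_assoc_rule[OF Om_Oi(2)])
qed

lemma commutes_tau_bas: assumes "i < p" shows "commutes (tau_bas p v) (gl (i, g) :: 'k::field fam)"
proof -
  interpret t: gwa SS TT "tau_img p (p, XAp) :: 'k fam" "Om * tau_img p (p, XAm)" "tau_img p (p, XKP)" "Om * tau_img p (p, XG)"
    by (rule gwa_tau)
  show ?thesis unfolding tau_bas_def
    by (rule t.bas_commutes; unfold tau_img_coaction; intro commutes_intros commutes_fam commutes_gl)
      (use assms in simp_all)
qed

lemma nf_letter_total:
  assumes "fst l \<le> p" "fst l = p \<Longrightarrow> snd l \<in> {XAp, XAm, XKP, XG}"
  shows "tau_img p l * tau_total p L = tau_total p (nf_letter p l L :: 'k::field fam_comb)"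
proof (cases "fst l = p")
  case True
  then obtain g where l: "l = (p, g)" by (cases l) simp
  have g: "g \<in> {XAp, XAm, XKP, XG}" using assms l by simp
  have *: "tau_total p (map (\<lambda>(e, v'). (e * d, v')) M) = tau_total p M * d" for d and M :: "'k fam_comb"
    by (induction M) (auto simp: tau_total_simps algebra_simps)
  show ?thesis unfolding l
  proof (induction L)
    case (Cons a L)
    obtain d v where a: "a = (d, v)" by (cases a)
    have "tau_img p (p, g) * tau_total p (a # L) = tau_img p (p, g) * tau_bas p v * d + tau_img p (p, g) * tau_total p L"
      by (simp add: a tau_total_simps distrib_left mult.assoc)
    also have "\<dots> = tau_total p (nf_letter p (p, g) (a # L))"
      by (simp add: Cons nf_step_tau[OF g]) (simp add: nf_letter_def a tau_total_simps *)
    finally show ?case .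
  qed (simp add: tau_total_simps nf_letter_def)
next
  case False
  with assms have l: "fst l < p" by simp
  then have t: "tau_img p l = (gl l :: 'k fam)" using tau_img_other[of "fst l" p "snd l"] by simp
  have c: "gl l * (tau_bas p v * d) = tau_bas p v * (gl l * d)" for v and d :: "'k fam"
    using commutes_tau_bas[OF l, of v "snd l", where 'k = 'k] by (simp add: commutes_def mult.assoc[symmetric])
  show ?thesis using False
    by (induction L) (auto simp: t nf_letter_def tau_total_simps distrib_left c)
qed

definition lcoeff :: "'k::field fam_comb \<Rightarrow> int \<times> nat \<times> nat \<Rightarrow> 'k fam" where
  "lcoeff L v = (\<Sum>(d, v')\<leftarrow>L. if v = v' then d else 0)"

lemma lcoeff_embed: "fam.embed L (fam.emb v) = lcoeff L v"
  by (induction L) (auto simp: lcoeff_def embed_simps fam.single_def fam.emb_inj)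

lemma tau_total_lcoeff:
  assumes "finite V" "snd ` set L \<subseteq> V"
  shows "tau_total p L = (\<Sum>v\<in>V. tau_bas p v * lcoeff L v)"
  using assms(2)
proof (induction L)
  case Nil
  then show ?case by (simp add: tau_total_simps lcoeff_def)
next
  case (Cons a L)
  obtain d v where a: "a = (d, v)" by (cases a)
  have "lcoeff (a # L) u = (if u = v then d else 0) + lcoeff L u" for u
    by (simp add: a lcoeff_def)
  then have "(\<Sum>u\<in>V. tau_bas p u * lcoeff (a # L) u)
      = (\<Sum>u\<in>V. if u = v then tau_bas p u * d else 0) + (\<Sum>u\<in>V. tau_bas p u * lcoeff L u)"
    by (simp add: distrib_left sum.distrib if_distrib[of "\<lambda>x. tau_bas p _ * x"] cong: if_cong)
  also have "(\<Sum>u\<in>V. if u = v then tau_bas p u * d else 0) = tau_bas p v * d"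
    using Cons.prems a assms(1) by simp
  finally show ?case using Cons a by (simp add: tau_total_simps)
qed

text \<open>Acting with e on the vector e(0, 0, 0) gives zero, and the coefficients of the result
  are those of the normal form of e. The image of e under tau_R is the combination of the
  \<open>tau_bas\<close> monomials with the same coefficients, so it vanishes as well. Hence two
  representatives whose difference is in the ideal have the same image.\<close>

theorem ev_tau_ideal:
  assumes "e \<in> osp_ideal s (Suc p)" "only_X_at p e"
  shows "ev s (tau_img p) e = (0 :: 'k::field fam)"
proof -
  let ?E = "{w. e w \<noteq> 0}"
  have e: "ncp_in (Suc p) e" using assms(1) by (rule osp_ideal_ncp_in)
  then have fin: "finite ?E" by (simp add: ncp_in_def)
  define nf where "nf w = foldr (nf_letter p) w [(1 :: 'k fam, (0 :: int, 0 :: nat, 0 :: nat))]" for w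
  have letters: "fst l \<le> p \<and> (fst l = p \<longrightarrow> snd l \<in> {XAp, XAm, XKP, XG})" if "e w \<noteq> 0" "l \<in> set w" for w l
    using e assms(2) that unfolding ncp_in_def only_X_at_def by (cases l) (auto simp: less_Suc_eq_le)
  define d0 where "d0 = fam.embed [(1 :: 'k fam, (0 :: int, 0 :: nat, 0 :: nat))]"
  have emb: "(\<And>l. l \<in> set w \<Longrightarrow> fst l \<le> p \<and> (fst l = p \<longrightarrow> snd l \<in> {XAp, XAm, XKP, XG})) \<Longrightarrow>
      foldr (mact p) w d0 = fam.embed (nf w)" for w
    by (induction w) (simp_all add: nf_def d0_def nf_letter_embed)
  have tot: "(\<And>l. l \<in> set w \<Longrightarrow> fst l \<le> p \<and> (fst l = p \<longrightarrow> snd l \<in> {XAp, XAm, XKP, XG})) \<Longrightarrow>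
      prod_list (map (tau_img p) w) = tau_total p (nf w)" for w
  proof (induction w)
    case Nil
    interpret t: gwa SS TT "tau_img p (p, XAp) :: 'k fam" "Om * tau_img p (p, XAm)" "tau_img p (p, XKP)" "Om * tau_img p (p, XG)"
      by (rule gwa_tau)
    show ?case by (simp add: nf_def tau_total_simps tau_bas_def t.bas_def)
  next
    case (Cons l w)
    then show ?case by (simp add: nf_def nf_letter_total)
  qed
  have "act_on s p e d0 (fam.emb v) = (\<Sum>w\<in>?E. sd s (e w) * lcoeff (nf w) v)" for v
    unfolding free_rep.act_def[OF mact_rep] sum_fun_apply
    by (intro sum.cong refl) (subst emb, use letters in \<open>auto simp: lcoeff_embed\<close>)
  \<comment> \<open>Different exponents occupy different basis vectors (\<open>emb_inj\<close>, used
    in \<open>lcoeff_embed\<close>), so a vanishing vector yields one equation for each normal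
    monomial.\<close>
  then have zero: "(\<Sum>w\<in>?E. sd s (e w) * lcoeff (nf w) v) = 0" for v
    using act_on_ideal[OF assms(1), of p d0] by simp
  define V where "V = (\<Union>w\<in>?E. snd ` set (nf w))"
  have V: "finite V" using fin by (simp add: V_def)
  have "ev s (tau_img p) e = (\<Sum>w\<in>?E. sd s (e w) * (\<Sum>v\<in>V. tau_bas p v * lcoeff (nf w) v))"
    unfolding ev_eq_sum
  proof (intro sum.cong refl)
    fix w assume w: "w \<in> ?E"
    then have "prod_list (map (tau_img p) w) = tau_total p (nf w)"
      using letters by (intro tot) auto
    also have "\<dots> = (\<Sum>v\<in>V. tau_bas p v * lcoeff (nf w) v)"
      using w by (intro tau_total_lcoeff V) (auto simp: V_def)
    finally show "sd s (e w) * prod_list (map (tau_img p) w) = sd s (e w) * (\<Sum>v\<in>V. tau_bas p v * lcoeff (nf w) v)"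
      by simp
  qed
  also have "\<dots> = (\<Sum>v\<in>V. \<Sum>w\<in>?E. tau_bas p v * (sd s (e w) * lcoeff (nf w) v))"
    by (subst sum.swap) (simp add: sum_distrib_left mult.assoc[symmetric] sd_central)
  also have "\<dots> = 0"
    by (simp add: sum_distrib_left[symmetric] zero)
  finally show ?thesis .
qed

section \<open>Removing superfluous tensor positions\<close>

text \<open>
  osp_ideal s k only has relations at positions below k.  Applying the counit at
  the other positions shows that elements of the union of these ideals that live below k lie in
  osp_ideal s k.
\<close>
fun counit :: "'k::field \<Rightarrow> sym \<Rightarrow> 'k" where
  "counit s Kp = 1" | "counit s Km = 1" | "counit s Pp = 1" | "counit s XKP = 1"
| "counit s XG = (1/s) / (s^2 - 1/s^2) - s / (s^2 - 1/s^2)" | "counit s _ = 0"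

definition cut :: "'k::field \<Rightarrow> nat \<Rightarrow> nat \<times> sym \<Rightarrow> 'k ncp" where
  "cut s k l = (if fst l < k then nmon 1 [l] else nconst (counit s (snd l)))"

lemma nsubst_id:
  assumes "nfin f" "\<And>w l. f w \<noteq> 0 \<Longrightarrow> l \<in> set w \<Longrightarrow> \<phi> l = nmon 1 [l]"
  shows "nsubst \<phi> f = f"
proof
  fix v
  have p: "(\<And>l. l \<in> set w \<Longrightarrow> \<phi> l = nmon 1 [l]) \<Longrightarrow> nprod (map \<phi> w) = nmon 1 w" for w
    by (induction w) (auto simp: nmul_nmon none_def nmon_Nil)
  have "nsubst \<phi> f v = (\<Sum>w | f w \<noteq> 0. if w = v then f v else 0)"
    unfolding nsubst_def by (intro sum.cong refl) (subst p, use assms(2) in \<open>auto simp: nmon_def\<close>)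
  also have "\<dots> = f v" using assms(1) by (simp add: nfin_def)
  finally show "nsubst \<phi> f v = f v" .
qed

lemma nmul_nconst_nconst: "nmul (nconst c) (nconst d) = nconst (c * d)"
  by (simp add: nmul_nconst_left) (auto simp: nconst_def)

lemma cut_osp_rels:
  assumes "r \<in> osp_rels s i" "\<not> i < k"
  shows "nsubst (cut s k) r = nzero"
proof -
  have eqs: "nadd (nconst a) (nconst b) = nconst (a + b)" "nsub (nconst a) (nconst b) = nconst (a - b)"
     "nadd (nconst a) nzero = nconst a" "none = nconst 1" for a b :: 'a
    by (auto simp: nadd_def nsub_def nconst_def nzero_def none_def)
  have z: "nconst c = nzero \<longleftrightarrow> c = 0" for c :: 'a
    by (auto simp: nconst_def nzero_def fun_eq_iff)
  show ?thesis
    using assms(1) by (cases rule: osp_relsE)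
      (simp_all add: nsubst_nsub nsubst_nadd nsubst_nmon nsubst_nzero nfin_binop nlet_eq_nmon cut_def assms(2)
        gamma_expr_def eqs nmul_nconst_nconst z del: nmul_none)
qed

text \<open>Letters at position k or beyond become scalars, so commutation with them is trivial, and
  the relations at those positions go to zero because the counit respects them. Relations below k
  are left as they are.\<close>

lemma cut_ideal: "x \<in> osp_ideal s k' \<Longrightarrow> nsubst (cut s k) x \<in> osp_ideal s k"
proof (induction rule: osp_ideal.induct)
  case (gen i r)
  show ?case
  proof (cases "i < k")
    case True
    have "nsubst (cut s k) r = r"
      using osp_rels_ncp_in[OF gen(2) lessI] osp_rels_pos[OF gen(2)] True
      by (intro nsubst_id ncp_in_nfin) (auto simp: cut_def)
    then show ?thesis using osp_ideal.gen[OF True gen(2)] by simp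
  next
    case False
    then show ?thesis using cut_osp_rels[OF gen(2)] osp_ideal.zero by simp
  qed
next
  case (comm i j g h)
  have "nsubst (cut s k) (nsub (nmon 1 [(i, g), (j, h)]) (nmon 1 [(j, h), (i, g)]))
      = nsub (nmul (cut s k (i, g)) (cut s k (j, h))) (nmul (cut s k (j, h)) (cut s k (i, g)))"
    by (simp add: nsubst_nsub nsubst_nmon flip: none_def)
  also have "\<dots> \<in> osp_ideal s k"
  proof (cases "i < k \<and> j < k")
    case True
    then show ?thesis using comm by (simp add: cut_def nmul_nmon osp_ideal.comm)
  next
    case False
    then have "nmul (cut s k (i, g)) (cut s k (j, h)) = nmul (cut s k (j, h)) (cut s k (i, g))"
      by (auto simp: cut_def nmul_nconst_left nmul_nconst_right)
    then show ?thesis by (simp add: nsub_self osp_ideal.zero)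
  qed
  finally show ?case .
next
  case zero
  then show ?case by (simp add: nsubst_nzero osp_ideal.zero)
next
  case (add x y)
  then show ?case
    by (simp add: nsubst_nadd ncp_in_nfin[OF osp_ideal_ncp_in] osp_ideal.add)
next
  case (mul x a b)
  have fin: "nfin x" "nfin a" "nfin b"
    using mul osp_ideal_ncp_in ncp_in_nfin by blast+
  have "ncp_in k (cut s k l)" for l
    by (cases l) (auto simp: cut_def intro!: ncp_in_nmon)
  then have "ncp_in k (nsubst (cut s k) a)" "ncp_in k (nsubst (cut s k) b)"
    using fin by (auto intro!: ncp_in_nsubst)
  then show ?case
    using osp_ideal.mul[OF mul.IH] fin by (simp add: nsubst_nmul nfin_binop)
qed

lemma nideal_cut:
  assumes "x \<in> nideal s" "ncp_in k x"
  shows "x \<in> osp_ideal s k"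
proof -
  obtain k' where "x \<in> osp_ideal s k'" using assms(1) unfolding nideal_def by blast
  then have "nsubst (cut s k) x \<in> osp_ideal s k" by (rule cut_ideal)
  moreover have "nsubst (cut s k) x = x"
    using assms(2) by (intro nsubst_id ncp_in_nfin[OF assms(2)]) (fastforce simp: ncp_in_def cut_def)
  ultimately show ?thesis by simp
qed

section \<open>Expansion of Casimir elements from the left\<close>

text \<open>A concrete polynomial for the Delta-matrix, besides the version \<open>Dstep\<close> in
  the product ring: the choice in \<open>tau_op\<close> ranges over polynomials, so an explicit
  witness with only generators of I_R at the last position is wanted. The members \<open>XAm\<close>
  and \<open>XG\<close> of the quadruple are the scaled elements, which explains the factors s^2 -
  1/s^2.\<close>

definition dstep :: "'k::field \<Rightarrow> nat \<Rightarrow> (sym \<Rightarrow> 'k ncp) \<Rightarrow> sym \<Rightarrow> 'k ncp" where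
  "dstep s p V X = (case X of
     XAp \<Rightarrow> nadd (nmul (nmon 1 [(p,Ap),(p,Kp)]) (V XKP)) (V XAp)
   | XAm \<Rightarrow> nadd (nmul (nmon (s^2 - 1/s^2) [(p,Am),(p,Kp)]) (V XKP)) (V XAm)
   | XKP \<Rightarrow> nmul (nmon 1 [(p,Kp),(p,Kp),(p,Pp)]) (V XKP)
   | XG \<Rightarrow> nadd (nmul (nadd (nmon (s^2 - 1/s^2) [(p,XG)]) (nmon (s - 1/s) [(p,Km),(p,Km),(p,Pp)])) (V XKP))
       (nadd (nmul (nmon (1/s) [(p,Ap),(p,Km),(p,Pp)]) (V XAm))
       (nadd (nmul (nmon (-(s^2 - 1/s^2)) [(p,Km),(p,Am),(p,Pp)]) (V XAp))
         (nmul (nmon 1 [(p,Km),(p,Km),(p,Pp)]) (V XG))))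
   | _ \<Rightarrow> nzero)"

definition tstep :: "'k::field \<Rightarrow> nat \<Rightarrow> (sym \<Rightarrow> 'k ncp) \<Rightarrow> sym \<Rightarrow> 'k ncp" where
  "tstep s p V X = (case X of
     XAp \<Rightarrow> nadd (nmul (nmon 1 [(p,Km),(p,Km),(p,Pp)]) (V XAp))
       (nadd (nmul (nmon (1/s) [(p,Ap),(p,Ap),(p,Pp)]) (V XAm))
       (nadd (nmul (nmon (1 - (1/s) * (1/s)) [(p,Ap),(p,Km),(p,Pp)]) (V XKP))
         (nmul (nmon (1/s) [(p,Ap),(p,Km),(p,Pp)]) (V XG))))
   | XAm \<Rightarrow> nmul (nmon 1 [(p,Kp),(p,Kp),(p,Pp)]) (V XAm)
   | XKP \<Rightarrow> nsub (V XKP) (nmul (nmon 1 [(p,Ap),(p,Kp)]) (V XAm))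
   | XG \<Rightarrow> V XG
   | _ \<Rightarrow> nzero)"

text \<open>
  The list entries say whether Delta (True) or tau_R (False) acts at the successive positions.
\<close>
fun rstring :: "'k::field \<Rightarrow> bool list \<Rightarrow> nat \<Rightarrow> sym \<Rightarrow> 'k ncp" where
  "rstring s [] p X = nmon (if X \<in> {XAm, XG} then s^2 - 1/s^2 else if X \<in> {XAp, XKP} then 1 else 0) [(p, X)]"
| "rstring s (b # r) p X = (if b then dstep else tstep) s p (rstring s r (Suc p)) X"

definition Dstep :: "(sym \<Rightarrow> 'k::field fam) \<Rightarrow> (sym \<Rightarrow> 'k fam) \<Rightarrow> sym \<Rightarrow> 'k fam" where
  "Dstep \<phi> V X = (case X of
     XAp \<Rightarrow> \<phi> Ap * \<phi> Kp * V XKP + V XAp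
   | XAm \<Rightarrow> Om * \<phi> Am * \<phi> Kp * V XKP + V XAm
   | XKP \<Rightarrow> \<phi> Kp * \<phi> Kp * \<phi> Pp * V XKP
   | XG \<Rightarrow> (Om * \<phi> XG + (SS - TT) * \<phi> Km * \<phi> Km * \<phi> Pp) * V XKP + TT * \<phi> Ap * \<phi> Km * \<phi> Pp * V XAm
       - \<phi> Km * (Om * \<phi> Am) * \<phi> Pp * V XAp + \<phi> Km * \<phi> Km * \<phi> Pp * V XG
   | _ \<Rightarrow> 0)"

definition Tstep :: "(sym \<Rightarrow> 'k::field fam) \<Rightarrow> (sym \<Rightarrow> 'k fam) \<Rightarrow> sym \<Rightarrow> 'k fam" where
  "Tstep \<phi> V X = (case X of
     XAp \<Rightarrow> \<phi> Km * \<phi> Km * \<phi> Pp * V XAp + TT * \<phi> Ap * \<phi> Ap * \<phi> Pp * V XAm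
       + (1 - TT * TT) * \<phi> Ap * \<phi> Km * \<phi> Pp * V XKP + TT * \<phi> Ap * \<phi> Km * \<phi> Pp * V XG
   | XAm \<Rightarrow> \<phi> Kp * \<phi> Kp * \<phi> Pp * V XAm
   | XKP \<Rightarrow> V XKP - \<phi> Ap * \<phi> Kp * V XAm
   | XG \<Rightarrow> V XG
   | _ \<Rightarrow> 0)"

fun fstring :: "(nat \<times> sym \<Rightarrow> 'k::field fam) \<Rightarrow> bool list \<Rightarrow> nat \<Rightarrow> sym \<Rightarrow> 'k fam" where
  "fstring \<phi> [] p X = (if X \<in> {XAm, XG} then Om * \<phi> (p, X) else if X \<in> {XAp, XKP} then \<phi> (p, X) else 0)"
| "fstring \<phi> (b # r) p X = (if b then Dstep else Tstep) (\<lambda>g. \<phi> (p, g)) (fstring \<phi> r (Suc p)) X"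

lemma rstring_ncp_in: "ncp_in (Suc (p + length r)) (rstring s r p X)"
proof (induction r arbitrary: p X)
  case Nil
  show ?case by (auto intro!: ncp_in_nmon)
next
  case (Cons b r)
  have V: "ncp_in (Suc (Suc (p + length r))) (rstring s r (Suc p) X)" for X using Cons[of "Suc p"] by simp
  show ?case
    by (cases X) (auto simp: dstep_def tstep_def intro!: ncp_in_nadd ncp_in_nsub ncp_in_nmul ncp_in_nmon V)
qed

lemma only_X_at_arith:
  "only_X_at p f \<Longrightarrow> only_X_at p g \<Longrightarrow> only_X_at p (nadd f g)"
  "only_X_at p f \<Longrightarrow> only_X_at p g \<Longrightarrow> only_X_at p (nsub f g)"
  "only_X_at p f \<Longrightarrow> only_X_at p g \<Longrightarrow> only_X_at p (nmul f g)"
  unfolding only_X_at_def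
  by (simp add: nadd_def, metis add_0 add.right_neutral)
    (simp add: nsub_def, metis diff_self, fastforce dest!: nmul_apply_neq0)

lemma only_X_at_nmon: "(\<And>g. (p, g) \<in> set w \<Longrightarrow> g \<in> {XAp, XAm, XKP, XG}) \<Longrightarrow> only_X_at p (nmon c w)"
  by (auto simp: only_X_at_def nmon_def split: if_splits)

lemma rstring_only_X: "only_X_at (p + length r) (rstring s r p X)"
proof (induction r arbitrary: p X)
  case Nil
  show ?case by (auto simp: only_X_at_def nmon_def split: if_splits)
next
  case (Cons b r)
  have V: "only_X_at (Suc (p + length r)) (rstring s r (Suc p) X)" for X using Cons[of "Suc p"] by simp
  have z: "only_X_at q nzero" for q by (simp add: only_X_at_def nzero_def)
  show ?case
    by (cases X) (auto simp: dstep_def tstep_def intro!: only_X_at_arith only_X_at_nmon V z)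
qed

lemma ev_rstring: "ev s \<phi> (rstring s r p X) = sd s 1 * fstring \<phi> r p X"
proof (induction r arbitrary: p X)
  case Nil
  have "sd s (s^2 - 1/s^2) = sd s 1 * (Om :: 'a fam)" unfolding Om_def by (rule sd_sc)
  moreover have "sd s 0 = (0 :: 'a fam)" using sd_diff[of s 0 0] by simp
  ultimately show ?case by (auto simp: ev_nmon mult.assoc)
next
  case (Cons b r)
  have fin: "nfin (rstring s r q X)" for q X using rstring_ncp_in ncp_in_nfin by blast
  have O: "sd s (s^2 - 1/s^2) = sd s 1 * (Om :: 'a fam)" unfolding Om_def by (rule sd_sc)
  have T: "sd s (1/s) = sd s 1 * (TT :: 'a fam)" unfolding TT_def by (rule sd_sc)
  have ST: "sd s (s - 1/s) = sd s 1 * (SS - TT :: 'a fam)"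
    unfolding SS_def TT_def sc_diff[symmetric] by (rule sd_sc)
  have TT: "sd s (1 - 1/s*(1/s)) = sd s 1 * (1 - TT * TT :: 'a fam)"
    unfolding TT_def sc_mult[symmetric] sc_1[symmetric] sc_diff[symmetric] by (rule sd_sc)
  have TT': "sd s (1 - 1/(s*s)) = sd s 1 * (1 - TT * TT :: 'a fam)" using TT by simp
  have O': "sd s (1/s^2 - s^2) = - (sd s 1 * (Om :: 'a fam))"
    using sd_consts(6)[of s "s^2 - 1/s^2"] O by simp
  have c: "\<phi> l * (sd s 1 * y) = sd s 1 * (\<phi> l * y)" "sd s 1 * (sd s 1 * y) = sd s 1 * y"
    "Om * (sd s 1 * y) = sd s 1 * (Om * y)" "SS * (sd s 1 * y) = sd s 1 * (SS * y)"  "TT * (sd s 1 * y) = sd s 1 * (TT * y)" for l y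
    by (simp_all add: mult.assoc[symmetric] sd_central[of "\<phi> l"] sd_central[of Om] sd_central[of SS] sd_central[of TT])
      (simp add: sd_mult[symmetric])
  have Om: "\<phi> l * (Om * y) = Om * (\<phi> l * y)" for l y by (rule Om_left)
  note ev = ev_nadd ev_nsub ev_nmul ev_nmon ev_nzero nfin_binop fin Cons
  show ?case
    by (cases b; cases X)
      (simp_all add: dstep_def tstep_def Dstep_def Tstep_def ev O O' T ST TT TT' sd_consts(6) c Om algebra_simps del: of_nat_Suc)
qed

text \<open>Applying Delta or tau_R keeps all letters before the last position and replaces the
  quadruple there by a matrix times the quadruple one position further right. This lemma turns such
  a replacement into an entry appended to the string, although \<open>fstring\<close> recurses from
  the left.\<close>

lemma fstring_cong:
  assumes "\<And>q g. p \<le> q \<Longrightarrow> q < p + length r \<Longrightarrow> \<phi> (q, g) = \<psi> (q, g)"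
    and "\<And>X. fstring \<phi> [] (p + length r) X = fstring \<psi> r' (p + length r) X"
  shows "fstring \<phi> r p X = fstring \<psi> (r @ r') p X"
  using assms
proof (induction r arbitrary: p X)
  case Nil
  then show ?case by simp
next
  case (Cons b r)
  have "fstring \<phi> r (Suc p) = fstring \<psi> (r @ r') (Suc p)"
    by (rule ext, rule Cons.IH) (use Cons.prems in auto)
  moreover have "(\<lambda>g. \<phi> (p, g)) = (\<lambda>g. \<psi> (p, g))"
    using Cons.prems(1)[of p] by simp
  ultimately show ?case by simp
qed

lemma fstring_tau: "fstring (tau_img (p + length r)) r p X = (fstring gl (r @ [False]) p X :: 'k::field fam)"
proof (rule fstring_cong)
  fix Y :: sym
  have "Y \<in> {XAp, XAm, XKP, XG} \<or> Y \<notin> {XAp, XAm, XKP, XG}" by blast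
  then show "fstring (tau_img (p + length r)) [] (p + length r) Y = (fstring gl [False] (p + length r) Y :: 'k fam)"
    by (cases Y) (simp_all add: Tstep_def tau_img_coaction)
qed (simp add: tau_img_other)

lemma fstring_delta: "fstring (delta_img (p + length r)) r p X = (fstring gl (r @ [True]) p X :: 'k::field fam)"
proof (rule fstring_cong)
  fix Y :: sym
  show "fstring (delta_img (p + length r)) [] (p + length r) Y = (fstring gl [True] (p + length r) Y :: 'k fam)"
    by (cases Y; simp add: Dstep_def delta_img_coaction; (simp add: gl_X mult.assoc)?)
qed (simp add: delta_img_other)

lemma fstring_shift: "fstring (\<lambda>(i, g). \<phi> (i + d, g)) r p X = fstring \<phi> r (p + d) X"
proof (induction r arbitrary: p X)
  case (Cons b r)
  have "fstring (\<lambda>(i, g). \<phi> (i + d, g)) r (Suc p) = fstring \<phi> r (Suc p + d)"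
    using Cons by blast
  then show ?case by simp
qed simp

text \<open>
  The factor Oi = 1/(q - 1/q) undoes the rescaling of Gamma.
\<close>
definition represents :: "'k::field \<Rightarrow> bool list \<Rightarrow> 'k ncp \<Rightarrow> bool" where
  "represents s r x \<longleftrightarrow> ncp_in (Suc (length r)) x \<and> at_param s x = sd s 1 * (Oi * fstring gl r 0 XG)"

definition rep_ncp :: "'k::field \<Rightarrow> bool list \<Rightarrow> 'k ncp" where
  "rep_ncp s r = nmul (nconst (1 / (s^2 - 1/s^2))) (rstring s r 0 XG)"

lemma ev_rep_ncp: "ev s \<phi> (rep_ncp s r) = sd s 1 * (Oi * fstring \<phi> r 0 XG)"
proof -
  have fin: "nfin (rstring s r 0 XG)" using rstring_ncp_in ncp_in_nfin by blast
  have "ev s \<phi> (nconst c) = sd s c" for c by (simp add: ev_nmon flip: nmon_Nil)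
  moreover have "sd s (1 / (s^2 - 1/s^2)) = sd s 1 * (Oi :: 'a fam)" unfolding Oi_def by (rule sd_sc)
  ultimately have "ev s \<phi> (rep_ncp s r) = sd s 1 * Oi * (sd s 1 * fstring \<phi> r 0 XG)"
    by (simp add: rep_ncp_def ev_nmul fin ev_rstring)
  also have "\<dots> = sd s 1 * sd s 1 * (Oi * fstring \<phi> r 0 XG)"
    by (simp add: mult.assoc mult_assoc_rule[OF sd_central[of Oi]])
  finally show ?thesis by (simp add: sd_mult[symmetric])
qed

lemma rep_ncp_in: "ncp_in (Suc (length r)) (rep_ncp s r)"
  using rstring_ncp_in[of 0 r s XG] by (auto simp: rep_ncp_def)

lemma rep_ncp_only_X: "only_X_at (length r) (rep_ncp s r)"
  unfolding rep_ncp_def nmon_Nil[symmetric]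
  using rstring_only_X[of 0 r s XG] by (auto intro!: only_X_at_arith only_X_at_nmon)

lemma at_rep_ncp: "at_param s (rep_ncp s r) = sd s 1 * (Oi * fstring gl r 0 XG)"
  using at_eq_ev[OF ncp_in_nfin[OF rep_ncp_in]] ev_rep_ncp by metis

lemma represents_ideal:
  assumes "generic s" "represents s r x"
  shows "nsub x (rep_ncp s r) \<in> osp_ideal s (Suc (length r))" "nsub (rep_ncp s r) x \<in> osp_ideal s (Suc (length r))"
proof -
  have x: "ncp_in (Suc (length r)) x" using assms(2) by (simp add: represents_def)
  have "at_param s x = at_param s (rep_ncp s r)" using assms(2) by (simp add: represents_def at_rep_ncp)
  then have "nsub x (rep_ncp s r) \<in> nideal s"
    using at_eq_iff[OF assms(1) ncp_in_nfin[OF x] ncp_in_nfin[OF rep_ncp_in]] by simp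
  then show "nsub x (rep_ncp s r) \<in> osp_ideal s (Suc (length r))"
    "nsub (rep_ncp s r) x \<in> osp_ideal s (Suc (length r))"
    using nideal_cut nideal_sym x rep_ncp_in by blast+
qed

lemma ncp_in_letter: "ncp_in k f \<Longrightarrow> f w \<noteq> 0 \<Longrightarrow> l \<in> set w \<Longrightarrow> fst l < k"
  unfolding ncp_in_def by (cases l) auto

lemma represents_delta:
  assumes "generic s" "represents s r x"
  shows "represents s (r @ [True]) (delta_op s (length r) x)"
proof -
  let ?p = "length r"
  have x: "ncp_in (Suc ?p) x" using assms(2) by (simp add: represents_def)
  have fin: "nfin x" "nfin (rep_ncp s r)" using x rep_ncp_in ncp_in_nfin by blast+
  have letter: "ncp_in (Suc (Suc ?p)) (delta_letter s ?p (i, g))" if "i < Suc ?p" for i g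
  proof -
    have d: "ncp_in (Suc (Suc ?p)) (dgen0 ?p g)" for g
      by (cases g) (auto intro!: ncp_in_nadd ncp_in_nmon)
    show ?thesis using that
      by (auto simp: delta_letter_def nlet_eq_nmon intro!: ncp_in_nmon ncp_in_nsubst nfin_expand d)
  qed
  have "ncp_in (Suc (Suc ?p)) (delta_op s ?p x)"
    unfolding delta_op_def
  proof (rule ncp_in_nsubst[OF fin(1)])
    fix w l assume "x w \<noteq> 0" "l \<in> set w"
    then show "ncp_in (Suc (Suc ?p)) (delta_letter s ?p l)"
      using ncp_in_letter[OF x] letter by (cases l) auto
  qed
  moreover have "at_param s (delta_op s ?p x) = ev s (delta_img ?p) x"
    unfolding delta_op_def by (rule at_nsubst) (simp_all add: fin nfin_delta_letter at_delta_letter)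
  moreover have "ev s (delta_img ?p) (nsub x (rep_ncp s r)) = 0"
    by (rule ev_osp_ideal[OF osp_letters_delta represents_ideal(1)[OF assms]])
  then have "ev s (delta_img ?p) x = sd s 1 * (Oi * fstring gl (r @ [True]) 0 XG)"
    by (simp add: ev_nsub fin ev_rep_ncp fstring_delta[of 0 r, simplified])
  ultimately show ?thesis by (simp add: represents_def)
qed

lemma represents_tau:
  assumes "generic s" "represents s r x"
  shows "represents s (r @ [False]) (tau_op s (length r) x)"
proof -
  let ?p = "length r"
  have x: "ncp_in (Suc ?p) x" using assms(2) by (simp add: represents_def)
  \<comment> \<open>\<open>rep_ncp s r\<close> is the witness that makes the choice in
    \<open>tau_op\<close> meaningful.\<close>
  have "\<exists>y e. ncp_in (Suc ?p) e \<and> only_X_at ?p e \<and> nsub e x \<in> osp_ideal s (Suc ?p) \<and> y = nsubst (tau_letter s ?p) e"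
    using rep_ncp_in rep_ncp_only_X represents_ideal(2)[OF assms] by blast
  then have "\<exists>e. ncp_in (Suc ?p) e \<and> only_X_at ?p e \<and> nsub e x \<in> osp_ideal s (Suc ?p)
      \<and> tau_op s ?p x = nsubst (tau_letter s ?p) e"
    unfolding tau_op_def by (rule someI_ex)
  then obtain e where e: "ncp_in (Suc ?p) e" "only_X_at ?p e" "nsub e x \<in> osp_ideal s (Suc ?p)"
      "tau_op s ?p x = nsubst (tau_letter s ?p) e" by blast
  have letter: "ncp_in (Suc (Suc ?p)) (tau_letter s ?p (i, g))" if "i < Suc ?p" for i g
  proof -
    have d: "ncp_in (Suc (Suc ?p)) (tau_gen s ?p g)" for g
      by (cases g) (auto simp: nlet_eq_nmon intro!: ncp_in_nadd ncp_in_nsub ncp_in_nmon)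
    show ?thesis using that
      by (auto simp: tau_letter_def nlet_eq_nmon intro!: ncp_in_nmon d)
  qed
  have fin: "nfin e" "nfin (rep_ncp s r)" using e(1) rep_ncp_in ncp_in_nfin by blast+
  have "nadd (nsub e x) (nsub x (rep_ncp s r)) = nsub e (rep_ncp s r)"
    by (simp add: nadd_def nsub_def)
  then have "nsub e (rep_ncp s r) \<in> osp_ideal s (Suc ?p)"
    using osp_ideal.add[OF e(3) represents_ideal(1)[OF assms]] by simp
  \<comment> \<open>The chosen e is unknown, but it differs from \<open>rep_ncp s r\<close> by an
    element of the ideal whose words have only generators of I_R at the last position; the image
    under tau_R can therefore be computed from \<open>rep_ncp s r\<close>.\<close>
  then have "ev s (tau_img ?p) (nsub e (rep_ncp s r)) = 0"
    by (rule ev_tau_ideal) (intro only_X_at_arith e(2) rep_ncp_only_X)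
  then have "ev s (tau_img ?p) e = sd s 1 * (Oi * fstring gl (r @ [False]) 0 XG)"
    by (simp add: ev_nsub fin ev_rep_ncp fstring_tau[of 0 r, simplified])
  moreover have "at_param s (tau_op s ?p x) = ev s (tau_img ?p) e"
    unfolding e(4) by (rule at_nsubst) (simp_all add: fin nfin_tau_letter at_tau_letter)
  moreover have "ncp_in (Suc (Suc ?p)) (tau_op s ?p x)"
    unfolding e(4)
  proof (rule ncp_in_nsubst[OF fin(1)])
    fix w l assume "e w \<noteq> 0" "l \<in> set w"
    then show "ncp_in (Suc (Suc ?p)) (tau_letter s ?p l)"
      using ncp_in_letter[OF e(1)] letter by (cases l) auto
  qed
  ultimately show ?thesis by (simp add: represents_def)
qed

lemma represents_taus:
  "generic s \<Longrightarrow> represents s r x \<Longrightarrow> represents s (r @ replicate j False) (taus s (length r) j x)"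
proof (induction j arbitrary: r x)
  case (Suc j)
  then show ?case using Suc.IH[OF Suc.prems(1) represents_tau[OF Suc.prems]]
    by simp
qed simp

lemma represents_mu:
  assumes "generic s" "represents s r x"
  shows "represents s (r @ True # replicate (b - length r - 1) False) (mu s (length r) b x)"
  using represents_taus[OF assms(1) represents_delta[OF assms], of "b - length r - 1"]
  by (simp add: mu_def)

lemma represents_gamma: "represents s [] (gamma_expr s 0)"
proof -
  have "nsub (nlet 0 XG) (expand s 0 XG) \<in> osp_ideal s 1"
    by (rule osp_ideal.gen[of 0]) (simp, unfold osp_rels_def, blast)
  then have "ev s gl (nsub (nlet 0 XG) (expand s 0 XG)) = 0"
    by (rule ev_osp_ideal[OF osp_letters_gl])
  then have "ev s gl (gamma_expr s 0) = sd s 1 * gl (0, XG)"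
    using nfin_expand[of s 0 XG] by (simp add: ev_nsub nlet_eq_nmon ev_nmon)
  moreover have "ncp_in 1 (gamma_expr s 0)"
    by (auto simp: gamma_expr_def intro!: ncp_in_nadd ncp_in_nmon)
  ultimately show ?thesis
    using at_eq_ev[OF ncp_in_nfin, of 1 "gamma_expr s 0" s] by (simp add: represents_def mult_assoc_rule[OF Om_Oi(2)])
qed

text \<open>The string \<open>r\<close> covers the positions before \<open>length r\<close>, where
  the quadruple currently sits. Each \<open>mu\<close> appends one True for Delta and one False for
  every integer skipped. The final position is absent from the string, as it carries a letter and no
  matrix.\<close>

lemma represents_foldl:
  assumes "generic s" "represents s r x" "sorted_wrt (<) (length r # bs)"
  shows "represents s (r @ map (\<lambda>i. i \<in> set (length r # bs)) [length r ..< last (length r # bs)])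
     (foldl (\<lambda>x (bp, b). mu s bp b x) x (zip (length r # bs) bs))"
  using assms(2,3)
proof (induction bs arbitrary: r x)
  case (Cons b bs)
  let ?r = "r @ True # replicate (b - length r - 1) False"
  have b: "length r < b" "length ?r = b" using Cons.prems(2) by auto
  have "represents s ?r (mu s (length r) b x)"
    by (rule represents_mu[OF assms(1) Cons.prems(1)])
  then have "represents s (?r @ map (\<lambda>i. i \<in> set (b # bs)) [b ..< last (b # bs)])
     (foldl (\<lambda>x (bp, b). mu s bp b x) (mu s (length r) b x) (zip (b # bs) bs))"
    using Cons.IH[of ?r] Cons.prems(2) unfolding b(2) by simp
  moreover have "map (\<lambda>i. i \<in> set (length r # b # bs)) [length r ..< last (length r # b # bs)]
      = True # replicate (b - length r - 1) False @ map (\<lambda>i. i \<in> set (b # bs)) [b ..< last (b # bs)]"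
  proof -
    have le: "b \<le> last (b # bs)" using Cons.prems(2) by (cases bs rule: rev_cases) auto
    obtain d where d: "last (b # bs) = b + d" using le le_Suc_ex by blast
    have "[length r ..< last (length r # b # bs)] = [length r ..< b] @ [b ..< last (b # bs)]"
    proof -
      have "last (length r # b # bs) = b + d" using d by simp
      then show ?thesis unfolding d using b(1) upt_add_eq_append[of "length r" b d] by simp
    qed
    then have "[length r ..< last (length r # b # bs)] = length r # [Suc (length r) ..< b] @ [b ..< last (b # bs)]"
      using b(1) by (simp add: upt_conv_Cons)
    moreover have "map (\<lambda>i. i \<in> set (length r # b # bs)) [Suc (length r) ..< b] = replicate (b - length r - 1) False"
      using Cons.prems(2) by (intro nth_equalityI) auto
    moreover have "map (\<lambda>i. i \<in> set (length r # b # bs)) [b ..< last (b # bs)] = map (\<lambda>i. i \<in> set (b # bs)) [b ..< last (b # bs)]"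
      using b(1) by auto
    ultimately show ?thesis by simp
  qed
  ultimately show ?case by simp
qed simp

text \<open>Position i of the tensor power stands for the integer i + 1, hence
  \<open>Suc i \<in> A\<close> and the bounds lowered by one. The range ends before
  \<open>Max A - 1\<close>, the position of the terminal quadruple.\<close>

lemma GammaA_represents:
  assumes s: "generic s" and A: "A \<noteq> {}" "A \<subseteq> {1..n}"
  shows "ncp_in n (GammaA s c A)"
    and "at_param s (GammaA s c A)
      = sd s 1 * (Oi * fstring gl (map (\<lambda>i. Suc i \<in> A) [Min A - 1 ..< Max A - 1]) (Min A - 1) XG)"
proof -
  have fin: "finite A" using A(2) finite_subset by blast
  define as where "as = sorted_list_of_set A"
  have as: "set as = A" "sorted_wrt (<) as" "as \<noteq> []"
    using fin A(1) by (auto simp: as_def)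
  obtain a1 as' where as_Cons: "as = a1 # as'" using as(3) by (cases as) auto
  have a1: "a1 = Min A" using as as_Cons fin by (intro Min_eqI[symmetric]) auto
  have a1_le: "\<And>a. a \<in> A \<Longrightarrow> a1 \<le> a" using fin by (simp add: a1)
  have last: "last as = Max A"
  proof (rule Max_eqI[symmetric])
    show "finite A" "last as \<in> A" using fin as(1,3) last_in_set by auto
    fix a assume "a \<in> A"
    then show "a \<le> last as" using as
      by (cases as rule: rev_cases) (auto simp: sorted_wrt_append)
  qed
  have pos: "1 \<le> a1" using A(2) as(1) as_Cons by auto
  define bs where "bs = map (\<lambda>a. a - a1) as'"
  have bs: "map (\<lambda>a. a - a1) as = 0 # bs" by (simp add: as_Cons bs_def)
  have sorted: "sorted_wrt (<) (0 # bs)"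
    unfolding bs[symmetric] sorted_wrt_map
  proof (rule sorted_wrt_mono_rel[OF _ as(2)])
    fix x y assume "x \<in> set as" "y \<in> set as" "x < y"
    then show "x - a1 < y - a1" using a1_le[of x] as(1) by auto
  qed
  let ?r = "map (\<lambda>i. i \<in> set (0 # bs)) [0 ..< last (0 # bs)]"
  have "represents s ?r (gam_core s (map (\<lambda>a. a - a1) as))"
    using represents_foldl[OF s represents_gamma, of bs] sorted unfolding gam_core_def bs by simp
  then have core: "ncp_in (Suc (length ?r)) (gam_core s (map (\<lambda>a. a - a1) as))"
      "at_param s (gam_core s (map (\<lambda>a. a - a1) as)) = sd s 1 * (Oi * fstring gl ?r 0 XG)"
    by (simp_all only: represents_def)
  define x where "x = gam_core s (map (\<lambda>a. a - a1) as)"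
  have x: "nfin x" "represents s ?r x"
    using core by (auto simp: x_def represents_def intro: ncp_in_nfin)
  have G: "GammaA s c A = shift (a1 - 1) x"
    using A(1) by (simp add: GammaA_def Let_def as_def[symmetric] as_Cons x_def)
  have len: "last (0 # bs) = Max A - a1"
    using as_Cons by (simp add: last[symmetric] bs_def last_map)
  have le: "a1 \<le> Max A" "Max A \<le> n" using A fin a1 by auto
  show "ncp_in n (GammaA s c A)"
    unfolding G shift_def
  proof (rule ncp_in_nsubst[OF x(1)])
    fix w l assume "x w \<noteq> 0" "l \<in> set w"
    then have "fst l < Suc (length ?r)" using ncp_in_letter core(1) x_def by blast
    then show "ncp_in n (case l of (i, g) \<Rightarrow> nlet (i + (a1 - 1)) g)"
      using len le pos by (cases l) (auto intro!: ncp_in_nlet)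
  qed
  let ?\<phi> = "\<lambda>(i, g). gl (i + (a1 - 1), g) :: 'a fam"
  have letters: "osp_letters ?\<phi>"
    using osp_letters_gl[where 'k = 'a] unfolding osp_letters_def by simp
  have "at_param s (shift (a1 - 1) x) = ev s ?\<phi> x"
    unfolding shift_def
  proof (rule at_nsubst[OF x(1)])
    show "nfin (case l of (i, g) \<Rightarrow> nlet (i + (a1 - 1)) g)" for l by (cases l) simp
    show "at_param s (case l of (i, g) \<Rightarrow> nlet (i + (a1 - 1)) g) = sd s 1 * ?\<phi> l" for l
      by (cases l) (simp add: nlet_eq_nmon at_nmon)
  qed
  also have "\<dots> = sd s 1 * (Oi * fstring ?\<phi> ?r 0 XG)"
    using ev_osp_ideal[OF letters represents_ideal(1)[OF s x(2)]]
    by (simp add: ev_nsub x(1) ncp_in_nfin[OF rep_ncp_in] ev_rep_ncp)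
  also have "fstring ?\<phi> ?r 0 XG = fstring gl ?r (a1 - 1) XG"
    using fstring_shift[of gl "a1 - 1" ?r 0 XG] by simp
  also have "?r = map (\<lambda>i. Suc i \<in> A) [a1 - 1 ..< Max A - 1]"
  proof (rule nth_equalityI)
    show "length ?r = length (map (\<lambda>i. Suc i \<in> A) [a1 - 1 ..< Max A - 1])"
      using len pos by simp
    fix i assume "i < length ?r"
    then have i: "i < Max A - a1" using len by simp
    have "i \<in> set (0 # bs) \<longleftrightarrow> i + a1 \<in> A"
      unfolding bs[symmetric] as(1)[symmetric] using a1_le as(1) by (auto intro: rev_image_eqI)
    then show "?r ! i = map (\<lambda>i. Suc i \<in> A) [a1 - 1 ..< Max A - 1] ! i"
      using i len pos by (simp add: add.commute)
  qed
  finally show "at_param s (GammaA s c A)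
      = sd s 1 * (Oi * fstring gl (map (\<lambda>i. Suc i \<in> A) [Min A - 1 ..< Max A - 1]) (Min A - 1) XG)"
    unfolding G a1 .
qed

section \<open>Commutation\<close>

text \<open>The quadruple built on the positions from p to N. At N it has the terminal letters;
  membership in A is consulted only for the positions before N.\<close>

definition casimir :: "nat set \<Rightarrow> nat \<Rightarrow> nat \<Rightarrow> sym \<Rightarrow> 'k::field fam" where
  "casimir A N p = fstring gl (map (\<lambda>i. i \<in> A) [p ..< N]) p"

lemma casimir_rec: "p < N \<Longrightarrow> casimir A N p =
    (if p \<in> A then Dstep else Tstep) (\<lambda>g. gl (p, g)) (casimir A N (Suc p))"
  by (simp add: casimir_def upt_conv_Cons fun_eq_iff)

lemma casimir_base: "casimir A N N XAp = gl (N, XAp)" "casimir A N N XAm = Om * gl (N, XAm)"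
  "casimir A N N XKP = gl (N, XKP)" "casimir A N N XG = Om * gl (N, XG)"
  by (simp_all add: casimir_def)

lemma commutes_steps:
  assumes "\<And>Y. commutes (V Y) z" "\<And>g. commutes (\<phi> g) z"
  shows "commutes (Dstep \<phi> V X) z" "commutes (Tstep \<phi> V X) z"
  by (cases X; auto simp: Dstep_def Tstep_def intro!: commutes_intros commutes_fam assms)+

lemma casimir_commutes_gl:
  assumes "p \<le> N" "q < p"
  shows "commutes (casimir A N p X) (gl (q, g) :: 'k::field fam)"
  using assms
proof (induction arbitrary: X rule: inc_induct)
  case base
  then show ?case
    by (auto simp: casimir_def intro!: commutes_intros commutes_fam commutes_gl)
next
  case (step p)
  then show ?case
    by (auto simp: casimir_rec intro!: commutes_steps commutes_gl)
qed

abbreviation exchanging :: "(sym \<Rightarrow> 'k::field fam) \<Rightarrow> (sym \<Rightarrow> 'k fam) \<Rightarrow> bool" where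
  "exchanging u w \<equiv> fam.exch (u XAp) (u XAm) (u XKP) (u XG) (w XAp) (w XAm) (w XKP) (w XG)"

lemma exchanging_casimir:
  assumes "B \<subseteq> A" "b < N \<Longrightarrow> b \<in> A" "b \<le> N" "p \<le> b"
  shows "exchanging (casimir A N p) (casimir B b p :: sym \<Rightarrow> 'k::field fam)"
  using assms(4)
proof (induction rule: inc_induct)
  case base
  show ?case
  proof (cases "b < N")
    case False
    then have "b = N" using assms(3) by simp
    show ?thesis
      unfolding \<open>b = N\<close> casimir_base gl_X mult.assoc[symmetric]
      by (rule osp_site.site_exch[OF site_gl])
  next
    case True
    let ?V = "casimir A N (Suc b) :: sym \<Rightarrow> 'k fam"
    have comm: "v * l = l * v" if "v \<in> {?V XAp, ?V XAm, ?V XKP, ?V XG}"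
      "l \<in> {gl (b, Ap), Om * gl (b, Am), gl (b, Kp), gl (b, Km), gl (b, Pp)}" for v l
    proof -
      have "commutes l v"
        using that True by (elim insertE emptyE) (auto intro!: commutes_intros commutes_fam commutes_sym[OF casimir_commutes_gl])
      then show ?thesis by (simp add: commutes_def)
    qed
    show ?thesis
      using osp_site.delta_exch_base[OF site_gl comm] True assms(2)
      by (simp add: casimir_rec casimir_base Dstep_def gl_X mult.assoc)
  qed
next
  case (step p)
  let ?V = "casimir A N (Suc p) :: sym \<Rightarrow> 'k fam" and ?W = "casimir B b (Suc p) :: sym \<Rightarrow> 'k fam"
  have comm: "v * l = l * v" if "v \<in> {?V XAp, ?V XAm, ?V XKP, ?V XG, ?W XAp, ?W XAm, ?W XKP, ?W XG}"
    "l \<in> {gl (p, Ap), Om * gl (p, Am), gl (p, Kp), gl (p, Km), gl (p, Pp)}" for v l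
  proof -
    have "commutes l v"
      using that step assms(3) by (elim insertE emptyE) (auto intro!: commutes_intros commutes_fam commutes_sym[OF casimir_commutes_gl])
    then show ?thesis by (simp add: commutes_def)
  qed
  note rules = osp_site.exch_delta_delta[OF site_gl comm step.IH] osp_site.exch_delta_tau[OF site_gl comm step.IH]
    osp_site.exch_tau_tau[OF site_gl comm step.IH]
  have "p < N" using step assms(3) by simp
  note recs = casimir_rec[OF \<open>p < N\<close>, of A] casimir_rec[OF step.hyps(2), of B]
  \<comment> \<open>The fourth combination, tau_R for A against Delta for B, is excluded by B
    \<subseteq> A.\<close>
  consider "p \<in> A" "p \<in> B" | "p \<in> A" "p \<notin> B" | "p \<notin> A" "p \<notin> B" using assms(1) by blast
  then show ?case
  proof cases
    case 1
    show ?thesis unfolding recs by (simp only: 1 if_True Dstep_def sym.case) (rule rules)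
  next
    case 2
    show ?thesis unfolding recs by (simp only: 2 if_True if_False Dstep_def Tstep_def sym.case) (rule rules)
  next
    case 3
    show ?thesis unfolding recs by (simp only: 3 if_False Tstep_def sym.case) (rule rules)
  qed
qed

text \<open>Goes on to the left of B, where Gamma_B has tensor factor 1. The matrix entries at such
  a position commute with w_g, and so do the elements that they multiply, by induction; from here on
  only commutation with w_g is carried along.\<close>

lemma casimir_commute:
  assumes "B \<subseteq> A" "b < N \<Longrightarrow> b \<in> A" "b \<le> N" "q \<le> b" "p \<le> q" "X \<in> {XAp, XAm, XKP, XG}"
  shows "commutes (casimir A N p X) (casimir B b q XG :: 'k::field fam)"
  using assms(5,6)
proof (induction arbitrary: X rule: inc_induct)
  case base
  then show ?case
    using exchanging_casimir[OF assms(1-4), where 'k = 'k]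
    by (auto simp: fam.exch_def commutes_def)
next
  case (step p)
  have "p < N" using step assms by simp
  have g: "commutes (gl (p, g)) (casimir B b q XG :: 'k fam)" for g
    using step assms(4) by (intro commutes_sym[OF casimir_commutes_gl]) auto
  show ?case
    using step.prems \<open>p < N\<close>
    by (auto simp: casimir_rec Dstep_def Tstep_def intro!: commutes_intros commutes_fam g step.IH)
qed

theorem theorem8p2:
  fixes s :: "'k::field" and c :: 'k and n :: nat and A B :: "nat set"
  assumes "s \<noteq> 0"
    and "\<forall>m::nat. m > 0 \<longrightarrow> (s^2)^m \<noteq> 1"
    and "n \<ge> 1"
    and "A \<subseteq> {1..n}" and "B \<subseteq> A"
  shows "nsub (nmul (GammaA s c A) (GammaA s c B)) (nmul (GammaA s c B) (GammaA s c A))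
           \<in> osp_ideal s n"
proof (cases "A = {} \<or> B = {}")
  case True
  then have "GammaA s c A = nconst c \<or> GammaA s c B = nconst c" by (auto simp: GammaA_def)
  then have "nmul (GammaA s c A) (GammaA s c B) = nmul (GammaA s c B) (GammaA s c A)"
    by (auto simp: nmul_nconst_left nmul_nconst_right)
  then show ?thesis by (simp add: nsub_self osp_ideal.zero)
next
  case False
  \<comment> \<open>The instance m = 2 says q^2 \<noteq> 1, so that q - 1/q is invertible.\<close>
  have "(s^2)^2 \<noteq> 1" using assms(2) by (metis zero_less_numeral)
  then have s: "generic s" using assms(1) by (simp add: generic_def)
  have ne: "A \<noteq> {}" "B \<noteq> {}" using False by auto
  have Bn: "B \<subseteq> {1..n}" using assms(4,5) by blast
  have fin: "finite A" "finite B" using assms(4) Bn finite_subset by blast+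
  let ?A = "{i. Suc i \<in> A}" and ?B = "{i. Suc i \<in> B}"
  note GA = GammaA_represents[OF s ne(1) assms(4), of c] and GB = GammaA_represents[OF s ne(2) Bn, of c]
  define a b where "a = (casimir ?A (Max A - 1) (Min A - 1) XG :: 'k fam)"
    and "b = (casimir ?B (Max B - 1) (Min B - 1) XG :: 'k fam)"
  have at_param: "at_param s (GammaA s c A) = sd s 1 * (Oi * a)" "at_param s (GammaA s c B) = sd s 1 * (Oi * b)"
    using GA(2) GB(2) by (simp_all add: a_def b_def casimir_def)
  have mem: "Min A \<in> A" "Max A \<in> A" "Min B \<in> B" "Max B \<in> B" using fin ne by auto
  have le: "Min A \<le> Min B" "Min B \<le> Max B" "Max B \<le> Max A" "1 \<le> Min A"
    using fin ne mem assms(4,5) by auto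
  have "commutes a b"
    unfolding a_def b_def
  proof (rule casimir_commute)
    show "Max B - 1 \<in> ?A" using mem le assms(5) by auto
  qed (use le assms(5) in auto)
  then have "commutes (sd s 1 * (Oi * a)) (sd s 1 * (Oi * b))"
  proof -
    have sd: "commutes (sd s 1) z" for z :: "'k fam" by (simp add: commutes_def sd_central)
    show ?thesis
      by (intro commutes_intros sd commutes_fam commutes_sym[OF commutes_intros(4)] commutes_sym[OF sd]
          commutes_sym[OF commutes_fam(4)]) (rule commutes_sym[OF \<open>commutes a b\<close>])
  qed
  then have "at_param s (nsub (nmul (GammaA s c A) (GammaA s c B)) (nmul (GammaA s c B) (GammaA s c A))) = 0"
    using ncp_in_nfin[OF GA(1)] ncp_in_nfin[OF GB(1)]
    by (simp add: at_arith nfin_binop at_param commutes_def)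
  moreover have in_n: "ncp_in n (nsub (nmul (GammaA s c A) (GammaA s c B)) (nmul (GammaA s c B) (GammaA s c A)))"
    by (intro ncp_in_nsub ncp_in_nmul GA(1) GB(1))
  \<comment> \<open>Vanishing of the component at s gives membership in the union of the ideals; as
    the commutator lives on n positions, \<open>nideal_cut\<close> brings it into the ideal for
    n.\<close>
  ultimately show ?thesis
    using at_eq_0_iff[OF s ncp_in_nfin[OF in_n]] nideal_cut by blast
qed

end
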